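(* Let $T$ be a completely non-unitary contraction in a separable Hilbert space $H$, and let $$\Phi_T(\lambda)=\bigl(-T+\lambda D_{T^*}(I_H-\lambda T^* )^{-1}D_T\bigr)\!\upharpoonright\mathfrak D_T,\qquad \lambda\in\mathbb D,$$ be the Sz.-Nagy--Foias characteristic function of $T$ (a function in $\mathbf S(\mathfrak D_T,\mathfrak D_{T^*})$). If $\{\Gamma_n\}_{n\ge0}$ are the Schur parameters of $\Phi_T$, then $T$ is unitarily equivalent to the truncated block operator CMV matrices $\mathcal T_0(\{\Gamma_n^*\}_{n\ge0})$ and $\widetilde{\mathcal T}_0(\{\Gamma_n^*\}_{n\ge0})$.
   Context: A contraction is completely non-unitary if it has no nontrivial reducing subspace on which it acts as a unitary operator. $\mathbb D=\{|\lambda|<1\}$. $\mathbf L(\mathfrak H_1,\mathfrak H_2)$ denotes the bounded linear operators from the complex Hilbert space $\mathfrak H_1$ to $\mathfrak H_2$. For a contraction $T\in\mathbf L(\mathfrak H_1,\mathfrak H_2)$: $D_T=(I-T^*T)^{1/2}$, $D_{T^*}=(I-TT^* )^{1/2}$, $\mathfrak D_T=\overline{\mathrm{ran}}\,D_T$, $\mathfrak D_{T^*}=\overline{\mathrm{ran}}\,D_{T^*}$ (either may be $\{0\}$). The elementary rotation of $T$ is the unitary operator $$\mathbf J_T=\begin{bmatrix}T&D_{T^*}\\ D_T&-T^*\end{bmatrix}:\mathfrak H_1\oplus\mathfrak D_{T^*}\to\mathfrak H_2\oplus\mathfrak D_T ,$$ with rows/columns belonging to zero spaces omitted: it is the row $[T\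 \ I_{\mathfrak D_{T^*}}]$ if $T$ is isometric, the column $\begin{bmatrix}T\\ D_T\end{bmatrix}$ if $T$ is co-isometric, and $T$ if $T$ is unitary. Schur class and Schur parameters. $\mathbf S(\mathfrak M,\mathfrak N)$ is the set of holomorphic functions on $\mathbb D$ whose values are contractions in $\mathbf L(\mathfrak M,\mathfrak N)$. For $\Theta\in\mathbf S(\mathfrak M,\mathfrak N)$ put $\Theta_0=\Theta$, $\Gamma_0=\Theta(0)$; given $\Theta_n$ and $\Gamma_n=\Theta_n(0)$, let $\Theta_{n+1}\in\mathbf S(\mathfrak D_{\Gamma_n},\mathfrak D_{\Gamma_n^*})$ be the unique function with $$\Theta_n(\lambda)=\Gamma_n+\lambda D_{\Gamma_n^*}\Theta_{n+1}(\lambda)\bigl(I+\lambda\Gamma_n^*\Theta_{n+1}(\lambda)\bigr)^{-1}D_{\Gamma_n},\quad\lambda\in\mathbb D,$$ and $\Gamma_{n+1}=\Theta_{n+1}(0)$. The contractions $\Gamma_0\in\mathbf L(\mathfrak M,\mathfrak N)$, $\Gamma_n\in\mathbf L(\mathfrak D_{\Gamma_{n-1}},\mathfrak D_{\Gamma_{n-1}^*})$ are the Schur parameters of $\Theta$. If some $\Gamma_N$ is unitary the process terminates at $N$; then for $n>N$ all the spaces $\mathfrak D_{\Gamma_n},\mathfrak D_{\Gamma_n^*}$ are taken to be $\{0\}$ and $\Gamma_n=0$. If $\Gamma_N$ is isometric or co-isometric then $\Gamma_n=0$ for $n>N$. A sequence of contractions $\Gamma_0\in\mathbf L(\mathfrak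 M,\mathfrak N)$, $\Gamma_n\in\mathbf L(\mathfrak D_{\Gamma_{n-1}},\mathfrak D_{\Gamma_{n-1}^*})$, $n\ge 1$, is called a choice sequence. (Truncated) block operator CMV matrices. For a choice sequence $\{\Gamma_n\}_{n\ge0}$ starting from $\Gamma_0\in\mathbf L(\mathfrak M,\mathfrak N)$ let $$\mathfrak H_0=\bigoplus_{n\ge0}(\mathfrak D_{\Gamma_{2n}}\oplus\mathfrak D_{\Gamma^*_{2n+1}}),\qquad \widetilde{\mathfrak H}_0=\bigoplus_{n\ge0}(\mathfrak D_{\Gamma^*_{2n}}\oplus\mathfrak D_{\Gamma_{2n+1}})$$ (Hilbert space orthogonal sums; zero summands omitted). Here $\mathbf J_{\Gamma_0}:\mathfrak M\oplus\mathfrak D_{\Gamma_0^*}\to\mathfrak N\oplus\mathfrak D_{\Gamma_0}$ and $\mathbf J_{\Gamma_k}:\mathfrak D_{\Gamma_{k-1}}\oplus\mathfrak D_{\Gamma_k^*}\to\mathfrak D_{\Gamma_{k-1}^*}\oplus\mathfrak D_{\Gamma_k}$, $k\ge1$. Writing $\mathfrak M\oplus\widetilde{\mathfrak H}_0=(\mathfrak M\oplus\mathfrak D_{\Gamma_0^*})\oplus\bigoplus_{n\ge1}(\mathfrak D_{\Gamma_{2n-1}}\oplus\mathfrak D_{\Gamma_{2n}^*})$ and $\mathfrak N\oplus\mathfrak H_0=(\mathfrak N\oplus\mathfrak D_{\Gamma_0})\oplus\bigoplus_{n\ge1}(\mathfrak D_{\Gamma_{2n-1}^*}\oplus\mathfrak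 D_{\Gamma_{2n}})$, define the unitary operators $$\mathcal L_0=\mathbf J_{\Gamma_0}\oplus\bigoplus_{n\ge1}\mathbf J_{\Gamma_{2n}}:\mathfrak M\oplus\widetilde{\mathfrak H}_0\to\mathfrak N\oplus\mathfrak H_0,\qquad \mathcal V_0=\bigoplus_{n\ge1}\mathbf J_{\Gamma_{2n-1}}:\mathfrak H_0\to\widetilde{\mathfrak H}_0,$$ $$\mathcal U_0=\mathcal L_0(I_{\mathfrak M}\oplus\mathcal V_0):\mathfrak M\oplus\mathfrak H_0\to\mathfrak N\oplus\mathfrak H_0,\qquad \widetilde{\mathcal U}_0=(I_{\mathfrak N}\oplus\mathcal V_0)\mathcal L_0:\mathfrak M\oplus\widetilde{\mathfrak H}_0\to\mathfrak N\oplus\widetilde{\mathfrak H}_0 .$$ The truncated block operator CMV matrices are the contractions $$\mathcal T_0(\{\Gamma_n\}_{n\ge0})=P_{\mathfrak H_0}\mathcal U_0\!\upharpoonright\mathfrak H_0\in\mathbf L(\mathfrak H_0),\qquad \widetilde{\mathcal T}_0(\{\Gamma_n\}_{n\ge0})=P_{\widetilde{\mathfrak H}_0}\widetilde{\mathcal U}_0\!\upharpoonright\widetilde{\mathfrak H}_0\in\mathbf L(\widetilde{\mathfrak H}_0).$$ If $\{\Gamma_n\}$ is a choice sequence with $\Gamma_0\in\mathbf L(\mathfrak M,\mathfrak N)$, then $\{\Gamma_n^*\}$ is a choice sequence with $\Gamma_0^*\in\mathbf L(\mathfrak N,\mathfrak M)$, and $\mathcal T_0(\{\Gamma_n^*\})$,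 $\widetilde{\mathcal T}_0(\{\Gamma_n^*\})$ are obtained by applying the construction to it. *)

theory Defs
  imports "HOL-Analysis.Analysis"
begin

section \<open>Complex Hilbert spaces\<close>

text \<open>
  A complex inner product space is a real inner product space (norm and topology are the ones
  of \<open>inner\<close>) with a compatible complex scalar multiplication and a sesquilinear form
  \<open>cinner\<close>, linear in its first argument, whose real part is \<open>inner\<close>.
  Positive definiteness is inherited from \<open>inner\<close>.
\<close>

class complex_inner = real_inner +
  fixes scaleC :: "complex \<Rightarrow> 'a \<Rightarrow> 'a"  (infixr \<open>*\<^sub>C\<close> 75)
    and cinner :: "'a \<Rightarrow> 'a \<Rightarrow> complex"
  assumes scaleC_add_right: "a *\<^sub>C (x + y) = a *\<^sub>C x + a *\<^sub>C y"
    and scaleC_add_left: "(a + b) *\<^sub>C x = a *\<^sub>C x + b *\<^sub>C x"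
    and scaleC_scaleC: "a *\<^sub>C b *\<^sub>C x = (a * b) *\<^sub>C x"
    and scaleR_scaleC: "r *\<^sub>R x = complex_of_real r *\<^sub>C x"
    and cinner_commute: "cinner x y = cnj (cinner y x)"
    and cinner_add_left: "cinner (x + y) z = cinner x z + cinner y z"
    and cinner_scaleC_left: "cinner (a *\<^sub>C x) y = a * cinner x y"
    and inner_eq_Re_cinner: "inner x y = Re (cinner x y)"

class complex_hilbert = complex_inner + complete_space

instantiation prod :: (complex_inner, complex_inner) complex_inner
begin

definition scaleC_prod_def: "a *\<^sub>C p = (a *\<^sub>C fst p, a *\<^sub>C snd p)"

definition cinner_prod_def: "cinner p q = cinner (fst p) (fst q) + cinner (snd p) (snd q)"

instance
proof
  fix a b :: complex and r :: real and x y z :: "'a \<times> 'b"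
  show "a *\<^sub>C (x + y) = a *\<^sub>C x + a *\<^sub>C y"
    by (simp add: scaleC_prod_def scaleC_add_right)
  show "(a + b) *\<^sub>C x = a *\<^sub>C x + b *\<^sub>C x"
    by (simp add: scaleC_prod_def scaleC_add_left)
  show "a *\<^sub>C b *\<^sub>C x = (a * b) *\<^sub>C x"
    by (simp add: scaleC_prod_def scaleC_scaleC)
  show "r *\<^sub>R x = complex_of_real r *\<^sub>C x"
    by (simp add: scaleC_prod_def scaleR_prod_def scaleR_scaleC)
  show "cinner x y = cnj (cinner y x)"
    using cinner_commute [of "fst x" "fst y"] cinner_commute [of "snd x" "snd y"]
    by (simp add: cinner_prod_def)
  show "cinner (x + y) z = cinner x z + cinner y z"
    by (simp add: cinner_prod_def cinner_add_left)
  show "cinner (a *\<^sub>C x) y = a * cinner x y"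
    by (simp add: cinner_prod_def scaleC_prod_def cinner_scaleC_left distrib_left)
  show "inner x y = Re (cinner x y)"
    by (simp add: cinner_prod_def inner_prod_def inner_eq_Re_cinner)
qed

end

instance prod :: (complex_hilbert, complex_hilbert) complex_hilbert ..


section \<open>Operators\<close>

definition bounded_clinear :: "('a::complex_inner \<Rightarrow> 'b::complex_inner) \<Rightarrow> bool" where
  "bounded_clinear A \<longleftrightarrow> bounded_linear A \<and> (\<forall>c x. A (c *\<^sub>C x) = c *\<^sub>C A x)"

definition contraction :: "('a::complex_inner \<Rightarrow> 'b::complex_inner) \<Rightarrow> bool" where
  "contraction A \<longleftrightarrow> bounded_clinear A \<and> (\<forall>x. norm (A x) \<le> norm x)"

definition closed_csubspace :: "'a::complex_inner set \<Rightarrow> bool" where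
  "closed_csubspace X \<longleftrightarrow> closed X \<and> subspace X \<and> (\<forall>c. \<forall>x\<in>X. c *\<^sub>C x \<in> X)"

text \<open>
  All Hilbert spaces entering the Schur algorithm and the CMV matrices are closed subspaces of two
  fixed ambient spaces. An operator from a closed subspace \<open>X\<close> to a closed subspace \<open>Y\<close> is
  represented by its extension by zero to the ambient space, i.e. by an ambient operator with range
  in \<open>Y\<close> that vanishes on the orthogonal complement of \<open>X\<close>. The adjoint of such an extension is the
  extension by zero of the adjoint from \<open>Y\<close> to \<open>X\<close>.
\<close>

definition operators :: "'a::complex_inner set \<Rightarrow> 'b::complex_inner set \<Rightarrow> ('a \<Rightarrow> 'b) set" where
  "operators X Y =
     {A. bounded_clinear A \<and> range A \<subseteq> Y \<and> (\<forall>x. (\<forall>z\<in>X. cinner x z = 0) \<longrightarrow> A x = 0)}"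

definition adj :: "('a::complex_inner \<Rightarrow> 'b::complex_inner) \<Rightarrow> 'b \<Rightarrow> 'a" where
  "adj A = (THE B. \<forall>x y. cinner (A x) y = cinner x (B y))"

definition ortho_proj :: "'a::complex_inner set \<Rightarrow> 'a \<Rightarrow> 'a" where
  "ortho_proj X x = (THE y. y \<in> X \<and> (\<forall>z\<in>X. cinner (x - y) z = 0))"

definition positive_op :: "('a::complex_inner \<Rightarrow> 'a) \<Rightarrow> bool" where
  "positive_op A \<longleftrightarrow> bounded_clinear A \<and> (\<forall>x. cinner (A x) x \<in> \<real>\<^sub>\<ge>\<^sub>0)"

definition sqrt_op :: "('a::complex_inner \<Rightarrow> 'a) \<Rightarrow> 'a \<Rightarrow> 'a" where
  "sqrt_op A = (THE S. positive_op S \<and> S \<circ> S = A)"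

text \<open>
  The defect operator \<open>(I - A\<^sup>* A)\<^sup>1\<^sup>/\<^sup>2\<close> of a contraction \<open>A\<close> with domain \<open>X\<close>. The identity of \<open>X\<close>,
  extended by zero, is the orthogonal projection onto \<open>X\<close>, so that the defect operator is again
  extended by zero. For \<open>X = UNIV\<close> the projection is the identity.
\<close>

definition defect_op :: "'a::complex_inner set \<Rightarrow> ('a \<Rightarrow> 'b::complex_inner) \<Rightarrow> 'a \<Rightarrow> 'a" where
  "defect_op X A = sqrt_op (\<lambda>x. ortho_proj X x - adj A (A x))"

definition defect_space :: "'a::complex_inner set \<Rightarrow> ('a \<Rightarrow> 'b::complex_inner) \<Rightarrow> 'a set" where
  "defect_space X A = closure (range (defect_op X A))"

definition completely_nonunitary :: "('a::complex_inner \<Rightarrow> 'a) \<Rightarrow> bool" where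
  "completely_nonunitary T \<longleftrightarrow>
     (\<forall>K. closed_csubspace K \<and> T ` K \<subseteq> K \<and> adj T ` K \<subseteq> K \<and>
          T ` K = K \<and> (\<forall>x\<in>K. norm (T x) = norm x) \<longrightarrow> K = {0})"


section \<open>The Schur class and Schur parameters\<close>

text \<open>Holomorphy is complex differentiability with respect to the operator norm.\<close>

definition operator_holomorphic_on ::
    "(complex \<Rightarrow> 'a::complex_inner \<Rightarrow> 'b::complex_inner) \<Rightarrow> complex set \<Rightarrow> bool" where
  "operator_holomorphic_on \<Theta> S \<longleftrightarrow>
     (\<forall>z\<in>S. \<exists>B. bounded_clinear B \<and>
        ((\<lambda>w. onorm (\<lambda>x. (1 / (w - z)) *\<^sub>C (\<Theta> w x - \<Theta> z x) - B x)) \<longlongrightarrow> 0) (at z within S))"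

definition schur_class ::
    "'a::complex_inner set \<Rightarrow> 'b::complex_inner set \<Rightarrow> (complex \<Rightarrow> 'a \<Rightarrow> 'b) set" where
  "schur_class X Y =
     {\<Theta>. operator_holomorphic_on \<Theta> (ball 0 1) \<and>
          (\<forall>z\<in>ball 0 1. \<Theta> z \<in> operators X Y \<and> contraction (\<Theta> z))}"

text \<open>
  \<open>defect_chain X \<Gamma> n\<close> is the domain of \<open>\<Gamma> n\<close>, and \<open>defect_chain X \<Gamma> (Suc n)\<close> the defect
  space of \<open>\<Gamma> n\<close>, for a choice sequence \<open>\<Gamma>\<close> whose first term has domain \<open>X\<close>. The spaces belonging
  to the adjoints are obtained from the sequence of adjoints.
\<close>

primrec defect_chain ::
    "'a::complex_inner set \<Rightarrow> (nat \<Rightarrow> 'a \<Rightarrow> 'b::complex_inner) \<Rightarrow> nat \<Rightarrow> 'a set" where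
  "defect_chain X \<Gamma> 0 = X"
| "defect_chain X \<Gamma> (Suc n) = defect_space (defect_chain X \<Gamma> n) (\<Gamma> n)"

definition defect_seq ::
    "'a::complex_inner set \<Rightarrow> (nat \<Rightarrow> 'a \<Rightarrow> 'b::complex_inner) \<Rightarrow> nat \<Rightarrow> 'a \<Rightarrow> 'a" where
  "defect_seq X \<Gamma> n = defect_op (defect_chain X \<Gamma> n) (\<Gamma> n)"

abbreviation adj_seq ::
    "(nat \<Rightarrow> 'a::complex_inner \<Rightarrow> 'b::complex_inner) \<Rightarrow> nat \<Rightarrow> 'b \<Rightarrow> 'a" where
  "adj_seq \<Gamma> \<equiv> (\<lambda>n. adj (\<Gamma> n))"

text \<open>
  \<open>\<Gamma>\<close> is the sequence of Schur parameters of \<open>\<Theta>\<close>, an operator function from \<open>M\<close> to \<open>N\<close>;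
  \<open>\<Psi> n\<close> is the \<open>n\<close>-th Schur iterate. The operator that is inverted leaves the defect space of \<open>\<Gamma> n\<close>
  and its orthogonal complement invariant and is the identity on the latter, so inverting it in the
  ambient space and in the defect space is the same on the range of the defect operator.
  After a unitary, isometric or co-isometric \<open>\<Gamma> k\<close> the space of operators to which all later
  parameters belong is \<open>{0}\<close>, so the conventions for terminating sequences need no special case.
\<close>

definition schur_parameters ::
    "'a::complex_inner set \<Rightarrow> 'b::complex_inner set \<Rightarrow> (complex \<Rightarrow> 'a \<Rightarrow> 'b) \<Rightarrow>
     (nat \<Rightarrow> 'a \<Rightarrow> 'b) \<Rightarrow> bool" where
  "schur_parameters M N \<Theta> \<Gamma> \<longleftrightarrow>
     (\<exists>\<Psi>. \<Psi> 0 = \<Theta> \<and>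
        (\<forall>n. \<Gamma> n = \<Psi> n 0) \<and>
        (\<forall>n. \<Psi> (Suc n) \<in>
           schur_class (defect_chain M \<Gamma> (Suc n)) (defect_chain N (adj_seq \<Gamma>) (Suc n))) \<and>
        (\<forall>n. \<forall>z\<in>ball 0 1. \<forall>x.
           \<Psi> n z x = \<Gamma> n x +
             z *\<^sub>C defect_seq N (adj_seq \<Gamma>) n
               (\<Psi> (Suc n) z
                 (inv (\<lambda>y. y + z *\<^sub>C adj (\<Gamma> n) (\<Psi> (Suc n) z y))
                   (defect_seq M \<Gamma> n x)))))"

text \<open>The restriction to the defect space is expressed as precomposition with its projection.\<close>

definition char_fun :: "('a::complex_inner \<Rightarrow> 'a) \<Rightarrow> complex \<Rightarrow> 'a \<Rightarrow> 'a" where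
  "char_fun T z x =
     (let p = ortho_proj (defect_space UNIV T) x in
        - T p + z *\<^sub>C defect_op UNIV (adj T)
                  (inv (\<lambda>y. y - z *\<^sub>C adj T y) (defect_op UNIV T p)))"


section \<open>Truncated block operator CMV matrices\<close>

text \<open>
  The Hilbert space orthogonal sum of the closed subspaces \<open>X n\<close>, as a set of sequences. Its inner
  product is \<open>\<Sum>n. cinner (f n) (g n)\<close>.
\<close>

definition hilbert_sum :: "(nat \<Rightarrow> 'a::complex_inner set) \<Rightarrow> (nat \<Rightarrow> 'a) set" where
  "hilbert_sum X = {f. (\<forall>n. f n \<in> X n) \<and> summable (\<lambda>n. (norm (f n))\<^sup>2)}"

text \<open>The \<open>n\<close>-th elementary rotation of a choice sequence starting from \<open>\<Gamma> 0 : M \<rightarrow> N\<close>.\<close>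

definition rotation ::
    "'a::complex_inner set \<Rightarrow> 'b::complex_inner set \<Rightarrow> (nat \<Rightarrow> 'a \<Rightarrow> 'b) \<Rightarrow> nat \<Rightarrow>
     'a \<times> 'b \<Rightarrow> 'b \<times> 'a" where
  "rotation M N \<Gamma> n =
     (\<lambda>(x, y). (\<Gamma> n x + defect_seq N (adj_seq \<Gamma>) n y, defect_seq M \<Gamma> n x - adj (\<Gamma> n) y))"

text \<open>The spaces \<open>H\<^sub>0\<close> and \<open>H\<^sub>0~\<close>, with the summands grouped in pairs.\<close>

definition cmv_space ::
    "'a::complex_inner set \<Rightarrow> 'b::complex_inner set \<Rightarrow> (nat \<Rightarrow> 'a \<Rightarrow> 'b) \<Rightarrow>
     (nat \<Rightarrow> 'a \<times> 'b) set" where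
  "cmv_space M N \<Gamma> = hilbert_sum (\<lambda>n.
     defect_chain M \<Gamma> (Suc (2 * n)) \<times> defect_chain N (adj_seq \<Gamma>) (Suc (2 * n + 1)))"

definition cmv_space_tilde ::
    "'a::complex_inner set \<Rightarrow> 'b::complex_inner set \<Rightarrow> (nat \<Rightarrow> 'a \<Rightarrow> 'b) \<Rightarrow>
     (nat \<Rightarrow> 'b \<times> 'a) set" where
  "cmv_space_tilde M N \<Gamma> = hilbert_sum (\<lambda>n.
     defect_chain N (adj_seq \<Gamma>) (Suc (2 * n)) \<times> defect_chain M \<Gamma> (Suc (2 * n + 1)))"

text \<open>
  The identification of \<open>A \<oplus> (B\<^sub>0 \<oplus> A\<^sub>0) \<oplus> (B\<^sub>1 \<oplus> A\<^sub>1) \<oplus> \<dots>\<close> with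
  \<open>(A \<oplus> B\<^sub>0) \<oplus> (A\<^sub>0 \<oplus> B\<^sub>1) \<oplus> \<dots>\<close> and its inverse.
\<close>

fun regroup :: "'a \<times> (nat \<Rightarrow> 'b \<times> 'a) \<Rightarrow> nat \<Rightarrow> 'a \<times> 'b" where
  "regroup (a, f) 0 = (a, fst (f 0))"
| "regroup (a, f) (Suc n) = (snd (f n), fst (f (Suc n)))"

definition ungroup :: "(nat \<Rightarrow> 'a \<times> 'b) \<Rightarrow> 'a \<times> (nat \<Rightarrow> 'b \<times> 'a)" where
  "ungroup g = (fst (g 0), \<lambda>n. (snd (g n), fst (g (Suc n))))"

definition cmv_L ::
    "'a::complex_inner set \<Rightarrow> 'b::complex_inner set \<Rightarrow> (nat \<Rightarrow> 'a \<Rightarrow> 'b) \<Rightarrow>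
     'a \<times> (nat \<Rightarrow> 'b \<times> 'a) \<Rightarrow> 'b \<times> (nat \<Rightarrow> 'a \<times> 'b)" where
  "cmv_L M N \<Gamma> p = ungroup (\<lambda>n. rotation M N \<Gamma> (2 * n) (regroup p n))"

definition cmv_V ::
    "'a::complex_inner set \<Rightarrow> 'b::complex_inner set \<Rightarrow> (nat \<Rightarrow> 'a \<Rightarrow> 'b) \<Rightarrow>
     (nat \<Rightarrow> 'a \<times> 'b) \<Rightarrow> (nat \<Rightarrow> 'b \<times> 'a)" where
  "cmv_V M N \<Gamma> h = (\<lambda>n. rotation M N \<Gamma> (2 * n + 1) (h n))"

definition cmv_U ::
    "'a::complex_inner set \<Rightarrow> 'b::complex_inner set \<Rightarrow> (nat \<Rightarrow> 'a \<Rightarrow> 'b) \<Rightarrow>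
     'a \<times> (nat \<Rightarrow> 'a \<times> 'b) \<Rightarrow> 'b \<times> (nat \<Rightarrow> 'a \<times> 'b)" where
  "cmv_U M N \<Gamma> = cmv_L M N \<Gamma> \<circ> map_prod id (cmv_V M N \<Gamma>)"

definition cmv_U_tilde ::
    "'a::complex_inner set \<Rightarrow> 'b::complex_inner set \<Rightarrow> (nat \<Rightarrow> 'a \<Rightarrow> 'b) \<Rightarrow>
     'a \<times> (nat \<Rightarrow> 'b \<times> 'a) \<Rightarrow> 'b \<times> (nat \<Rightarrow> 'b \<times> 'a)" where
  "cmv_U_tilde M N \<Gamma> = map_prod id (cmv_V M N \<Gamma>) \<circ> cmv_L M N \<Gamma>"

text \<open>These are operators on \<open>cmv_space M N \<Gamma>\<close> and \<open>cmv_space_tilde M N \<Gamma>\<close>, respectively.\<close>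

definition truncated_cmv ::
    "'a::complex_inner set \<Rightarrow> 'b::complex_inner set \<Rightarrow> (nat \<Rightarrow> 'a \<Rightarrow> 'b) \<Rightarrow>
     (nat \<Rightarrow> 'a \<times> 'b) \<Rightarrow> (nat \<Rightarrow> 'a \<times> 'b)" where
  "truncated_cmv M N \<Gamma> h = snd (cmv_U M N \<Gamma> (0, h))"

definition truncated_cmv_tilde ::
    "'a::complex_inner set \<Rightarrow> 'b::complex_inner set \<Rightarrow> (nat \<Rightarrow> 'a \<Rightarrow> 'b) \<Rightarrow>
     (nat \<Rightarrow> 'b \<times> 'a) \<Rightarrow> (nat \<Rightarrow> 'b \<times> 'a)" where
  "truncated_cmv_tilde M N \<Gamma> h = snd (cmv_U_tilde M N \<Gamma> (0, h))"


section \<open>Unitary equivalence\<close>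

text \<open>Unitary operators from a whole space onto a Hilbert space orthogonal sum \<open>H\<close> (a \<open>hilbert_sum\<close>).\<close>

definition unitary_onto_sum ::
    "('a::complex_inner \<Rightarrow> nat \<Rightarrow> 'b::complex_inner) \<Rightarrow> (nat \<Rightarrow> 'b) set \<Rightarrow> bool" where
  "unitary_onto_sum W H \<longleftrightarrow>
     (\<forall>x y n. W (x + y) n = W x n + W y n) \<and>
     (\<forall>c x n. W (c *\<^sub>C x) n = c *\<^sub>C W x n) \<and>
     (\<forall>x y. (\<lambda>n. cinner (W x n) (W y n)) sums cinner x y) \<and>
     range W = H"

definition unitarily_equivalent ::
    "('a::complex_inner \<Rightarrow> 'a) \<Rightarrow> (nat \<Rightarrow> 'b::complex_inner) set \<Rightarrow>
     ((nat \<Rightarrow> 'b) \<Rightarrow> (nat \<Rightarrow> 'b)) \<Rightarrow> bool" where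
  "unitarily_equivalent T H S \<longleftrightarrow>
     (\<exists>W. unitary_onto_sum W H \<and> (\<forall>x. W (T x) = S (W x)))"

end

theory Submission
  imports Defs
begin

text \<open>
  Let \<open>\<Theta>\<close> be the characteristic function of \<open>T\<close>, from \<open>\<DD>\<^sub>T\<close> to \<open>\<DD>\<^sub>T\<^sub>*\<close>. It is the transfer function of a
  unitary operator \<open>U\<^sup>* : \<DD>\<^sub>T \<oplus> H \<rightarrow> \<DD>\<^sub>T\<^sub>* \<oplus> H\<close>, where \<open>U = [-T\<^sup>* D\<^sub>T; D\<^sub>T\<^sub>* T]\<close> is in essence the elementary
  rotation of \<open>T\<close>: \<open>U\<^sup>* (m, z k) = (\<Theta> z m, k)\<close> for a suitable \<open>k\<close>. From any unitary
  \<open>U : M \<oplus> K \<rightarrow> N \<oplus> K\<close> with corner \<open>G : M \<rightarrow> N\<close> the rotation \<open>J\<^sub>G\<close> can be split off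
  (\<open>splits_off_exists\<close>): the defect space \<open>\<DD>\<^sub>G\<close> embeds isometrically in \<open>K\<close>, say with orthogonal complement
  \<open>K'\<close>, and \<open>U = (J\<^sub>G \<oplus> I) (I \<oplus> U'')\<close> with a unitary \<open>U'' : \<DD>\<^sub>G \<oplus> K' \<rightarrow> \<DD>\<^sub>G\<^sub>* \<oplus> K'\<close>. On
  transfer functions this is one step of the Schur algorithm (\<open>realizes_splits_off\<close>,
  \<open>realizes_adj_splits_off\<close>). So the corners of the operators that arise from repeated splitting are
  the Schur parameters of \<open>\<Theta>\<close> and their adjoints.

  Each splitting is applied to the inverse of the operator that the previous one leaves. The corners
  are then \<open>\<Gamma>\<^sub>0\<^sup>*, \<Gamma>\<^sub>1, \<Gamma>\<^sub>2\<^sup>*, \<Gamma>\<^sub>3, \<dots>\<close>, and the spaces that are split off from \<open>H\<close> are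
  \<open>\<DD>\<close> of these operators in turn: exactly the summands of the space of the CMV matrix of
  \<open>\<Gamma>\<^sub>0\<^sup>*, \<Gamma>\<^sub>1\<^sup>*, \<dots>\<close>. Following the equation \<open>U (0, h) = (n, T h)\<close> through all splittings
  (\<open>rotation_tower.trace\<close>) expresses the coordinates of \<open>T h\<close> in those of \<open>h\<close> by elementary
  rotations, and this expression is the factorization that defines the CMV matrix.

  What is never split off, the intersection of all state spaces, is a reducing subspace on which
  \<open>T\<close> is unitary, by the same bookkeeping with all coordinates zero; it is \<open>{0}\<close>
  because \<open>T\<close> is completely non-unitary. Hence the coordinates define a unitary operator
  (\<open>rotation_tower.unitary_pairs\<close>). The block diagonal factor \<open>cmv_V\<close> carries the first
  CMV matrix to the second, since the two are products of the same factors in opposite order.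
\<close>

section \<open>Complex inner products and bounded operators\<close>

instance complex_hilbert \<subseteq> banach ..

lemma scaleC_one [simp]: "1 *\<^sub>C x = (x::'a::complex_inner)"
  using scaleR_scaleC [of 1 x] by simp

lemma scaleC_zero_left [simp]: "0 *\<^sub>C x = (0::'a::complex_inner)"
  using scaleR_scaleC [of 0 x] by simp

lemma scaleC_zero_right [simp]: "c *\<^sub>C 0 = (0::'a::complex_inner)"
  using scaleC_add_right [of c "0::'a" 0] by simp

lemma scaleC_minus_right [simp]: "c *\<^sub>C (- x) = - (c *\<^sub>C (x::'a::complex_inner))"
  using scaleC_add_right [of c x "- x"] by (simp add: minus_unique)

lemma scaleC_minus_left [simp]: "(- c) *\<^sub>C x = - (c *\<^sub>C (x::'a::complex_inner))"
  using scaleC_add_left [of c "- c" x] by (simp add: minus_unique)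

lemma scaleC_diff_right: "c *\<^sub>C (x - y) = c *\<^sub>C x - c *\<^sub>C (y::'a::complex_inner)"
  using scaleC_add_right [of c x "- y"] by simp

lemma scaleC_diff_left: "(a - b) *\<^sub>C x = a *\<^sub>C x - b *\<^sub>C (x::'a::complex_inner)"
  using scaleC_add_left [of a "- b" x] by simp

lemma scaleC_inverse [simp]: "c \<noteq> 0 \<Longrightarrow> (1 / c) *\<^sub>C c *\<^sub>C x = (x::'a::complex_inner)"
  and scaleC_inverse' [simp]: "c \<noteq> 0 \<Longrightarrow> c *\<^sub>C (1 / c) *\<^sub>C x = x"
  by (simp_all add: scaleC_scaleC)

lemma cinner_zero_left [simp]: "cinner 0 y = 0"
  using cinner_scaleC_left [of 0 0 y] by simp

lemma cinner_zero_right [simp]: "cinner x 0 = 0"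
  by (subst cinner_commute) simp

lemma cinner_add_right: "cinner x (y + z) = cinner x y + cinner x z"
  using cinner_commute [of x "y + z"] cinner_commute [of x y] cinner_commute [of x z]
  by (simp add: cinner_add_left)

lemma cinner_scaleC_right: "cinner x (a *\<^sub>C y) = cnj a * cinner x y"
  using cinner_commute [of x "a *\<^sub>C y"] cinner_commute [of x y] by (simp add: cinner_scaleC_left)

lemma cinner_minus_left [simp]: "cinner (- x) y = - cinner x y"
  using cinner_add_left [of x "- x" y] by (simp add: minus_unique)

lemma cinner_minus_right [simp]: "cinner x (- y) = - cinner x y"
  using cinner_add_right [of x y "- y"] by (simp add: minus_unique)

lemma cinner_diff_left: "cinner (x - y) z = cinner x z - cinner y z"
  using cinner_add_left [of x "- y" z] by simp

lemma cinner_diff_right: "cinner x (y - z) = cinner x y - cinner x z"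
  using cinner_add_right [of x y "- z"] by simp

lemmas cinner_simps = cinner_add_left cinner_add_right cinner_diff_left cinner_diff_right
  cinner_scaleC_left cinner_scaleC_right

lemma cinner_self: "cinner x x = of_real ((norm x)\<^sup>2)"
proof -
  have "Im (cinner x x) = 0"
    using arg_cong [OF cinner_commute [of x x], of Im] by simp
  then show ?thesis
    by (simp add: complex_eq_iff power2_norm_eq_inner inner_eq_Re_cinner)
qed

lemma cinner_self_eq_0 [simp]: "cinner x x = 0 \<longleftrightarrow> x = 0"
  by (simp add: cinner_self)

lemma norm_eq_cinner: "norm x = norm y \<longleftrightarrow> cinner x x = cinner y y"
  unfolding cinner_self of_real_eq_iff by simp

lemma cinner_eq_0_commute: "cinner x y = 0 \<Longrightarrow> cinner y x = 0"
  by (subst cinner_commute) simp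

lemma cinner_ext: "(\<And>z. cinner z x = cinner z y) \<Longrightarrow> x = y"
  using cinner_self_eq_0 [of "x - y"] by (simp add: cinner_diff_right del: cinner_self_eq_0)

lemma norm_scaleC [simp]: "norm (c *\<^sub>C x) = cmod c * norm (x::'a::complex_inner)"
proof -
  have "of_real ((norm (c *\<^sub>C x))\<^sup>2) = (of_real ((cmod c * norm x)\<^sup>2) :: complex)"
    unfolding cinner_self [symmetric]
    unfolding cinner_scaleC_left cinner_scaleC_right cinner_self [of x]
    by (simp add: power_mult_distrib complex_norm_square del: of_real_power)
  then have "(norm (c *\<^sub>C x))\<^sup>2 = (cmod c * norm x)\<^sup>2"
    using of_real_eq_iff by blast
  then show ?thesis
    by simp
qed

text \<open>The real inequality, applied to \<open>x\<close> turned by the phase of \<open>cinner x y\<close>.\<close>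

lemma norm_cinner_le: "cmod (cinner x y) \<le> norm x * norm y"
proof -
  have "cmod (cinner x y) = Re (cinner (cnj (sgn (cinner x y)) *\<^sub>C x) y)"
  proof (cases "cinner x y = 0")
    case False
    have "cnj (cinner x y) * cinner x y = of_real ((cmod (cinner x y))\<^sup>2)"
      by (subst mult.commute, subst complex_norm_square [symmetric]) simp
    then have "cnj (sgn (cinner x y)) * cinner x y = of_real (cmod (cinner x y))"
      using False by (simp add: sgn_eq power2_eq_square)
    then show ?thesis
      by (simp only: cinner_scaleC_left) simp
  qed simp
  also have "\<dots> \<le> norm (cnj (sgn (cinner x y)) *\<^sub>C x) * norm y"
    unfolding inner_eq_Re_cinner [symmetric] by (rule norm_cauchy_schwarz)
  also have "\<dots> \<le> norm x * norm y"
    by (intro mult_right_mono) (simp_all add: norm_sgn)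
  finally show ?thesis .
qed

lemma bounded_bilinear_cinner: "bounded_bilinear cinner"
proof
  show "\<exists>K. \<forall>a b. cmod (cinner a b) \<le> norm a * norm b * K"
    by (rule exI [of _ 1]) (simp add: norm_cinner_le)
qed (auto simp: cinner_simps scaleR_scaleC scaleR_conv_of_real)

lemma bounded_bilinear_scaleC: "bounded_bilinear (scaleC :: complex \<Rightarrow> 'a::complex_inner \<Rightarrow> 'a)"
proof
  show "\<exists>K. \<forall>a b. norm (a *\<^sub>C b :: 'a) \<le> norm a * norm b * K"
    by (rule exI [of _ 1]) simp
qed (auto simp: scaleC_add_left scaleC_add_right scaleR_scaleC scaleC_scaleC scaleR_conv_of_real
      mult.commute)

lemmas tendsto_cinner [tendsto_intros] = bounded_bilinear.tendsto [OF bounded_bilinear_cinner]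
lemmas tendsto_scaleC [tendsto_intros] = bounded_bilinear.tendsto [OF bounded_bilinear_scaleC]

lemma norm_add_square_orthogonal:
  fixes x y :: "'a::complex_inner"
  assumes "cinner x y = 0"
  shows "(norm (x + y))\<^sup>2 = (norm x)\<^sup>2 + (norm y)\<^sup>2"
  using assms cinner_eq_0_commute [OF assms]
  by (simp add: power2_norm_eq_inner inner_eq_Re_cinner cinner_simps)

lemma norm_Pair_square: "(norm (x, y))\<^sup>2 = (norm x)\<^sup>2 + (norm y)\<^sup>2"
  by (simp add: norm_Pair)

lemma cinner_Pair [simp]: "cinner (a, b) (c, d) = cinner a c + cinner b d"
  by (simp add: cinner_prod_def)

lemma scaleC_Pair [simp]: "c *\<^sub>C (a, b) = (c *\<^sub>C a, c *\<^sub>C b)"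
  by (simp add: scaleC_prod_def)

lemma bounded_clinearI:
  assumes "\<And>x y. A (x + y) = A x + A y" "\<And>c x. A (c *\<^sub>C x) = c *\<^sub>C A x"
    and "\<And>x. norm (A x) \<le> C * norm x"
  shows "bounded_clinear A"
  unfolding bounded_clinear_def
proof
  show "bounded_linear A"
    by (rule bounded_linear_intro [of _ C])
      (use assms in \<open>simp_all add: scaleR_scaleC mult.commute\<close>)
qed (use assms in blast)

lemma bounded_clinear_imp_bounded_linear: "bounded_clinear A \<Longrightarrow> bounded_linear A"
  by (simp add: bounded_clinear_def)

lemma bounded_clinear_add: "bounded_clinear A \<Longrightarrow> A (x + y) = A x + A y"
  and bounded_clinear_diff: "bounded_clinear A \<Longrightarrow> A (x - y) = A x - A y"
  and bounded_clinear_minus: "bounded_clinear A \<Longrightarrow> A (- x) = - A x"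
  and bounded_clinear_zero: "bounded_clinear A \<Longrightarrow> A 0 = 0"
  and bounded_clinear_scaleC: "bounded_clinear A \<Longrightarrow> A (c *\<^sub>C x) = c *\<^sub>C A x"
  unfolding bounded_clinear_def
  by (auto simp: linear_add linear_diff linear_neg linear_0 dest: bounded_linear.linear)

lemmas bounded_clinear_simps = bounded_clinear_add bounded_clinear_diff bounded_clinear_minus
  bounded_clinear_zero bounded_clinear_scaleC

lemma bounded_clinear_bound:
  assumes "bounded_clinear A"
  obtains C where "C \<ge> 0" "\<And>x. norm (A x) \<le> C * norm x"
  using bounded_linear.nonneg_bounded [OF bounded_clinear_imp_bounded_linear [OF assms]]
  by (auto simp: mult.commute)

lemma bounded_clinear_tendsto:
  "bounded_clinear A \<Longrightarrow> (f \<longlongrightarrow> l) F \<Longrightarrow> ((\<lambda>x. A (f x)) \<longlongrightarrow> A l) F"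
  by (rule bounded_linear.tendsto [OF bounded_clinear_imp_bounded_linear])

lemma bounded_clinear_id: "bounded_clinear (\<lambda>x. x)"
  by (rule bounded_clinearI [of _ 1]) auto

lemma bounded_clinear_compose:
  assumes "bounded_clinear A" "bounded_clinear B"
  shows "bounded_clinear (\<lambda>x. A (B x))"
  using assms bounded_linear_compose [of A B] by (auto simp: bounded_clinear_def)

lemma bounded_clinear_plus:
  assumes "bounded_clinear A" "bounded_clinear B"
  shows "bounded_clinear (\<lambda>x. A x + B x)"
  using assms bounded_linear_add [of A B] by (auto simp: bounded_clinear_def scaleC_add_right)

lemma bounded_clinear_sub:
  assumes "bounded_clinear A" "bounded_clinear B"
  shows "bounded_clinear (\<lambda>x. A x - B x)"
  using assms bounded_linear_sub [of A B] by (auto simp: bounded_clinear_def scaleC_diff_right)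

lemma bounded_clinear_uminus:
  assumes "bounded_clinear A"
  shows "bounded_clinear (\<lambda>x. - A x)"
  using assms bounded_linear_minus [of A] by (auto simp: bounded_clinear_def)

lemma bounded_clinear_mult_scaleC:
  assumes "bounded_clinear A"
  shows "bounded_clinear (\<lambda>x. c *\<^sub>C A x)"
proof -
  obtain C where "C \<ge> 0" "\<And>x. norm (A x) \<le> C * norm x"
    using bounded_clinear_bound [OF assms] by blast
  then show ?thesis
    by (intro bounded_clinearI [of _ "cmod c * C"])
      (use assms in \<open>auto simp: bounded_clinear_simps scaleC_add_right scaleC_scaleC mult.commute [of c]
        mult.assoc intro!: mult_left_mono\<close>)
qed

lemma bounded_clinear_Pair:
  assumes "bounded_clinear A" "bounded_clinear B"
  shows "bounded_clinear (\<lambda>x. (A x, B x))"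
  using assms bounded_linear_Pair [of A B] by (auto simp: bounded_clinear_def)

lemma bounded_clinear_fst: "bounded_clinear fst"
  and bounded_clinear_snd: "bounded_clinear snd"
  by (auto simp: bounded_clinear_def scaleC_prod_def bounded_linear_fst bounded_linear_snd)

lemmas bounded_clinear_intros = bounded_clinear_id bounded_clinear_plus
  bounded_clinear_sub bounded_clinear_uminus bounded_clinear_mult_scaleC bounded_clinear_Pair

lemma contraction_norm: "contraction A \<Longrightarrow> norm (A x) \<le> norm x"
  and contraction_bounded_clinear: "contraction A \<Longrightarrow> bounded_clinear A"
  by (auto simp: contraction_def)

section \<open>Orthogonal projections and adjoints\<close>

lemma csubspace_zero: "closed_csubspace X \<Longrightarrow> 0 \<in> X"
  and csubspace_add: "closed_csubspace X \<Longrightarrow> x \<in> X \<Longrightarrow> y \<in> X \<Longrightarrow> x + y \<in> X"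
  and csubspace_diff: "closed_csubspace X \<Longrightarrow> x \<in> X \<Longrightarrow> y \<in> X \<Longrightarrow> x - y \<in> X"
  and csubspace_minus: "closed_csubspace X \<Longrightarrow> x \<in> X \<Longrightarrow> - x \<in> X"
  and csubspace_scaleC: "closed_csubspace X \<Longrightarrow> x \<in> X \<Longrightarrow> c *\<^sub>C x \<in> X"
  by (auto simp: closed_csubspace_def subspace_0 subspace_add subspace_diff subspace_neg)

lemmas csubspace_intros = csubspace_zero csubspace_add csubspace_diff csubspace_minus
  csubspace_scaleC

lemma closed_csubspaceI:
  assumes "closed X" "0 \<in> X" "\<And>x y. x \<in> X \<Longrightarrow> y \<in> X \<Longrightarrow> x + y \<in> X"
    and "\<And>c x. x \<in> X \<Longrightarrow> c *\<^sub>C x \<in> X"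
  shows "closed_csubspace X"
  using assms unfolding closed_csubspace_def subspace_def by (auto simp: scaleR_scaleC)

lemma closed_csubspace_UNIV [simp]: "closed_csubspace UNIV"
  by (rule closed_csubspaceI) auto

lemma closed_csubspace_Times:
  "closed_csubspace X \<Longrightarrow> closed_csubspace Y \<Longrightarrow> closed_csubspace (X \<times> Y)"
  by (rule closed_csubspaceI)
    (auto simp: csubspace_intros zero_prod_def scaleC_prod_def closed_Times closed_csubspace_def [of X, THEN iffD1]
      closed_csubspace_def [of Y, THEN iffD1])

lemma closed_csubspace_orthogonal_complement:
  assumes "closed_csubspace K"
  shows "closed_csubspace {x \<in> K. \<forall>z\<in>S. cinner x z = 0}"
proof (rule closed_csubspaceI)
  have "closed (\<Inter>z\<in>S. {x. cinner x z = 0})"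
    by (intro closed_INT ballI closed_Collect_eq continuous_on_const
        bounded_linear.continuous_on [OF bounded_bilinear.bounded_linear_left
          [OF bounded_bilinear_cinner]] continuous_on_id)
  moreover have "{x \<in> K. \<forall>z\<in>S. cinner x z = 0} = K \<inter> (\<Inter>z\<in>S. {x. cinner x z = 0})"
    by auto
  ultimately show "closed {x \<in> K. \<forall>z\<in>S. cinner x z = 0}"
    using assms by (simp add: closed_csubspace_def closed_Int)
qed (use assms in \<open>auto simp: csubspace_intros cinner_simps\<close>)

lemma closure_range_sequential:
  fixes A :: "'a \<Rightarrow> 'b::metric_space"
  shows "x \<in> closure (range A) \<longleftrightarrow> (\<exists>u. (\<lambda>n. A (u n)) \<longlonglongrightarrow> x)"
proof
  assume "x \<in> closure (range A)"
  then obtain f where f: "\<forall>n. f n \<in> range A" "f \<longlonglongrightarrow> x"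
    unfolding closure_sequential by auto
  then have "\<forall>n. \<exists>u. f n = A u"
    by blast
  then obtain u where "\<forall>n. f n = A (u n)"
    using choice [of "\<lambda>n u. f n = A u"] by blast
  then have "f = (\<lambda>n. A (u n))"
    by blast
  with f(2) show "\<exists>u. (\<lambda>n. A (u n)) \<longlonglongrightarrow> x"
    by blast
next
  assume "\<exists>u. (\<lambda>n. A (u n)) \<longlonglongrightarrow> x"
  then obtain u where "(\<lambda>n. A (u n)) \<longlonglongrightarrow> x"
    by blast
  then show "x \<in> closure (range A)"
    unfolding closure_sequential by (intro exI [of _ "\<lambda>n. A (u n)"]) simp
qed

lemma closed_csubspace_closure_range:
  assumes A: "bounded_clinear A"
  shows "closed_csubspace (closure (range A))"
proof (rule closed_csubspaceI)
  show "0 \<in> closure (range A)"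
    by (rule subsetD [OF closure_subset]) (rule range_eqI [of _ _ 0], simp add: bounded_clinear_zero [OF A])
next
  fix x y assume "x \<in> closure (range A)" "y \<in> closure (range A)"
  then obtain u v where "(\<lambda>n. A (u n)) \<longlonglongrightarrow> x" "(\<lambda>n. A (v n)) \<longlonglongrightarrow> y"
    unfolding closure_range_sequential by auto
  then have "(\<lambda>n. A (u n + v n)) \<longlonglongrightarrow> x + y"
    unfolding bounded_clinear_add [OF A] by (rule tendsto_add)
  then show "x + y \<in> closure (range A)"
    unfolding closure_range_sequential by (rule exI [of _ "\<lambda>n. u n + v n"])
next
  fix c x assume "x \<in> closure (range A)"
  then obtain u where "(\<lambda>n. A (u n)) \<longlonglongrightarrow> x"
    unfolding closure_range_sequential by auto
  then have "(\<lambda>n. A (c *\<^sub>C u n)) \<longlonglongrightarrow> c *\<^sub>C x"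
    unfolding bounded_clinear_scaleC [OF A] by (rule tendsto_scaleC [OF tendsto_const])
  then show "c *\<^sub>C x \<in> closure (range A)"
    unfolding closure_range_sequential by (rule exI [of _ "\<lambda>n. c *\<^sub>C u n"])
qed simp

text \<open>
  The nearest point to \<open>x\<close> in \<open>X\<close> is the limit of a minimizing sequence, which is a Cauchy sequence by
  the parallelogram law; minimality makes the difference orthogonal to \<open>X\<close>.
\<close>

lemma projection_exists:
  fixes X :: "'a::complex_hilbert set"
  assumes X: "closed_csubspace X"
  obtains y where "y \<in> X" "\<And>z. z \<in> X \<Longrightarrow> cinner (x - y) z = 0"
proof -
  define d where "d = infdist x X"
  have ne: "X \<noteq> {}"
    using csubspace_zero [OF X] by blast
  have d: "d \<ge> 0"
    by (simp add: d_def infdist_nonneg)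
  have d_le: "d \<le> norm (x - y)" if "y \<in> X" for y
    using infdist_le [OF that, of x] by (simp add: d_def dist_norm)
  have "\<exists>y\<in>X. norm (x - y) < d + 1 / real (Suc n)" for n
  proof (rule ccontr)
    assume "\<not> ?thesis"
    then have "d + 1 / real (Suc n) \<le> dist x y" if "y \<in> X" for y
      using that by (auto simp: dist_norm not_less)
    then have "d + 1 / real (Suc n) \<le> d"
      unfolding d_def infdist_notempty [OF ne] by (intro cINF_greatest ne)
    then show False
      by simp
  qed
  then obtain f where f: "\<And>n. f n \<in> X" "\<And>n. norm (x - f n) < d + 1 / real (Suc n)"
    by metis
  have par: "(norm (f m - f n))\<^sup>2 \<le> (8 * d + 4) * e"
    if e: "0 < e" "e \<le> 1" "norm (x - f m) < d + e" "norm (x - f n) < d + e" for m n e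
  proof -
    define h where "h = (1/2) *\<^sub>R (f m + f n)"
    have "h \<in> X"
      using f(1) X by (simp add: h_def closed_csubspace_def subspace_add subspace_scale)
    then have dh: "d\<^sup>2 \<le> (norm (x - h))\<^sup>2"
      using d_le d by (intro power_mono) auto
    have parallelogram: "(norm (a - b))\<^sup>2 + (norm (a + b))\<^sup>2 = 2 * (norm a)\<^sup>2 + 2 * (norm b)\<^sup>2" for a b :: 'a
      by (simp add: power2_norm_eq_inner inner_simps)
    have "(x - f n) - (x - f m) = f m - f n" "(x - f n) + (x - f m) = 2 *\<^sub>R (x - h)"
      by (simp_all add: h_def scaleR_diff_right scaleR_2)
    then have "(norm (f m - f n))\<^sup>2 = 2 * (norm (x - f m))\<^sup>2 + 2 * (norm (x - f n))\<^sup>2 - 4 * (norm (x - h))\<^sup>2"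
      using parallelogram [of "x - f n" "x - f m"] by (simp add: power_mult_distrib)
    also have "\<dots> \<le> 2 * (d + e)\<^sup>2 + 2 * (d + e)\<^sup>2 - 4 * d\<^sup>2"
    proof -
      have "(norm (x - f m))\<^sup>2 \<le> (d + e)\<^sup>2" "(norm (x - f n))\<^sup>2 \<le> (d + e)\<^sup>2"
        using e by (auto intro!: power_mono)
      then show ?thesis
        using dh by linarith
    qed
    also have "\<dots> = 8 * d * e + 4 * e * e"
      by (simp add: power2_eq_square algebra_simps)
    also have "\<dots> \<le> (8 * d + 4) * e"
      using e by (simp add: algebra_simps mult_left_le)
    finally show ?thesis .
  qed
  have "Cauchy f"
  proof (rule CauchyI)
    fix r :: real assume r: "r > 0"
    obtain N where N: "inverse (real (Suc N)) < r\<^sup>2 / (8 * d + 4)"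
      using reals_Archimedean [of "r\<^sup>2 / (8 * d + 4)"] r d by auto
    have "norm (f m - f n) < r" if "m \<ge> N" "n \<ge> N" for m n
    proof -
      have *: "1 / real (Suc k) \<le> inverse (real (Suc N))" if "k \<ge> N" for k
        using that by (simp add: field_simps)
      have "(norm (f m - f n))\<^sup>2 \<le> (8 * d + 4) * inverse (real (Suc N))"
        using f(2) [of m] f(2) [of n] * [OF that(1)] * [OF that(2)]
        by (intro par) (linarith | simp add: field_simps)+
      also have "\<dots> < r\<^sup>2"
        using N d by (simp add: field_simps)
      finally show ?thesis
        using r by (simp add: power2_less_imp_less)
    qed
    then show "\<exists>M. \<forall>m\<ge>M. \<forall>n\<ge>M. norm (f m - f n) < r"
      by blast
  qed
  then obtain y where y: "f \<longlonglongrightarrow> y"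
    using Cauchy_convergent convergent_def by blast
  have yX: "y \<in> X"
    using X f(1) y unfolding closed_csubspace_def closed_sequential_limits by blast
  have "norm (x - y) \<le> d"
  proof (rule LIMSEQ_le)
    show "(\<lambda>n. norm (x - f n)) \<longlonglongrightarrow> norm (x - y)"
      by (intro tendsto_intros y)
    show "(\<lambda>n. d + 1 / real (Suc n)) \<longlonglongrightarrow> d"
      using tendsto_add [OF tendsto_const LIMSEQ_Suc [OF lim_1_over_n], of d]
      by simp
    show "\<exists>N. \<forall>n\<ge>N. norm (x - f n) \<le> d + 1 / real (Suc n)"
      using f(2) less_imp_le by blast
  qed
  then have min: "norm (x - y) \<le> norm (x - z)" if "z \<in> X" for z
    using d_le [OF that] by linarith
  have Re0: "inner (x - y) z = 0" if z: "z \<in> X" for z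
  proof (cases "z = 0")
    case False
    define t where "t = inner (x - y) z / (norm z)\<^sup>2"
    have "(norm (x - y))\<^sup>2 \<le> (norm (x - (y + t *\<^sub>R z)))\<^sup>2"
      using min [of "y + t *\<^sub>R z"] yX z X
      by (intro power_mono) (auto simp: closed_csubspace_def subspace_add subspace_scale)
    also have "x - (y + t *\<^sub>R z) = (x - y) - t *\<^sub>R z"
      by simp
    also have "(norm ((x - y) - t *\<^sub>R z))\<^sup>2 = (norm (x - y))\<^sup>2 - 2 * t * inner (x - y) z + t\<^sup>2 * (norm z)\<^sup>2"
      using dot_norm_neg [of "x - y" "t *\<^sub>R z"] by (simp add: power_mult_distrib field_simps)
    also have "\<dots> = (norm (x - y))\<^sup>2 - (inner (x - y) z)\<^sup>2 / (norm z)\<^sup>2"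
      using False by (simp add: t_def power2_eq_square field_simps)
    finally have "(inner (x - y) z)\<^sup>2 / (norm z)\<^sup>2 \<le> 0"
      by simp
    then show ?thesis
      using False by (simp add: divide_le_0_iff)
  qed simp
  have "cinner (x - y) z = 0" if z: "z \<in> X" for z
  proof -
    have "Re (cinner (x - y) z) = 0" "Re (cinner (x - y) (\<i> *\<^sub>C z)) = 0"
      using Re0 [OF z] Re0 [OF csubspace_scaleC [OF X z, of "\<i>"]]
      by (simp_all add: inner_eq_Re_cinner)
    then show ?thesis
      by (simp add: cinner_scaleC_right complex_eq_iff)
  qed
  with yX show ?thesis
    using that by blast
qed

lemma ortho_proj_unique:
  assumes X: "closed_csubspace X" and y: "y \<in> X" "\<And>z. z \<in> X \<Longrightarrow> cinner (x - y) z = 0"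
  shows "ortho_proj X x = y"
  unfolding ortho_proj_def
proof (rule the_equality)
  fix w assume w: "w \<in> X \<and> (\<forall>z\<in>X. cinner (x - w) z = 0)"
  then have wX: "w - y \<in> X"
    using csubspace_diff [OF X] y(1) by blast
  have "cinner (w - y) (w - y) = cinner (x - y) (w - y) - cinner (x - w) (w - y)"
    by (simp add: cinner_simps)
  also have "\<dots> = 0"
    using w wX y(2) by simp
  finally show "w = y"
    by simp
qed (use y in blast)

context
  fixes X :: "'a::complex_hilbert set"
  assumes X: "closed_csubspace X"
begin

lemma ortho_proj_in [simp]: "ortho_proj X x \<in> X"
  and ortho_proj_orthogonal: "z \<in> X \<Longrightarrow> cinner (x - ortho_proj X x) z = 0"
proof -
  obtain y where y: "y \<in> X" "\<And>z. z \<in> X \<Longrightarrow> cinner (x - y) z = 0"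
    using projection_exists [OF X] by blast
  with ortho_proj_unique [OF X, OF y] show "ortho_proj X x \<in> X"
    "z \<in> X \<Longrightarrow> cinner (x - ortho_proj X x) z = 0"
    by auto
qed

lemma ortho_proj_id [simp]: "x \<in> X \<Longrightarrow> ortho_proj X x = x"
  by (rule ortho_proj_unique [OF X]) auto

lemma ortho_proj_eq_0: "(\<And>z. z \<in> X \<Longrightarrow> cinner x z = 0) \<Longrightarrow> ortho_proj X x = 0"
  by (rule ortho_proj_unique [OF X]) (auto simp: csubspace_zero [OF X])

lemma cinner_ortho_proj_right: "z \<in> X \<Longrightarrow> cinner z (ortho_proj X x) = cinner z x"
  using cinner_eq_0_commute [OF ortho_proj_orthogonal, of z x] by (simp add: cinner_diff_right)

lemma cinner_ortho_proj_left: "z \<in> X \<Longrightarrow> cinner (ortho_proj X x) z = cinner x z"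
  using ortho_proj_orthogonal [of z x] by (simp add: cinner_diff_left)

lemma cinner_ortho_proj_commute: "cinner (ortho_proj X x) y = cinner x (ortho_proj X y)"
  using cinner_ortho_proj_right [of "ortho_proj X x" y] cinner_ortho_proj_left [of "ortho_proj X y" x]
  by (metis ortho_proj_in)

lemma bounded_clinear_ortho_proj: "bounded_clinear (ortho_proj X)"
  and norm_ortho_proj_le: "norm (ortho_proj X x) \<le> norm x"
proof -
  have le: "norm (ortho_proj X x) \<le> norm x" for x
  proof -
    have "(norm (ortho_proj X x + (x - ortho_proj X x)))\<^sup>2 =
        (norm (ortho_proj X x))\<^sup>2 + (norm (x - ortho_proj X x))\<^sup>2"
      by (intro norm_add_square_orthogonal cinner_eq_0_commute [OF ortho_proj_orthogonal]) simp
    then have "(norm (ortho_proj X x))\<^sup>2 \<le> (norm x)\<^sup>2"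
      by simp
    then show ?thesis
      by simp
  qed
  then show "norm (ortho_proj X x) \<le> norm x" .
  show "bounded_clinear (ortho_proj X)"
  proof (rule bounded_clinearI [of _ 1])
    fix x y c
    show "ortho_proj X (x + y) = ortho_proj X x + ortho_proj X y"
      by (rule ortho_proj_unique [OF X])
        (auto simp: csubspace_add [OF X] cinner_simps cinner_ortho_proj_left)
    show "ortho_proj X (c *\<^sub>C x) = c *\<^sub>C ortho_proj X x"
      by (rule ortho_proj_unique [OF X])
        (auto simp: csubspace_scaleC [OF X] cinner_simps cinner_ortho_proj_left)
  qed (simp add: le)
qed

lemma orthogonal_complement_twice:
  assumes "\<And>z. (\<And>y. y \<in> X \<Longrightarrow> cinner z y = 0) \<Longrightarrow> cinner z x = 0"
  shows "x \<in> X"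
proof -
  have "cinner (x - ortho_proj X x) x = 0"
    by (rule assms) (rule ortho_proj_orthogonal)
  moreover have "cinner (x - ortho_proj X x) (ortho_proj X x) = 0"
    by (rule ortho_proj_orthogonal) simp
  ultimately have "cinner (x - ortho_proj X x) (x - ortho_proj X x) = 0"
    by (simp only: cinner_diff_right [of "x - ortho_proj X x"] diff_self)
  then have "x = ortho_proj X x"
    by simp
  then show ?thesis
    using ortho_proj_in by metis
qed

end

lemma ortho_proj_UNIV [simp]: "ortho_proj UNIV = (\<lambda>x. x :: 'a::complex_hilbert)"
  by (rule ext) simp

text \<open>The representing vector is a multiple of a vector orthogonal to the kernel of \<open>f\<close>.\<close>

lemma Riesz_representation:
  fixes f :: "'a::complex_hilbert \<Rightarrow> complex"
  assumes add: "\<And>x y. f (x + y) = f x + f y" and scale: "\<And>c x. f (c *\<^sub>C x) = c * f x"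
    and bound: "\<And>x. cmod (f x) \<le> C * norm x"
  obtains b where "\<And>x. f x = cinner x b"
proof (cases "\<forall>x. f x = 0")
  case True
  then show ?thesis
    using that [of 0] by simp
next
  case False
  then obtain x0 where x0: "f x0 \<noteq> 0"
    by blast
  have "bounded_linear f"
    by (rule bounded_linear_intro [of _ C])
      (use add scale bound in \<open>simp_all add: scaleR_scaleC scaleR_conv_of_real mult.commute\<close>)
  then have "closed {x. f x = 0}"
    by (intro closed_Collect_eq continuous_on_const) (rule linear_continuous_on)
  then have ker: "closed_csubspace {x. f x = 0}"
    by (intro closed_csubspaceI) (use add scale scale [of 0] in auto)
  obtain y where y: "f y = 0" "\<And>z. f z = 0 \<Longrightarrow> cinner (x0 - y) z = 0"
    using projection_exists [OF ker, of x0] by auto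
  define w where "w = x0 - y"
  have fw: "f w = f x0"
    using add [of w y] y by (simp add: w_def)
  have "w \<noteq> 0"
    using fw x0 scale [of 0 0] by auto
  show ?thesis
  proof (rule that)
    fix x
    have "f (x - (f x / f w) *\<^sub>C w) = 0"
      using add [of "x - (f x / f w) *\<^sub>C w" "(f x / f w) *\<^sub>C w"] x0 fw by (simp add: scale)
    then have "cinner (x - (f x / f w) *\<^sub>C w) w = 0"
      using y(2) cinner_eq_0_commute unfolding w_def by blast
    then show "f x = cinner x ((cnj (f w) / of_real ((norm w)\<^sup>2)) *\<^sub>C w)"
      using \<open>w \<noteq> 0\<close> x0 fw by (simp add: cinner_simps cinner_self field_simps)
  qed
qed

lemma adj_unique:
  assumes "\<And>x y. cinner (A x) y = cinner x (B y)"
  shows "adj A = B"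
  unfolding adj_def
proof (rule the_equality)
  fix B' assume B': "\<forall>x y. cinner (A x) y = cinner x (B' y)"
  show "B' = B"
    by (rule ext, rule cinner_ext) (use assms B' in metis)
qed (use assms in blast)

lemma cinner_adj:
  fixes A :: "'a::complex_hilbert \<Rightarrow> 'b::complex_inner"
  assumes A: "bounded_clinear A"
  shows "cinner (A x) y = cinner x (adj A y)"
proof -
  obtain C where C: "C \<ge> 0" "\<And>x. norm (A x) \<le> C * norm x"
    using bounded_clinear_bound [OF A] by blast
  have "\<exists>b. \<forall>x. cinner (A x) y = cinner x b" for y
  proof -
    have "cmod (cinner (A x) y) \<le> (C * norm y) * norm x" for x
      using norm_cinner_le [of "A x" y] mult_right_mono [OF C(2) norm_ge_zero, of x y]
      by (simp add: ac_simps)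
    then obtain b where "\<And>x. cinner (A x) y = cinner x b"
      using Riesz_representation [of "\<lambda>x. cinner (A x) y" "C * norm y"] A
      by (auto simp: bounded_clinear_simps cinner_simps)
    then show ?thesis
      by blast
  qed
  then obtain B where "\<And>x y. cinner (A x) y = cinner x (B y)"
    by metis
  with adj_unique [of A B] show ?thesis
    by metis
qed

lemma cinner_adj':
  fixes A :: "'a::complex_hilbert \<Rightarrow> 'b::complex_inner"
  assumes "bounded_clinear A"
  shows "cinner (adj A y) x = cinner y (A x)"
  using cinner_adj [OF assms] by (metis cinner_commute)

lemma bounded_clinear_adj:
  fixes A :: "'a::complex_hilbert \<Rightarrow> 'b::complex_inner"
  assumes A: "bounded_clinear A"
  shows "bounded_clinear (adj A)"
proof -
  obtain C where C: "C \<ge> 0" "\<And>x. norm (A x) \<le> C * norm x"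
    using bounded_clinear_bound [OF A] by blast
  show ?thesis
  proof (rule bounded_clinearI [of _ C])
    fix x y c
    show "adj A (x + y) = adj A x + adj A y"
      by (rule cinner_ext) (simp add: cinner_simps flip: cinner_adj [OF A])
    show "adj A (c *\<^sub>C x) = c *\<^sub>C adj A x"
      by (rule cinner_ext) (simp add: cinner_simps flip: cinner_adj [OF A])
    have "(norm (adj A x))\<^sup>2 = cmod (cinner (A (adj A x)) x)"
      by (simp add: cinner_adj [OF A] cinner_self norm_power)
    also have "\<dots> \<le> norm (A (adj A x)) * norm x"
      by (rule norm_cinner_le)
    also have "\<dots> \<le> C * norm (adj A x) * norm x"
      by (intro mult_right_mono C) simp
    finally have "norm (adj A x) * norm (adj A x) \<le> norm (adj A x) * (C * norm x)"
      by (simp add: power2_eq_square ac_simps)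
    then show "norm (adj A x) \<le> C * norm x"
      using C by (cases "adj A x = 0") auto
  qed
qed

lemma adj_adj:
  fixes A :: "'a::complex_hilbert \<Rightarrow> 'b::complex_inner"
  assumes "bounded_clinear A"
  shows "adj (adj A) = A"
  by (rule adj_unique) (simp add: cinner_adj' [OF assms])

lemma contraction_adj:
  fixes A :: "'a::complex_hilbert \<Rightarrow> 'b::complex_inner"
  assumes A: "contraction A"
  shows "contraction (adj A)"
proof -
  note bA = contraction_bounded_clinear [OF A]
  have "norm (adj A x) \<le> norm x" for x
  proof -
    have "(norm (adj A x))\<^sup>2 = cmod (cinner (A (adj A x)) x)"
      by (simp add: cinner_adj [OF bA] cinner_self norm_power)
    also have "\<dots> \<le> norm (A (adj A x)) * norm x"
      by (rule norm_cinner_le)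
    also have "\<dots> \<le> norm (adj A x) * norm x"
      by (intro mult_right_mono contraction_norm [OF A]) simp
    finally have "norm (adj A x) * norm (adj A x) \<le> norm (adj A x) * norm x"
      by (simp add: power2_eq_square)
    then show ?thesis
      by (cases "adj A x = 0") auto
  qed
  then show ?thesis
    using bounded_clinear_adj [OF bA] by (simp add: contraction_def)
qed

lemma operators_bounded_clinear: "A \<in> operators X Y \<Longrightarrow> bounded_clinear A"
  and operators_in: "A \<in> operators X Y \<Longrightarrow> A x \<in> Y"
  and operators_eq_0: "A \<in> operators X Y \<Longrightarrow> (\<And>z. z \<in> X \<Longrightarrow> cinner x z = 0) \<Longrightarrow> A x = 0"
  by (auto simp: operators_def)

lemma operators_ortho_proj:
  fixes X :: "'a::complex_hilbert set"
  assumes "A \<in> operators X Y" "closed_csubspace X"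
  shows "A (ortho_proj X x) = A x"
proof -
  have "A (x - ortho_proj X x) = 0"
    by (rule operators_eq_0 [OF assms(1)]) (rule ortho_proj_orthogonal [OF assms(2)])
  then show ?thesis
    by (simp add: bounded_clinear_simps [OF operators_bounded_clinear [OF assms(1)]])
qed

lemma operatorsI:
  fixes X :: "'a::complex_hilbert set"
  assumes "bounded_clinear A" "closed_csubspace X" "\<And>x. A x \<in> Y" "\<And>x. A (ortho_proj X x) = A x"
  shows "A \<in> operators X Y"
proof -
  have "A x = 0" if "\<forall>z\<in>X. cinner x z = 0" for x
    using ortho_proj_eq_0 [OF assms(2), of x] that assms(4) [of x] bounded_clinear_zero [OF assms(1)]
    by simp
  then show ?thesis
    using assms by (auto simp: operators_def)
qed

lemma adj_operators:
  fixes A :: "'a::complex_hilbert \<Rightarrow> 'b::complex_inner"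
  assumes A: "A \<in> operators X Y" and X: "closed_csubspace X"
  shows "adj A \<in> operators Y X"
proof -
  note bA = operators_bounded_clinear [OF A]
  have "adj A y \<in> X" for y
  proof (rule orthogonal_complement_twice [OF X])
    fix z assume "\<And>x. x \<in> X \<Longrightarrow> cinner z x = 0"
    then show "cinner z (adj A y) = 0"
      using operators_eq_0 [OF A] by (simp flip: cinner_adj [OF bA])
  qed
  moreover have "adj A y = 0" if "\<forall>z\<in>Y. cinner y z = 0" for y
  proof (rule cinner_ext)
    fix z
    have "cinner (A z) y = 0"
      using that operators_in [OF A] cinner_eq_0_commute by blast
    then show "cinner z (adj A y) = cinner z 0"
      by (simp add: cinner_adj [OF bA])
  qed
  ultimately show ?thesis
    using bounded_clinear_adj [OF bA] by (auto simp: operators_def)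
qed

section \<open>Square roots of positive operators\<close>

lemma positive_op_bounded_clinear: "positive_op A \<Longrightarrow> bounded_clinear A"
  by (simp add: positive_op_def)

lemma positive_op_selfadjoint:
  assumes "positive_op A"
  shows "cinner (A x) y = cinner x (A y)"
proof -
  note A = positive_op_bounded_clinear [OF assms]
  define s where "s x y = cinner (A x) y - cinner x (A y)" for x y
  have s0: "s x x = 0" for x
  proof -
    have "cinner (A x) x \<in> \<real>\<^sub>\<ge>\<^sub>0"
      using assms by (simp add: positive_op_def)
    then have "cnj (cinner (A x) x) = cinner (A x) x"
      by (auto simp: nonneg_Reals_def)
    then show ?thesis
      using cinner_commute [of x "A x"] by (simp add: s_def)
  qed
  have s_add: "s x y + s y x = 0" for x y
    using s0 [of "x + y"] s0 [of x] s0 [of y]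
    by (simp add: s_def cinner_simps bounded_clinear_simps [OF A] algebra_simps)
  have "s x (\<i> *\<^sub>C y) + s (\<i> *\<^sub>C y) x = \<i> * (s y x - s x y)"
    by (simp add: s_def cinner_simps bounded_clinear_simps [OF A] algebra_simps)
  with s_add [of x "\<i> *\<^sub>C y"] have "s y x = s x y"
    by simp
  with s_add [of x y] have "s x y = 0"
    by simp
  then show ?thesis
    by (simp add: s_def)
qed

lemma positive_op_Re: "positive_op A \<Longrightarrow> 0 \<le> Re (cinner (A x) x)"
  by (auto simp: positive_op_def complex_nonneg_Reals_iff)

text \<open>
  The Cauchy-Schwarz inequality for the form \<open>cinner (A x) y\<close>, in the degenerate case: adding a
  suitable negative multiple of \<open>A y\<close> to \<open>y\<close> would otherwise make the form negative.
\<close>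

lemma positive_op_eq_0:
  assumes A: "positive_op A" and 0: "cinner (A y) y = 0"
  shows "A y = 0"
proof -
  define a where "a = (norm (A y))\<^sup>2"
  define c where "c = Re (cinner (A (A y)) (A y))"
  define t where "t = - a / (c + 1)"
  have c: "c \<ge> 0"
    using positive_op_Re [OF A] by (simp add: c_def)
  have yAAy: "cinner (A (A y)) y = of_real a"
    by (subst positive_op_selfadjoint [OF A]) (simp only: cinner_self a_def)
  have AyAy: "cinner (A y) (A y) = of_real a"
    by (simp only: cinner_self a_def)
  have "0 \<le> Re (cinner (A (y + of_real t *\<^sub>C A y)) (y + of_real t *\<^sub>C A y))"
    by (rule positive_op_Re [OF A])
  also have "\<dots> = 2 * t * a + t\<^sup>2 * c"
    by (simp add: bounded_clinear_simps [OF positive_op_bounded_clinear [OF A]] cinner_simps 0 yAAy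
        AyAy c_def power2_eq_square algebra_simps)
  also have "\<dots> = a\<^sup>2 * (- c - 2) / (c + 1)\<^sup>2"
  proof -
    have ta: "t * (c + 1) = - a"
      using c by (simp add: t_def)
    have "(2 * t * a + t\<^sup>2 * c) * (c + 1)\<^sup>2 = 2 * (t * (c + 1)) * a * (c + 1) + (t * (c + 1))\<^sup>2 * c"
      by (simp add: power2_eq_square algebra_simps)
    also have "\<dots> = a\<^sup>2 * (- c - 2)"
      unfolding ta by (simp add: power2_eq_square algebra_simps)
    finally show ?thesis
      using c by (simp add: eq_divide_eq)
  qed
  finally have "0 \<le> a\<^sup>2 * (- c - 2)"
    using c by (simp add: zero_le_divide_iff)
  then have "a = 0"
    using c by (simp add: zero_le_mult_iff)
  then show ?thesis
    by (simp add: a_def)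
qed

text \<open>
  Writing \<open>A = I - B\<close>, the operator \<open>X = I - A\<^sup>1\<^sup>/\<^sup>2\<close> solves \<open>X = (B + X\<^sup>2) / 2\<close>. The fixed-point iteration
  for this equation is dominated, term by term and in its increments, by the same iteration for the
  number 1 in place of \<open>B\<close>, whose convergence thus carries over.
\<close>

primrec sqrt_iter :: "('a::complex_inner \<Rightarrow> 'a) \<Rightarrow> nat \<Rightarrow> 'a \<Rightarrow> 'a" where
  "sqrt_iter B 0 = (\<lambda>x. 0)"
| "sqrt_iter B (Suc n) = (\<lambda>x. (1/2) *\<^sub>C (B x + sqrt_iter B n (sqrt_iter B n x)))"

primrec majorant :: "nat \<Rightarrow> real" where
  "majorant 0 = 0"
| "majorant (Suc n) = (1 + (majorant n)\<^sup>2) / 2"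

lemma majorant_bounds: "0 \<le> majorant n \<and> majorant n \<le> 1"
proof (induction n)
  case (Suc n)
  then show ?case
    using power_le_one [of "majorant n" 2] by simp
qed simp

lemma majorant_mono: "m \<le> n \<Longrightarrow> majorant m \<le> majorant n"
proof (rule lift_Suc_mono_le [of majorant])
  fix n
  have "0 \<le> (majorant n - 1)\<^sup>2"
    by simp
  then show "majorant n \<le> majorant (Suc n)"
    by (simp add: power2_eq_square algebra_simps)
qed

lemma majorant_Cauchy: "Cauchy majorant"
proof -
  have "convergent majorant"
    by (rule Bseq_mono_convergent) (auto simp: majorant_mono majorant_bounds intro!: BseqI' [of _ 1])
  then show ?thesis
    by (rule convergent_Cauchy)
qed

definition one_minus_sqrt :: "('a::complex_inner \<Rightarrow> 'a) \<Rightarrow> 'a \<Rightarrow> 'a" where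
  "one_minus_sqrt B x = lim (\<lambda>n. sqrt_iter B n x)"

lemma bounded_clinear_sqrt_iter:
  assumes "bounded_clinear B"
  shows "bounded_clinear (sqrt_iter B n)"
proof (induction n)
  case 0
  then show ?case
    unfolding sqrt_iter.simps by (rule bounded_clinearI [of _ 0]) simp_all
next
  case (Suc n)
  show ?case
    unfolding sqrt_iter.simps
    by (intro bounded_clinear_intros bounded_clinear_compose [OF Suc Suc] assms)
qed

lemma sqrt_iter_intertwine:
  assumes "bounded_clinear C" "\<And>x. C (B x) = B' (C x)"
  shows "C (sqrt_iter B n x) = sqrt_iter B' n (C x)"
proof (induction n arbitrary: x)
  case (Suc n)
  then show ?case
    by (simp add: bounded_clinear_simps [OF assms(1)] assms(2))
qed (simp add: bounded_clinear_simps [OF assms(1)])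

context
  fixes B :: "'a::complex_hilbert \<Rightarrow> 'a"
  assumes B: "contraction B"
begin

private lemmas iter_clinear = bounded_clinear_sqrt_iter [OF contraction_bounded_clinear [OF B]]

lemma sqrt_iter_commute: "sqrt_iter B m (sqrt_iter B n x) = sqrt_iter B n (sqrt_iter B m x)"
  by (rule sqrt_iter_intertwine [OF iter_clinear])
    (rule sqrt_iter_intertwine [symmetric, OF contraction_bounded_clinear [OF B]], simp)

lemma norm_sqrt_iter: "norm (sqrt_iter B n x) \<le> majorant n * norm x"
proof (induction n arbitrary: x)
  case (Suc n)
  have "norm (sqrt_iter B n (sqrt_iter B n x)) \<le> majorant n * (majorant n * norm x)"
    using Suc [of "sqrt_iter B n x"] mult_left_mono [OF Suc [of x]] majorant_bounds [of n] by force
  then have "norm (B x + sqrt_iter B n (sqrt_iter B n x)) \<le> norm x + majorant n * (majorant n * norm x)"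
    using contraction_norm [OF B, of x] by (intro norm_triangle_le) linarith
  then show ?case
    by (simp add: field_simps power2_eq_square)
qed simp

lemma norm_sqrt_iter_Suc_diff:
  "norm (sqrt_iter B (Suc n) x - sqrt_iter B n x) \<le> (majorant (Suc n) - majorant n) * norm x"
proof (induction n arbitrary: x)
  case 0
  then show ?case
    using contraction_norm [OF B, of x] by simp
next
  case (Suc n)
  let ?X = "sqrt_iter B" and ?t = majorant
  define w where "w = ?X (Suc n) x + ?X n x"
  have "?X (Suc (Suc n)) x - ?X (Suc n) x = (1/2) *\<^sub>C (?X (Suc n) (?X (Suc n) x) - ?X n (?X n x))"
    unfolding sqrt_iter.simps(2) [of B "Suc n"] sqrt_iter.simps(2) [of B n, THEN fun_cong, of x]
    by (simp add: scaleC_add_right scaleC_diff_right del: sqrt_iter.simps)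
  also have "?X (Suc n) (?X (Suc n) x) - ?X n (?X n x) = ?X (Suc n) w - ?X n w"
    using sqrt_iter_commute [of n "Suc n" x]
    by (simp add: w_def bounded_clinear_simps [OF iter_clinear] del: sqrt_iter.simps)
  finally have "norm (?X (Suc (Suc n)) x - ?X (Suc n) x) = norm (?X (Suc n) w - ?X n w) / 2"
    by simp
  also have "\<dots> \<le> (?t (Suc n) - ?t n) * norm w / 2"
    using Suc [of w] by simp
  also have "\<dots> \<le> (?t (Suc n) - ?t n) * ((?t (Suc n) + ?t n) * norm x) / 2"
  proof -
    have "norm w \<le> ?t (Suc n) * norm x + ?t n * norm x"
      unfolding w_def using norm_sqrt_iter by (intro norm_triangle_le add_mono)
    then show ?thesis
      using majorant_mono [of n "Suc n"] by (intro divide_right_mono mult_left_mono) (auto simp: algebra_simps)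
  qed
  also have "\<dots> = (?t (Suc (Suc n)) - ?t (Suc n)) * norm x"
    unfolding majorant.simps(2) [of "Suc n"] using majorant.simps(2) [of n]
    by (simp add: field_simps power2_eq_square)
  finally show ?case .
qed

lemma norm_sqrt_iter_diff:
  "m \<le> n \<Longrightarrow> norm (sqrt_iter B n x - sqrt_iter B m x) \<le> (majorant n - majorant m) * norm x"
proof (induction n rule: dec_induct)
  case (step n)
  have "norm (sqrt_iter B (Suc n) x - sqrt_iter B m x) \<le>
      norm (sqrt_iter B (Suc n) x - sqrt_iter B n x) + norm (sqrt_iter B n x - sqrt_iter B m x)"
    using norm_triangle_ineq [of "sqrt_iter B (Suc n) x - sqrt_iter B n x" "sqrt_iter B n x - sqrt_iter B m x"]
    by simp
  also have "\<dots> \<le> (majorant (Suc n) - majorant n) * norm x + (majorant n - majorant m) * norm x"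
    by (intro add_mono norm_sqrt_iter_Suc_diff step.IH)
  finally show ?case
    by (simp add: left_diff_distrib)
qed simp

lemma sqrt_iter_tendsto: "(\<lambda>n. sqrt_iter B n x) \<longlonglongrightarrow> one_minus_sqrt B x"
proof -
  have "Cauchy (\<lambda>n. sqrt_iter B n x)"
  proof (rule CauchyI')
    fix e :: real assume e: "e > 0"
    then have "e / (norm x + 1) > 0"
      by (simp add: add_nonneg_pos)
    then obtain M where M: "\<And>m n. m \<ge> M \<Longrightarrow> n \<ge> M \<Longrightarrow> norm (majorant m - majorant n) < e / (norm x + 1)"
      using majorant_Cauchy unfolding Cauchy_iff by blast
    have "norm (sqrt_iter B m x - sqrt_iter B n x) < e" if "m \<ge> M" "n > m" for m n
    proof -
      have "norm (sqrt_iter B m x - sqrt_iter B n x) \<le> (majorant n - majorant m) * norm x"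
        using norm_sqrt_iter_diff [of m n x] that by (simp add: norm_minus_commute)
      also have "\<dots> \<le> (majorant n - majorant m) * (norm x + 1)"
        using majorant_mono [of m n] that by (intro mult_left_mono) auto
      also have "\<dots> < e"
      proof -
        have "majorant n - majorant m < e / (norm x + 1)"
          using M [of n m] that by (simp add: abs_less_iff)
        then show ?thesis
          using norm_ge_zero [of x] by (simp add: pos_less_divide_eq add_nonneg_pos)
      qed
      finally show ?thesis .
    qed
    then show "\<exists>M. \<forall>m\<ge>M. \<forall>n>m. dist (sqrt_iter B m x) (sqrt_iter B n x) < e"
      unfolding dist_norm by blast
  qed
  then show ?thesis
    unfolding one_minus_sqrt_def convergent_LIMSEQ_iff [symmetric] by (rule Cauchy_convergent)
qed

lemma norm_one_minus_sqrt: "norm (one_minus_sqrt B x) \<le> norm x"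
proof (rule LIMSEQ_le_const2 [OF tendsto_norm [OF sqrt_iter_tendsto]])
  have "norm (sqrt_iter B n x) \<le> norm x" for n
    using norm_sqrt_iter [of n x] majorant_bounds [of n] mult_left_le_one_le [of "norm x" "majorant n"]
    by simp
  then show "\<exists>N. \<forall>n\<ge>N. norm (sqrt_iter B n x) \<le> norm x"
    by blast
qed

lemma bounded_clinear_one_minus_sqrt: "bounded_clinear (one_minus_sqrt B)"
proof (rule bounded_clinearI [of _ 1])
  fix x y c
  show "one_minus_sqrt B (x + y) = one_minus_sqrt B x + one_minus_sqrt B y"
    using LIMSEQ_unique [OF sqrt_iter_tendsto [of "x + y"]] tendsto_add [OF sqrt_iter_tendsto sqrt_iter_tendsto]
    by (simp add: bounded_clinear_simps [OF iter_clinear])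
  show "one_minus_sqrt B (c *\<^sub>C x) = c *\<^sub>C one_minus_sqrt B x"
    using LIMSEQ_unique [OF sqrt_iter_tendsto [of "c *\<^sub>C x"]]
      tendsto_scaleC [OF tendsto_const sqrt_iter_tendsto, of c x]
    by (simp add: bounded_clinear_simps [OF iter_clinear])
qed (simp add: norm_one_minus_sqrt)

lemma one_minus_sqrt_eq: "one_minus_sqrt B x = (1/2) *\<^sub>C (B x + one_minus_sqrt B (one_minus_sqrt B x))"
proof -
  let ?X = "sqrt_iter B" and ?L = "one_minus_sqrt B"
  have "(\<lambda>n. ?X n (?X n x) - ?X n (?L x)) \<longlonglongrightarrow> 0"
  proof (rule Lim_null_comparison)
    show "\<forall>\<^sub>F n in sequentially. norm (?X n (?X n x) - ?X n (?L x)) \<le> norm (?X n x - ?L x)"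
    proof (rule always_eventually, rule allI)
      fix n
      show "norm (?X n (?X n x) - ?X n (?L x)) \<le> norm (?X n x - ?L x)"
        using norm_sqrt_iter [of n "?X n x - ?L x"] majorant_bounds [of n]
          mult_left_le_one_le [of "norm (?X n x - ?L x)" "majorant n"]
        by (simp add: bounded_clinear_simps [OF iter_clinear])
    qed
    show "(\<lambda>n. norm (?X n x - ?L x)) \<longlonglongrightarrow> 0"
      using sqrt_iter_tendsto [of x] by (simp add: LIM_zero tendsto_norm_zero)
  qed
  from tendsto_add [OF this sqrt_iter_tendsto [of "?L x"]]
  have "(\<lambda>n. ?X n (?X n x)) \<longlonglongrightarrow> ?L (?L x)"
    by simp
  then have "(\<lambda>n. ?X (Suc n) x) \<longlonglongrightarrow> (1/2) *\<^sub>C (B x + ?L (?L x))"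
    unfolding sqrt_iter.simps by (intro tendsto_intros)
  then show ?thesis
    by (rule LIMSEQ_unique [OF LIMSEQ_Suc [OF sqrt_iter_tendsto]])
qed

lemma one_minus_sqrt_square:
  "(x - one_minus_sqrt B x) - one_minus_sqrt B (x - one_minus_sqrt B x) = x - B x"
proof -
  have "one_minus_sqrt B x + one_minus_sqrt B x = B x + one_minus_sqrt B (one_minus_sqrt B x)"
    using arg_cong [OF one_minus_sqrt_eq [of x], of "scaleC 2"]
      scaleC_add_left [of 1 1 "one_minus_sqrt B x"]
    by (simp only: scaleC_scaleC) simp
  then show ?thesis
    by (simp add: bounded_clinear_simps [OF bounded_clinear_one_minus_sqrt] algebra_simps)
qed

lemma one_minus_sqrt_selfadjoint:
  assumes sa: "\<And>x y. cinner (B x) y = cinner x (B y)"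
  shows "cinner (one_minus_sqrt B x) y = cinner x (one_minus_sqrt B y)"
proof -
  have "cinner (sqrt_iter B n x) y = cinner x (sqrt_iter B n y)" for n x y
    by (induction n arbitrary: x y) (simp_all add: cinner_simps sa)
  with tendsto_cinner [OF sqrt_iter_tendsto tendsto_const, of x y]
  have "(\<lambda>n. cinner x (sqrt_iter B n y)) \<longlonglongrightarrow> cinner (one_minus_sqrt B x) y"
    by simp
  then show ?thesis
    by (rule LIMSEQ_unique) (rule tendsto_cinner [OF tendsto_const sqrt_iter_tendsto])
qed

lemma positive_op_sqrt:
  assumes sa: "\<And>x y. cinner (B x) y = cinner x (B y)"
  shows "positive_op (\<lambda>x. x - one_minus_sqrt B x)"
  unfolding positive_op_def
proof (intro conjI allI)
  show "bounded_clinear (\<lambda>x. x - one_minus_sqrt B x)"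
    by (intro bounded_clinear_intros bounded_clinear_one_minus_sqrt)
  fix x
  let ?c = "cinner (one_minus_sqrt B x) x"
  have "cnj ?c = ?c"
    using one_minus_sqrt_selfadjoint [OF sa, of x x] cinner_commute [of x "one_minus_sqrt B x"] by simp
  then have c: "?c = of_real (Re ?c)"
    by (simp add: complex_eq_iff)
  have "Re ?c \<le> norm (one_minus_sqrt B x) * norm x"
    using norm_cinner_le [of "one_minus_sqrt B x" x] complex_Re_le_cmod [of ?c] by linarith
  also have "\<dots> \<le> (norm x)\<^sup>2"
    using norm_one_minus_sqrt [of x] by (simp add: power2_eq_square mult_right_mono)
  finally have "(norm x)\<^sup>2 - Re ?c \<ge> 0"
    by simp
  moreover have "cinner (x - one_minus_sqrt B x) x = of_real ((norm x)\<^sup>2 - Re ?c)"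
    using c by (simp only: cinner_diff_left cinner_self of_real_diff)
  ultimately show "cinner (x - one_minus_sqrt B x) x \<in> \<real>\<^sub>\<ge>\<^sub>0"
    using nonneg_Reals_of_real_iff by metis
qed

text \<open>
  If \<open>S\<close> and \<open>R\<close> are commuting positive square roots of one operator, then
  \<open>(S + R)(S - R) = 0\<close>, so that both positive forms vanish on the range of \<open>S - R\<close>. A square root of
  \<open>I - B\<close> commutes with \<open>B\<close>, hence with the root that the iteration constructs.
\<close>

lemma sqrt_op_eq:
  assumes sa: "\<And>x y. cinner (B x) y = cinner x (B y)"
  shows "sqrt_op (\<lambda>x. x - B x) = (\<lambda>x. x - one_minus_sqrt B x)"
  unfolding sqrt_op_def
proof (rule the_equality)
  let ?S = "\<lambda>x. x - one_minus_sqrt B x"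
  have S: "positive_op ?S"
    by (rule positive_op_sqrt [OF sa])
  then show "positive_op ?S \<and> ?S \<circ> ?S = (\<lambda>x. x - B x)"
    using one_minus_sqrt_square by (simp add: fun_eq_iff)
  fix R assume "positive_op R \<and> R \<circ> R = (\<lambda>x. x - B x)"
  then have R: "positive_op R" and RR: "\<And>x. R (R x) = x - B x"
    by (auto simp: fun_eq_iff)
  note R_cl = positive_op_bounded_clinear [OF R]
  note S_cl = positive_op_bounded_clinear [OF S]
  have "R (B x) = B (R x)" for x
    using RR [of x] RR [of "R x"] bounded_clinear_diff [OF R_cl, of x "B x"] by simp
  then have "R (sqrt_iter B n x) = sqrt_iter B n (R x)" for n x
    by (rule sqrt_iter_intertwine [OF R_cl])
  then have "R (one_minus_sqrt B x) = one_minus_sqrt B (R x)" for x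
    using LIMSEQ_unique [OF sqrt_iter_tendsto [of "R x"]]
      bounded_clinear_tendsto [OF R_cl sqrt_iter_tendsto [of x]] by simp
  then have RS: "R (?S x) = ?S (R x)" for x
    by (simp add: bounded_clinear_simps [OF R_cl])
  show "R = ?S"
  proof (rule ext, rule ccontr)
    fix x assume neq: "R x \<noteq> ?S x"
    define y where "y = ?S x - R x"
    have "?S y + R y = (?S (?S x) - ?S (R x)) + (R (?S x) - R (R x))"
      unfolding y_def by (simp only: bounded_clinear_diff [OF R_cl] bounded_clinear_diff [OF S_cl])
    also have "\<dots> = 0"
      unfolding RS RR by (simp only: one_minus_sqrt_square) simp
    finally have "cinner (?S y) y + cinner (R y) y = 0"
      by (simp flip: cinner_add_left)
    then have sum0: "Re (cinner (?S y) y) + Re (cinner (R y) y) = 0"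
      by (simp add: complex_eq_iff)
    have real: "Im (cinner (P y) y) = 0" if "positive_op P" for P
      using that by (simp add: positive_op_def complex_nonneg_Reals_iff)
    have "cinner (?S y) y = 0" "cinner (R y) y = 0"
      using sum0 positive_op_Re [OF S, of y] positive_op_Re [OF R, of y] real [OF S] real [OF R]
      by (simp_all add: complex_eq_iff)
    then have "?S y = 0" "R y = 0"
      using positive_op_eq_0 [OF S] positive_op_eq_0 [OF R] by blast+
    moreover have "cinner y y = cinner x (?S y) - cinner x (R y)"
      unfolding positive_op_selfadjoint [OF S, symmetric] positive_op_selfadjoint [OF R, symmetric]
      by (simp only: y_def cinner_diff_left)
    ultimately have "y = 0"
      by simp
    with neq show False
      by (simp add: y_def)
  qed
qed

end

lemma one_minus_sqrt_intertwine:
  fixes B :: "'a::complex_hilbert \<Rightarrow> 'a" and B' :: "'b::complex_hilbert \<Rightarrow> 'b"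
  assumes "contraction B" "contraction B'" "bounded_clinear C" "\<And>x. C (B x) = B' (C x)"
  shows "C (one_minus_sqrt B x) = one_minus_sqrt B' (C x)"
proof (rule LIMSEQ_unique)
  show "(\<lambda>n. sqrt_iter B' n (C x)) \<longlonglongrightarrow> C (one_minus_sqrt B x)"
    using bounded_clinear_tendsto [OF assms(3) sqrt_iter_tendsto [OF assms(1)], of x]
    unfolding sqrt_iter_intertwine [of C B B', OF assms(3,4)] .
qed (rule sqrt_iter_tendsto [OF assms(2)])

section \<open>Defect operators and elementary rotations\<close>

lemma cinner_eq_of_norm_eq:
  assumes A: "bounded_clinear A" and X: "closed_csubspace X"
    and norm: "\<And>x. x \<in> X \<Longrightarrow> norm (A x) = norm x" and x: "x \<in> X" "y \<in> X"
  shows "cinner (A x) (A y) = cinner x y"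
proof -
  have Re: "Re (cinner (A x) (A y)) = Re (cinner x y)" if "x \<in> X" "y \<in> X" for x y
    using dot_norm [of "A x" "A y"] dot_norm [of x y] norm [OF that(1)] norm [OF that(2)]
      norm [OF csubspace_add [OF X that]]
    by (simp add: inner_eq_Re_cinner bounded_clinear_add [OF A])
  have "Re (cinner (A x) (A (\<i> *\<^sub>C y))) = Re (cinner x (\<i> *\<^sub>C y))"
    by (intro Re x csubspace_scaleC [OF X])
  with Re [OF x] show ?thesis
    by (simp add: complex_eq_iff cinner_simps bounded_clinear_scaleC [OF A])
qed

locale contraction_between =
  fixes X :: "'a::complex_hilbert set" and Y :: "'b::complex_hilbert set" and G :: "'a \<Rightarrow> 'b"
  assumes X: "closed_csubspace X" and Y: "closed_csubspace Y"
    and G: "G \<in> operators X Y" and contr: "contraction G"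
begin

lemma adjoint: "contraction_between Y X (adj G)"
  by unfold_locales (rule Y X adj_operators [OF G X] contraction_adj [OF contr])+

lemmas G_clinear = operators_bounded_clinear [OF G]

lemma adj_adj_G [simp]: "adj (adj G) = G"
  by (rule adj_adj [OF G_clinear])

lemma adj_G_in: "adj G y \<in> X"
  by (rule operators_in [OF adj_operators [OF G X]])

text \<open>
  \<open>I - D\<^sub>G\<^sup>2\<close> is the sum of the projection onto the orthogonal complement of \<open>X\<close> and of \<open>G\<^sup>* G\<close>, which acts
  within \<open>X\<close>. So it is a contraction, and the iteration for square roots applies to it.
\<close>

lemma codefect_contraction: "contraction (\<lambda>x. x - (ortho_proj X x - adj G (G x)))"
  unfolding contraction_def
proof (intro conjI allI)
  show "bounded_clinear (\<lambda>x. x - (ortho_proj X x - adj G (G x)))"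
    by (intro bounded_clinear_intros bounded_clinear_ortho_proj X
        bounded_clinear_compose [OF bounded_clinear_adj [OF G_clinear] G_clinear])
  fix x
  let ?P = "ortho_proj X x"
  have orth: "cinner (x - ?P) z = 0" if "z \<in> X" for z
    by (rule ortho_proj_orthogonal [OF X that])
  have "norm (adj G (G ?P)) \<le> norm ?P"
    using contraction_norm [OF contraction_adj [OF contr], of "G ?P"] contraction_norm [OF contr, of ?P]
    by linarith
  then have "(norm (adj G (G x)))\<^sup>2 \<le> (norm ?P)\<^sup>2"
    by (simp add: operators_ortho_proj [OF G X] power_mono)
  moreover have "(norm ((x - ?P) + adj G (G x)))\<^sup>2 = (norm (x - ?P))\<^sup>2 + (norm (adj G (G x)))\<^sup>2"
    by (rule norm_add_square_orthogonal [OF orth [OF adj_G_in]])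
  moreover have "(norm ((x - ?P) + ?P))\<^sup>2 = (norm (x - ?P))\<^sup>2 + (norm ?P)\<^sup>2"
    by (rule norm_add_square_orthogonal [OF orth [OF ortho_proj_in [OF X]]])
  ultimately have "(norm (x - (?P - adj G (G x))))\<^sup>2 \<le> (norm x)\<^sup>2"
    by (simp add: algebra_simps)
  then show "norm (x - (?P - adj G (G x))) \<le> norm x"
    by simp
qed

lemma codefect_selfadjoint:
  "cinner (x - (ortho_proj X x - adj G (G x))) y = cinner x (y - (ortho_proj X y - adj G (G y)))"
  by (simp add: cinner_simps cinner_ortho_proj_commute [OF X] cinner_adj [OF G_clinear]
      cinner_adj' [OF G_clinear])

abbreviation D where "D \<equiv> defect_op X G"
abbreviation D\<^sub>s where "D\<^sub>s \<equiv> defect_op Y (adj G)"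

lemma defect_op_eq: "D x = x - one_minus_sqrt (\<lambda>x. x - (ortho_proj X x - adj G (G x))) x"
  using fun_cong [OF sqrt_op_eq [OF codefect_contraction codefect_selfadjoint], of x]
  by (simp add: defect_op_def)

lemma positive_op_defect: "positive_op D"
  using positive_op_sqrt [OF codefect_contraction codefect_selfadjoint]
  by (simp add: defect_op_eq [abs_def])

lemmas defect_clinear = positive_op_bounded_clinear [OF positive_op_defect]

lemma defect_square: "D (D x) = ortho_proj X x - adj G (G x)"
  using one_minus_sqrt_square [OF codefect_contraction, of x] by (simp add: defect_op_eq)

lemma defect_selfadjoint: "cinner (D x) y = cinner x (D y)"
  by (rule positive_op_selfadjoint [OF positive_op_defect])

lemma norm_defect: "(norm (D x))\<^sup>2 + (norm (G x))\<^sup>2 = (norm (ortho_proj X x))\<^sup>2"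
proof -
  have "cinner (D x) (D x) + cinner (G x) (G x) = cinner (D (D x)) x + cinner (adj G (G x)) x"
    by (simp add: defect_selfadjoint cinner_adj' [OF G_clinear])
  also have "\<dots> = cinner (ortho_proj X x) x"
    by (simp add: defect_square cinner_simps)
  also have "\<dots> = cinner (ortho_proj X x) (ortho_proj X x)"
    by (simp add: cinner_ortho_proj_right [OF X] X)
  finally have "complex_of_real ((norm (D x))\<^sup>2 + (norm (G x))\<^sup>2) = of_real ((norm (ortho_proj X x))\<^sup>2)"
    by (simp only: cinner_self of_real_add)
  then show ?thesis
    using of_real_eq_iff by blast
qed

lemma norm_defect_le: "norm (D x) \<le> norm x"
proof -
  have "(norm (D x))\<^sup>2 \<le> (norm (ortho_proj X x))\<^sup>2"
    using norm_defect [of x] zero_le_power2 [of "norm (G x)"] by linarith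
  also have "\<dots> \<le> (norm x)\<^sup>2"
    by (intro power_mono norm_ortho_proj_le X) simp
  finally show ?thesis
    by simp
qed

text \<open>
  The operator \<open>G\<close> intertwines \<open>G\<^sup>* G\<close> and \<open>G G\<^sup>*\<close>, hence also the square roots that
  are constructed from them by iteration.
\<close>

lemma defect_intertwine: "G (D x) = D\<^sub>s (G x)"
proof -
  interpret ad: contraction_between Y X "adj G"
    by (rule adjoint)
  have "G (one_minus_sqrt (\<lambda>x. x - (ortho_proj X x - adj G (G x))) x) =
      one_minus_sqrt (\<lambda>x. x - (ortho_proj Y x - adj (adj G) (adj G x))) (G x)"
    by (rule one_minus_sqrt_intertwine [OF codefect_contraction ad.codefect_contraction G_clinear])
      (simp add: bounded_clinear_simps [OF G_clinear] operators_ortho_proj [OF G X]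
        ortho_proj_id [OF Y] operators_in [OF G])
  then show ?thesis
    by (simp add: defect_op_eq ad.defect_op_eq bounded_clinear_simps [OF G_clinear])
qed

lemma defect_commute_proj: "ortho_proj X (D x) = D (ortho_proj X x)"
proof -
  have "ortho_proj X (one_minus_sqrt (\<lambda>x. x - (ortho_proj X x - adj G (G x))) x) =
      one_minus_sqrt (\<lambda>x. x - (ortho_proj X x - adj G (G x))) (ortho_proj X x)"
    by (rule one_minus_sqrt_intertwine [OF codefect_contraction codefect_contraction
          bounded_clinear_ortho_proj [OF X]])
      (simp add: bounded_clinear_simps [OF bounded_clinear_ortho_proj [OF X]]
        operators_ortho_proj [OF G X] ortho_proj_id [OF X] adj_G_in X)
  then show ?thesis
    by (simp add: defect_op_eq bounded_clinear_simps [OF bounded_clinear_ortho_proj [OF X]])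
qed

lemma defect_ortho_proj: "D (ortho_proj X x) = D x"
proof -
  have "ortho_proj X (x - ortho_proj X x) = 0"
    by (simp add: bounded_clinear_simps [OF bounded_clinear_ortho_proj [OF X]] X)
  then have "D (x - ortho_proj X x) = 0"
    using norm_defect [of "x - ortho_proj X x"] by (simp add: sum_power2_eq_zero_iff)
  then show ?thesis
    by (simp add: bounded_clinear_simps [OF defect_clinear])
qed

lemma defect_in: "D x \<in> X"
  using defect_commute_proj [of x] ortho_proj_in [OF X, of "D x"] by (simp add: defect_ortho_proj)

lemma defect_in_space: "D x \<in> defect_space X G"
  unfolding defect_space_def by (rule subsetD [OF closure_subset]) simp

lemma closed_defect_space: "closed_csubspace (defect_space X G)"
  unfolding defect_space_def by (rule closed_csubspace_closure_range [OF defect_clinear])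

lemma defect_space_subset: "defect_space X G \<subseteq> X"
  unfolding defect_space_def using defect_in X
  by (intro closure_minimal) (auto simp: closed_csubspace_def)

lemma defect_space_approx:
  assumes "x \<in> defect_space X G"
  obtains u where "(\<lambda>n. D (u n)) \<longlonglongrightarrow> x"
  using assms unfolding defect_space_def closure_range_sequential by auto

text \<open>The kernel of a selfadjoint operator is orthogonal to its range.\<close>

lemma defect_inj:
  assumes x: "x \<in> defect_space X G" and Dx: "D x = 0"
  shows "x = 0"
proof -
  obtain u where u: "(\<lambda>n. D (u n)) \<longlonglongrightarrow> x"
    using defect_space_approx [OF x] .
  have "cinner x (D v) = 0" for v
    by (simp add: Dx flip: defect_selfadjoint)
  then have "(\<lambda>n. 0) \<longlonglongrightarrow> cinner x x"
    using tendsto_cinner [OF tendsto_const u, of x] by simp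
  then show ?thesis
    using LIMSEQ_unique [OF tendsto_const] by fastforce
qed

lemma maps_defect_space:
  assumes "x \<in> defect_space X G"
  shows "G x \<in> defect_space Y (adj G)"
proof -
  obtain u where "(\<lambda>n. D (u n)) \<longlonglongrightarrow> x"
    using defect_space_approx [OF assms] .
  then have "(\<lambda>n. G (D (u n))) \<longlonglongrightarrow> G x"
    by (rule bounded_clinear_tendsto [OF G_clinear])
  then have "\<exists>v. (\<lambda>n. D\<^sub>s (v n)) \<longlonglongrightarrow> G x"
    unfolding defect_intertwine by (rule exI [of _ "\<lambda>n. G (u n)"])
  then show ?thesis
    unfolding defect_space_def closure_range_sequential .
qed

end

definition elementary_rotation ::
    "'a::complex_inner set \<Rightarrow> 'b::complex_inner set \<Rightarrow> ('a \<Rightarrow> 'b) \<Rightarrow> 'a \<times> 'b \<Rightarrow> 'b \<times> 'a" where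
  "elementary_rotation X Y G =
     (\<lambda>(x, y). (G x + defect_op Y (adj G) y, defect_op X G x - adj G y))"

context contraction_between
begin

lemma elementary_rotation_in:
  assumes "x \<in> X" "y \<in> defect_space Y (adj G)"
  shows "elementary_rotation X Y G (x, y) \<in> Y \<times> defect_space X G"
proof -
  interpret ad: contraction_between Y X "adj G"
    by (rule adjoint)
  have "adj G y \<in> defect_space X G"
    using ad.maps_defect_space [OF assms(2)] by simp
  then show ?thesis
    by (simp add: elementary_rotation_def csubspace_add [OF Y] operators_in [OF G] ad.defect_in
        csubspace_diff [OF closed_defect_space] defect_in_space)
qed

text \<open>The mixed terms cancel by \<open>defect_intertwine\<close>.\<close>

lemma elementary_rotation_inverse:
  assumes "x \<in> X" "y \<in> Y"
  shows "elementary_rotation Y X (adj G) (elementary_rotation X Y G (x, y)) = (x, y)"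
proof -
  interpret ad: contraction_between Y X "adj G"
    by (rule adjoint)
  show ?thesis
    using assms ad.defect_intertwine [of y]
    by (simp add: elementary_rotation_def bounded_clinear_simps [OF G_clinear]
        bounded_clinear_simps [OF ad.G_clinear] bounded_clinear_simps [OF defect_clinear]
        bounded_clinear_simps [OF ad.defect_clinear] defect_square ad.defect_square
        defect_intertwine X Y)
qed

lemma elementary_rotation_adjoint:
  "cinner (elementary_rotation X Y G p) q = cinner p (elementary_rotation Y X (adj G) q)"
proof -
  interpret ad: contraction_between Y X "adj G"
    by (rule adjoint)
  show ?thesis
    by (cases p, cases q)
      (simp add: elementary_rotation_def cinner_simps defect_selfadjoint ad.defect_selfadjoint
        cinner_adj [OF G_clinear] cinner_adj' [OF G_clinear])
qed

lemma elementary_rotation_cinner: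
  assumes "p \<in> X \<times> Y" "q \<in> X \<times> Y"
  shows "cinner (elementary_rotation X Y G p) (elementary_rotation X Y G q) = cinner p q"
  using assms elementary_rotation_inverse by (auto simp: elementary_rotation_adjoint)

lemma elementary_rotation_clinear: "bounded_clinear (elementary_rotation X Y G)"
proof -
  interpret ad: contraction_between Y X "adj G"
    by (rule adjoint)
  have "bounded_clinear (\<lambda>p. (G (fst p) + D\<^sub>s (snd p), D (fst p) - adj G (snd p)))"
    by (intro bounded_clinear_intros
        bounded_clinear_compose [OF _ bounded_clinear_fst]
        bounded_clinear_compose [OF _ bounded_clinear_snd]
        G_clinear ad.G_clinear defect_clinear ad.defect_clinear)
  then show ?thesis
    by (simp add: elementary_rotation_def case_prod_unfold)
qed

end

section \<open>Unitary operators between closed subspaces\<close>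

definition unitary_op ::
    "'a::complex_hilbert set \<Rightarrow> 'b::complex_hilbert set \<Rightarrow> ('a \<Rightarrow> 'b) \<Rightarrow> bool" where
  "unitary_op X Y U \<longleftrightarrow> closed_csubspace X \<and> closed_csubspace Y \<and> U \<in> operators X Y \<and>
     (\<forall>x\<in>X. adj U (U x) = x) \<and> (\<forall>y\<in>Y. U (adj U y) = y)"

context
  fixes X :: "'a::complex_hilbert set" and Y :: "'b::complex_hilbert set" and U
  assumes U: "unitary_op X Y U"
begin

lemma unitary_op_operators: "U \<in> operators X Y"
  and unitary_op_domain: "closed_csubspace X"
  and unitary_op_inverse: "x \<in> X \<Longrightarrow> adj U (U x) = x"
  and unitary_op_inverse': "y \<in> Y \<Longrightarrow> U (adj U y) = y"
  using U by (auto simp: unitary_op_def)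

lemmas unitary_op_clinear = operators_bounded_clinear [OF unitary_op_operators]
lemmas unitary_op_in = operators_in [OF unitary_op_operators]

lemma unitary_op_adj: "unitary_op Y X (adj U)"
  using U adj_operators [OF unitary_op_operators unitary_op_domain] adj_adj [OF unitary_op_clinear]
  by (simp add: unitary_op_def)

lemma unitary_op_cinner: "x \<in> X \<Longrightarrow> cinner (U x) (U y) = cinner x y"
  using cinner_adj' [OF unitary_op_clinear, of "U x" y] by (simp add: unitary_op_inverse)

lemma unitary_op_norm: "x \<in> X \<Longrightarrow> norm (U x) = norm x"
  by (simp add: norm_eq_cinner unitary_op_cinner)

lemma unitary_op_swap: "x \<in> X \<Longrightarrow> y \<in> Y \<Longrightarrow> adj U y = x \<longleftrightarrow> U x = y"
  using unitary_op_inverse unitary_op_inverse' by auto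

end

lemma isometry_adj_inverse:
  fixes X :: "'a::complex_hilbert set" and V :: "'a \<Rightarrow> 'b::complex_hilbert"
  assumes X: "closed_csubspace X" and V: "V \<in> operators X Y"
    and isometric: "\<And>x. x \<in> X \<Longrightarrow> norm (V x) = norm x" and x: "x \<in> X"
  shows "adj V (V x) = x"
proof (rule cinner_ext)
  note V_cl = operators_bounded_clinear [OF V]
  fix z
  have "cinner z (adj V (V x)) = cinner (V (ortho_proj X z)) (V x)"
    by (simp add: cinner_adj [OF V_cl, symmetric] operators_ortho_proj [OF V X])
  also have "\<dots> = cinner (ortho_proj X z) x"
    by (rule cinner_eq_of_norm_eq [OF V_cl X isometric]) (simp_all add: X x)
  also have "\<dots> = cinner z x"
    by (rule cinner_ortho_proj_left [OF X x])
  finally show "cinner z (adj V (V x)) = cinner z x" .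
qed

lemma unitary_opI:
  fixes X :: "'a::complex_hilbert set" and Y :: "'b::complex_hilbert set"
  assumes X: "closed_csubspace X" and Y: "closed_csubspace Y" and U: "U \<in> operators X Y"
    and isometric: "\<And>x. x \<in> X \<Longrightarrow> norm (U x) = norm x"
    and onto: "\<And>y. y \<in> Y \<Longrightarrow> \<exists>x\<in>X. U x = y"
  shows "unitary_op X Y U"
proof -
  have inv: "adj U (U x) = x" if "x \<in> X" for x
    by (rule isometry_adj_inverse [OF X U isometric that])
  moreover have "U (adj U y) = y" if y: "y \<in> Y" for y
    using onto [OF y] inv by auto
  ultimately show ?thesis
    using X Y U by (simp add: unitary_op_def)
qed

text \<open>
  The partial isometry of a polar decomposition: it is determined on the range of \<open>f\<close> and extends
  to the closure by continuity.
\<close>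

lemma isometry_extension:
  fixes f :: "'a::complex_inner \<Rightarrow> 'b::complex_hilbert" and g :: "'a \<Rightarrow> 'c::complex_hilbert"
  assumes f: "bounded_clinear f" and g: "bounded_clinear g" and norm: "\<And>x. norm (f x) = norm (g x)"
  obtains V where "V \<in> operators (closure (range f)) (closure (range g))"
    "\<And>y. y \<in> closure (range f) \<Longrightarrow> norm (V y) = norm y" "\<And>x. V (f x) = g x"
proof -
  define R where "R y z \<longleftrightarrow> (\<exists>u. (\<lambda>n. f (u n)) \<longlonglongrightarrow> y \<and> (\<lambda>n. g (u n)) \<longlonglongrightarrow> z)" for y z
  have R_norm: "norm z = norm y" if "R y z" for y z
  proof -
    obtain u where u: "(\<lambda>n. f (u n)) \<longlonglongrightarrow> y" "(\<lambda>n. g (u n)) \<longlonglongrightarrow> z"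
      using \<open>R y z\<close> unfolding R_def by auto
    have "(\<lambda>n. norm (f (u n))) \<longlonglongrightarrow> norm y" "(\<lambda>n. norm (f (u n))) \<longlonglongrightarrow> norm z"
      using tendsto_norm [OF u(1)] tendsto_norm [OF u(2)] by (simp_all add: norm)
    then show ?thesis
      using LIMSEQ_unique by blast
  qed
  have R_add: "R (y + y') (z + z')" if yz: "R y z" "R y' z'" for y z y' z'
  proof -
    obtain u u' where u: "(\<lambda>n. f (u n)) \<longlonglongrightarrow> y" "(\<lambda>n. g (u n)) \<longlonglongrightarrow> z"
        "(\<lambda>n. f (u' n)) \<longlonglongrightarrow> y'" "(\<lambda>n. g (u' n)) \<longlonglongrightarrow> z'"
      using yz unfolding R_def by auto
    then show ?thesis
      unfolding R_def
      by (intro exI [of _ "\<lambda>n. u n + u' n"])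
        (simp add: bounded_clinear_add [OF f] bounded_clinear_add [OF g] tendsto_add)
  qed
  have R_scale: "R (c *\<^sub>C y) (c *\<^sub>C z)" if yz: "R y z" for y z c
  proof -
    obtain u where u: "(\<lambda>n. f (u n)) \<longlonglongrightarrow> y" "(\<lambda>n. g (u n)) \<longlonglongrightarrow> z"
      using yz unfolding R_def by auto
    then show ?thesis
      unfolding R_def
      by (intro exI [of _ "\<lambda>n. c *\<^sub>C u n"])
        (simp add: bounded_clinear_scaleC [OF f] bounded_clinear_scaleC [OF g] tendsto_scaleC)
  qed
  have R_unique: "z = z'" if "R y z" "R y z'" for y z z'
  proof -
    have "R (y + (- 1) *\<^sub>C y) (z + (- 1) *\<^sub>C z')"
      by (intro R_add R_scale that)
    then show ?thesis
      using R_norm by fastforce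
  qed
  have R_f: "R (f x) (g x)" for x
    unfolding R_def by (intro exI [of _ "\<lambda>_. x"]) simp
  have R_ex: "\<exists>z. R y z" if "y \<in> closure (range f)" for y
  proof -
    obtain u where u: "(\<lambda>n. f (u n)) \<longlonglongrightarrow> y"
      using \<open>y \<in> closure (range f)\<close> unfolding closure_range_sequential by auto
    have "norm (g (u m) - g (u n)) = norm (f (u m) - f (u n))" for m n
      by (metis bounded_clinear_diff f g norm)
    then have "Cauchy (\<lambda>n. g (u n))"
      using LIMSEQ_imp_Cauchy [OF u] by (simp add: Cauchy_iff)
    then obtain z where "(\<lambda>n. g (u n)) \<longlonglongrightarrow> z"
      using Cauchy_convergent convergent_def by blast
    with u show ?thesis
      unfolding R_def by (intro exI [of _ z] exI [of _ u]) simp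
  qed
  define V0 where "V0 y = (THE z. R y z)" for y
  have V0: "R y (V0 y)" if "y \<in> closure (range f)" for y
    unfolding V0_def by (rule theI') (use R_ex [OF that] R_unique in blast)
  have V0_eq: "V0 y = z" if "R y z" for y z
    unfolding V0_def by (rule the_equality) (use that R_unique in blast)+
  let ?X = "closure (range f)"
  have X: "closed_csubspace ?X"
    by (rule closed_csubspace_closure_range [OF f])
  define V where "V y = V0 (ortho_proj ?X y)" for y
  note P = bounded_clinear_simps [OF bounded_clinear_ortho_proj [OF X]]
  show ?thesis
  proof
    show "V \<in> operators ?X (closure (range g))"
    proof (rule operatorsI [OF _ X])
      show "bounded_clinear V"
      proof (rule bounded_clinearI [of _ 1])
        fix x y c
        show "V (x + y) = V x + V y" "V (c *\<^sub>C x) = c *\<^sub>C V x"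
          unfolding V_def P by (intro V0_eq R_add R_scale V0 ortho_proj_in X)+
        show "norm (V x) \<le> 1 * norm x"
          using R_norm [OF V0 [OF ortho_proj_in [OF X], of x]] norm_ortho_proj_le [OF X, of x]
          by (simp add: V_def)
      qed
      fix y
      obtain u where "(\<lambda>n. g (u n)) \<longlonglongrightarrow> V y"
        using V0 [OF ortho_proj_in [OF X], of y] unfolding R_def V_def by auto
      then show "V y \<in> closure (range g)"
        unfolding closure_range_sequential by (rule exI [of _ u])
      show "V (ortho_proj ?X y) = V y"
        by (simp add: V_def X)
    qed
    show "norm (V y) = norm y" if "y \<in> ?X" for y
      using R_norm [OF V0 [OF that]] that by (simp add: V_def X)
    show "V (f x) = g x" for x
    proof -
      have "f x \<in> ?X"
        by (rule subsetD [OF closure_subset]) simp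
      then show ?thesis
        using V0_eq [OF R_f [of x]] by (simp add: V_def X)
    qed
  qed
qed

section \<open>Splitting off an elementary rotation\<close>

lemma ortho_proj_Times:
  fixes X :: "'a::complex_hilbert set" and Y :: "'b::complex_hilbert set"
  assumes "closed_csubspace X" "closed_csubspace Y"
  shows "ortho_proj (X \<times> Y) (x, y) = (ortho_proj X x, ortho_proj Y y)"
  by (rule ortho_proj_unique [OF closed_csubspace_Times [OF assms]])
    (auto simp: assms ortho_proj_orthogonal)

text \<open>
  Let \<open>U : M \<oplus> K \<rightarrow> N \<oplus> K\<close> be unitary with corner \<open>G : M \<rightarrow> N\<close>. The isometry \<open>V\<close> embeds the defect space
  of \<open>G\<close> in the state space \<open>K\<close>, and \<open>K'\<close> is what it leaves. The condition says that
  \<open>U = (J\<^sub>G \<oplus> I) (I \<oplus> U'\<inverse>)\<close> when \<open>K\<close> is written as the sum of the defect space and \<open>K'\<close>. Taking the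
  inverse of the remaining factor exchanges the roles of \<open>M\<close> and \<open>N\<close>, so that repeated splitting
  produces the alternation of defect spaces that the CMV matrices have.
\<close>

definition splits_off ::
    "'m::complex_hilbert set \<Rightarrow> 'n::complex_hilbert set \<Rightarrow> 'k::complex_hilbert set \<Rightarrow> ('m \<Rightarrow> 'n) \<Rightarrow>
     ('m \<times> 'k \<Rightarrow> 'n \<times> 'k) \<Rightarrow> ('m \<Rightarrow> 'k) \<Rightarrow> 'k set \<Rightarrow> ('n \<times> 'k \<Rightarrow> 'm \<times> 'k) \<Rightarrow> bool" where
  "splits_off M N K G U V K' U' \<longleftrightarrow>
     V \<in> operators (defect_space M G) K \<and>
     (\<forall>m\<in>defect_space M G. norm (V m) = norm m) \<and>
     K' = {k \<in> K. \<forall>z\<in>V ` defect_space M G. cinner k z = 0} \<and>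
     unitary_op (defect_space N (adj G) \<times> K') (defect_space M G \<times> K') U' \<and>
     (\<forall>m\<in>M. \<forall>n\<in>defect_space N (adj G). \<forall>k\<in>K'.
        U (m, V (fst (U' (n, k))) + snd (U' (n, k))) =
        (G m + defect_op N (adj G) n, V (defect_op M G m - adj G n) + k))"

locale isometric_embedding =
  fixes X :: "'a::complex_hilbert set" and K :: "'k::complex_hilbert set" and V :: "'a \<Rightarrow> 'k"
    and K' :: "'k set"
  assumes X: "closed_csubspace X" and K: "closed_csubspace K" and V: "V \<in> operators X K"
    and isometric: "\<And>x. x \<in> X \<Longrightarrow> norm (V x) = norm x"
    and K'_eq: "K' = {k \<in> K. \<forall>z\<in>V ` X. cinner k z = 0}"
begin

lemmas V_clinear = operators_bounded_clinear [OF V]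

lemma V_in: "V x \<in> K"
  by (rule operators_in [OF V])

lemma adj_V_in: "adj V k \<in> X"
  by (rule operators_in [OF adj_operators [OF V X]])

lemma adj_V_clinear: "bounded_clinear (adj V)"
  by (rule bounded_clinear_adj [OF V_clinear])

lemma K': "closed_csubspace K'"
  unfolding K'_eq by (rule closed_csubspace_orthogonal_complement [OF K])

lemma K'_subset: "k \<in> K' \<Longrightarrow> k \<in> K"
  by (simp add: K'_eq)

lemma adj_V_V: "x \<in> X \<Longrightarrow> adj V (V x) = x"
  by (rule isometry_adj_inverse [OF X V isometric])

lemma adj_V_K': "k \<in> K' \<Longrightarrow> adj V k = 0"
proof (rule cinner_ext)
  fix z assume "k \<in> K'"
  moreover have "V z = V (ortho_proj X z)"
    by (simp add: operators_ortho_proj [OF V X])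
  ultimately have "cinner k (V z) = 0"
    by (auto simp: K'_eq X)
  then show "cinner z (adj V k) = cinner z 0"
    using cinner_eq_0_commute by (simp flip: cinner_adj [OF V_clinear])
qed

lemma orthogonal: "k \<in> K' \<Longrightarrow> cinner (V x) k = 0"
  by (simp add: cinner_adj [OF V_clinear] adj_V_K')

lemma remainder_in: "k \<in> K \<Longrightarrow> k - V (adj V k) \<in> K'"
proof -
  have "cinner (V (adj V k)) (V x) = cinner k (V x)" if "x \<in> X" for x
    using cinner_adj' [OF V_clinear, of k x] cinner_adj [OF V_clinear, of "adj V k" "V x"]
    by (simp add: adj_V_V [OF that])
  then show "k \<in> K \<Longrightarrow> k - V (adj V k) \<in> K'"
    by (auto simp: K'_eq cinner_simps csubspace_diff [OF K] V_in)
qed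

lemma adj_V_sum: "x \<in> X \<Longrightarrow> k \<in> K' \<Longrightarrow> adj V (V x + k) = x"
  by (simp add: bounded_clinear_simps [OF adj_V_clinear] adj_V_V adj_V_K')

lemma norm_sum:
  assumes "x \<in> X" "k \<in> K'"
  shows "(norm (V x + k))\<^sup>2 = (norm x)\<^sup>2 + (norm k)\<^sup>2"
  using norm_add_square_orthogonal [OF orthogonal [OF assms(2)], of x] isometric [OF assms(1)] by simp

end

text \<open>
  The first column of \<open>U\<close> is \<open>(G, C)\<close> with \<open>C\<^sup>* C = D\<^sub>G\<^sup>2\<close>, so that \<open>C = V D\<^sub>G\<close> with an isometry \<open>V\<close>; this
  column is \<open>J\<^sub>G\<close> applied to the inclusion of \<open>M\<close>. The inverse of \<open>J\<^sub>G\<close> therefore turns \<open>U\<close> into an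
  operator that is the identity on \<open>M\<close>, and hence maps the orthogonal complement \<open>K\<close> of \<open>M\<close> onto that
  of \<open>M\<close>.
\<close>

lemma splits_off_exists:
  fixes U :: "'m::complex_hilbert \<times> 'k::complex_hilbert \<Rightarrow> 'n::complex_hilbert \<times> 'k"
  assumes "contraction_between M N G" and K: "closed_csubspace K"
    and U: "unitary_op (M \<times> K) (N \<times> K) U" and corner: "\<And>m. m \<in> M \<Longrightarrow> fst (U (m, 0)) = G m"
  obtains V K' U' where "splits_off M N K G U V K' U'"
proof -
  interpret g: contraction_between M N G
    by fact
  interpret ad: contraction_between N M "adj G"
    by (rule g.adjoint)
  let ?M' = "defect_space M G" and ?N' = "defect_space N (adj G)"
  let ?D = "defect_op M G" and ?D\<^sub>s = "defect_op N (adj G)"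
  note U_cl = unitary_op_clinear [OF U]
  have zero_in: "0 \<in> K"
    by (rule csubspace_zero [OF K])
  have U_proj: "U (m, 0) = U (ortho_proj M m, 0)" for m
    using operators_ortho_proj [OF unitary_op_operators [OF U] unitary_op_domain [OF U], of "(m, 0)"]
    by (simp add: ortho_proj_Times g.X K zero_in)
  have fst_U: "fst (U (m, 0)) = G m" for m
    using corner [of "ortho_proj M m"] by (simp add: U_proj [of m] g.X operators_ortho_proj [OF g.G g.X])
  define C where "C m = snd (U (m, 0))" for m
  have C_clinear: "bounded_clinear C"
    unfolding C_def
    by (intro bounded_clinear_compose [OF bounded_clinear_snd] bounded_clinear_compose [OF U_cl]
        bounded_clinear_Pair bounded_clinear_id) (auto intro: bounded_clinearI [of _ 0])
  have C_in: "C m \<in> K" for m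
    using unitary_op_in [OF U, of "(m, 0)"] by (auto simp: C_def mem_Times_iff)
  have norm_C: "norm (?D m) = norm (C m)" for m
  proof -
    have "norm (U (m, 0)) = norm (ortho_proj M m)"
      using unitary_op_norm [OF U, of "(ortho_proj M m, 0)"]
      by (simp add: U_proj [of m] g.X zero_in norm_Pair)
    moreover have "U (m, 0) = (G m, C m)"
      by (simp add: C_def fst_U prod_eq_iff)
    ultimately have "(norm (G m))\<^sup>2 + (norm (C m))\<^sup>2 = (norm (ortho_proj M m))\<^sup>2"
      by (metis norm_Pair_square)
    with g.norm_defect [of m] have "(norm (?D m))\<^sup>2 = (norm (C m))\<^sup>2"
      by linarith
    then show ?thesis
      by simp
  qed
  obtain V where V: "V \<in> operators ?M' (closure (range C))"
      "\<And>y. y \<in> ?M' \<Longrightarrow> norm (V y) = norm y" "\<And>m. V (?D m) = C m"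
    unfolding defect_space_def
    using isometry_extension [OF g.defect_clinear C_clinear norm_C] by metis
  have "closure (range C) \<subseteq> K"
    using K C_in by (intro closure_minimal) (auto simp: closed_csubspace_def)
  then have V_op: "V \<in> operators ?M' K"
    using V(1) by (auto simp: operators_def)
  define K' where "K' = {k \<in> K. \<forall>z\<in>V ` ?M'. cinner k z = 0}"
  interpret v: isometric_embedding ?M' K V K'
    by unfold_locales (use g.closed_defect_space K V_op V(2) K'_def in auto)
  have U_m: "U (m, 0) = (G m, V (?D m))" for m
    by (simp add: V(3) C_def fst_U prod_eq_iff)
  have dom: "closed_csubspace (?N' \<times> K')"
    by (intro closed_csubspace_Times ad.closed_defect_space v.K')
  define Z where "Z p = (?D\<^sub>s (fst p), snd p - V (adj G (fst p)))" for p
  define q where "q p = snd (adj U (Z p))" for p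
  define U' where "U' p = (let r = q (ortho_proj (?N' \<times> K') p) in (adj V r, r - V (adj V r)))" for p
  have G_in: "adj G n \<in> ?M'" if "n \<in> ?N'" for n
    using ad.maps_defect_space [OF that] by simp
  \<comment> \<open>\<open>Z (n, k)\<close> is \<open>J\<^sub>G (0, n)\<close> with the state \<open>k\<close> added. It is orthogonal to the first column of \<open>U\<close>.\<close>
  have UZ: "U (0, q (n, k)) = Z (n, k) \<and> q (n, k) \<in> K" if nk: "n \<in> ?N'" "k \<in> K'" for n k
  proof -
    have Z_in: "Z (n, k) \<in> N \<times> K"
      using nk by (auto simp: Z_def ad.defect_in csubspace_diff [OF K] v.V_in v.K'_subset)
    then have in_MK: "adj U (Z (n, k)) \<in> M \<times> K"
      using unitary_op_in [OF unitary_op_adj [OF U]] by blast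
    let ?m = "fst (adj U (Z (n, k)))"
    have "cinner (?m, 0) (adj U (Z (n, k))) = cinner (G ?m) (?D\<^sub>s n) - cinner (V (?D ?m)) (V (adj G n))"
      using nk by (simp add: cinner_adj [OF U_cl, symmetric] U_m Z_def cinner_simps v.orthogonal)
    also have "\<dots> = cinner (?D\<^sub>s (G ?m)) n - cinner (?D ?m) (adj G n)"
      using cinner_eq_of_norm_eq [OF v.V_clinear g.closed_defect_space V(2)] nk G_in g.defect_in_space
      by (simp add: ad.defect_selfadjoint)
    also have "\<dots> = 0"
      by (simp add: cinner_adj [OF g.G_clinear, symmetric] g.defect_intertwine)
    finally have m0: "?m = 0"
      by (simp add: cinner_prod_def)
    then have "adj U (Z (n, k)) = (0, q (n, k))"
      by (simp add: q_def prod_eq_iff)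
    with in_MK unitary_op_inverse' [OF U Z_in] show ?thesis
      by auto
  qed
  have U'_eq: "U' (n, k) = (adj V (q (n, k)), q (n, k) - V (adj V (q (n, k))))"
    if "n \<in> ?N'" "k \<in> K'" for n k
    using that by (simp add: U'_def Let_def ortho_proj_id [OF dom])
  have "bounded_clinear (\<lambda>p. (adj V (q p), q p - V (adj V (q p))))"
  proof -
    have "bounded_clinear Z"
      unfolding Z_def [abs_def]
      by (intro bounded_clinear_Pair bounded_clinear_sub bounded_clinear_snd
          bounded_clinear_compose [OF ad.defect_clinear bounded_clinear_fst]
          bounded_clinear_compose [OF v.V_clinear bounded_clinear_compose [OF ad.G_clinear bounded_clinear_fst]])
    then have q_cl: "bounded_clinear q"
      unfolding q_def [abs_def]
      by (intro bounded_clinear_compose [OF bounded_clinear_snd]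
          bounded_clinear_compose [OF bounded_clinear_adj [OF U_cl]])
    then have Vq: "bounded_clinear (\<lambda>p. adj V (q p))"
      by (rule bounded_clinear_compose [OF v.adj_V_clinear])
    show ?thesis
      by (rule bounded_clinear_Pair [OF Vq bounded_clinear_sub [OF q_cl
            bounded_clinear_compose [OF v.V_clinear Vq]]])
  qed
  from bounded_clinear_compose [OF this bounded_clinear_ortho_proj [OF dom]]
  have U'_cl: "bounded_clinear U'"
    by (simp add: U'_def [abs_def] Let_def)
  have U'_op: "U' \<in> operators (?N' \<times> K') (?M' \<times> K')"
  proof (rule operatorsI [OF U'_cl dom])
    fix p
    have "ortho_proj (?N' \<times> K') p \<in> ?N' \<times> K'"
      by (rule ortho_proj_in [OF dom])
    then have "q (ortho_proj (?N' \<times> K') p) \<in> K"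
      using UZ by (metis prod.collapse mem_Times_iff)
    then show "U' p \<in> ?M' \<times> K'"
      by (simp add: U'_def Let_def v.adj_V_in v.remainder_in)
    show "U' (ortho_proj (?N' \<times> K') p) = U' p"
      by (simp add: U'_def ortho_proj_id [OF dom] ortho_proj_in [OF dom])
  qed
  have "unitary_op (?N' \<times> K') (?M' \<times> K') U'"
  proof (rule unitary_opI [OF dom closed_csubspace_Times [OF g.closed_defect_space v.K'] U'_op])
    fix p assume "p \<in> ?N' \<times> K'"
    then obtain n k where p: "p = (n, k)" "n \<in> ?N'" "k \<in> K'"
      by blast
    have n: "n \<in> N"
      using p(2) ad.defect_space_subset by blast
    let ?q = "q (n, k)"
    have "(norm (U' p))\<^sup>2 = (norm (V (adj V ?q) + (?q - V (adj V ?q))))\<^sup>2"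
      using UZ p by (subst v.norm_sum) (auto simp: U'_eq norm_Pair_square v.adj_V_in v.remainder_in)
    also have "\<dots> = (norm ((0::'m), ?q))\<^sup>2"
      by (simp add: norm_Pair)
    also have "\<dots> = (norm (Z (n, k)))\<^sup>2"
      using UZ [OF p(2,3)] unitary_op_norm [OF U, of "(0, ?q)"] by (simp add: csubspace_zero g.X)
    also have "\<dots> = (norm (?D\<^sub>s n))\<^sup>2 + (norm (V (- adj G n) + k))\<^sup>2"
      by (simp add: Z_def norm_Pair_square bounded_clinear_simps [OF v.V_clinear])
    also have "\<dots> = (norm (?D\<^sub>s n))\<^sup>2 + ((norm (adj G n))\<^sup>2 + (norm k)\<^sup>2)"
      using G_in [OF p(2)] p(3) by (subst v.norm_sum) (auto simp: csubspace_minus [OF g.closed_defect_space])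
    also have "\<dots> = (norm n)\<^sup>2 + (norm k)\<^sup>2"
      using ad.norm_defect [of n] n by (simp add: g.Y)
    also have "\<dots> = (norm p)\<^sup>2"
      by (simp add: p(1) norm_Pair_square)
    finally show "norm (U' p) = norm p"
      by simp
  next
    fix r assume "r \<in> ?M' \<times> K'"
    then obtain m1 k' where r: "r = (m1, k')" "m1 \<in> ?M'" "k' \<in> K'"
      by blast
    define q0 where "q0 = V m1 + k'"
    have q0: "(0, q0) \<in> M \<times> K"
      using r by (auto simp: q0_def csubspace_add [OF K] v.V_in v.K'_subset csubspace_zero [OF g.X])
    obtain n0 l where nl: "U (0, q0) = (n0, l)"
      by fastforce
    have nl_in: "n0 \<in> N" "l \<in> K"
      using unitary_op_in [OF U, of "(0, q0)"] by (auto simp: nl)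
    define m2 where "m2 = adj V l"
    have m2: "m2 \<in> ?M'"
      by (simp add: m2_def v.adj_V_in)
    \<comment> \<open>Onto: \<open>U (0, q0)\<close> is orthogonal to the first column, so its rotated back first component vanishes.\<close>
    have "cinner (adj G n0 + ?D m2) m = 0" for m
    proof -
      have "cinner (adj G n0 + ?D m2) m = cinner n0 (G m) + cinner l (V (?D m))"
        by (simp add: cinner_simps cinner_adj' [OF g.G_clinear] g.defect_selfadjoint m2_def
            cinner_adj' [OF v.V_clinear])
      also have "\<dots> = cinner (U (0, q0)) (U (m, 0))"
        by (simp add: nl U_m)
      also have "\<dots> = 0"
        by (simp add: unitary_op_cinner [OF U q0])
      finally show ?thesis .
    qed
    then have "adj G n0 + ?D m2 = 0"
      using cinner_self_eq_0 by blast
    define n1 where "n1 = ?D\<^sub>s n0 - G m2"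
    have rot: "elementary_rotation N M (adj G) (n0, m2) = (0, n1)"
      using \<open>adj G n0 + ?D m2 = 0\<close> by (simp add: elementary_rotation_def n1_def)
    then have n1: "n1 \<in> ?N'"
      using ad.elementary_rotation_in [of n0 m2] nl_in m2 by simp
    have "elementary_rotation M N G (0, n1) = (n0, m2)"
      using ad.elementary_rotation_inverse [of n0 m2] nl_in m2 g.defect_space_subset
      by (auto simp: rot)
    then have J: "?D\<^sub>s n1 = n0" "- adj G n1 = m2"
      by (simp_all add: elementary_rotation_def bounded_clinear_simps [OF g.G_clinear]
          bounded_clinear_simps [OF g.defect_clinear])
    define k1 where "k1 = l - V m2"
    have k1: "k1 \<in> K'"
      using v.remainder_in [OF nl_in(2)] by (simp add: k1_def m2_def)
    have "V (adj G n1) = - V m2"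
      using J(2) bounded_clinear_minus [OF v.V_clinear, of "adj G n1"] by simp
    then have "Z (n1, k1) = (n0, l)"
      by (simp add: Z_def J(1) k1_def)
    then have "adj U (Z (n1, k1)) = (0, q0)"
      using unitary_op_inverse [OF U q0] by (simp add: nl)
    then have "q (n1, k1) = q0"
      by (simp add: q_def)
    moreover have "adj V q0 = m1"
      unfolding q0_def by (rule v.adj_V_sum [OF r(2,3)])
    ultimately have "U' (n1, k1) = r"
      by (simp add: U'_eq [OF n1 k1] r(1)) (simp add: q0_def)
    then show "\<exists>p\<in>?N' \<times> K'. U' p = r"
      using n1 k1 by blast
  qed
  moreover have "U (m, V (fst (U' (n, k))) + snd (U' (n, k))) =
      (G m + ?D\<^sub>s n, V (?D m - adj G n) + k)"
    if "m \<in> M" "n \<in> ?N'" "k \<in> K'" for m n k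
  proof -
    have "U (m, V (fst (U' (n, k))) + snd (U' (n, k))) = U ((m, 0) + (0, q (n, k)))"
      using that by (simp add: U'_eq)
    also have "\<dots> = U (m, 0) + U (0, q (n, k))"
      by (rule bounded_clinear_add [OF U_cl])
    also have "\<dots> = (G m + ?D\<^sub>s n, V (?D m - adj G n) + k)"
      using UZ [OF that(2,3)] by (simp add: U_m Z_def bounded_clinear_simps [OF v.V_clinear])
    finally show ?thesis .
  qed
  ultimately have "splits_off M N K G U V K' U'"
    using V_op V(2) K'_def unfolding splits_off_def by blast
  then show ?thesis
    using that by blast
qed

section \<open>Transfer functions and the Schur algorithm\<close>

text \<open>Surjectivity is the fixed-point theorem for \<open>y \<mapsto> b - S y\<close>.\<close>

lemma bij_id_plus:
  fixes S :: "'a::complex_hilbert \<Rightarrow> 'a"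
  assumes S: "bounded_clinear S" and r: "0 \<le> r" "r < 1" and le: "\<And>x. norm (S x) \<le> r * norm x"
  shows "bij (\<lambda>y. y + S y)"
    and "norm (x - y) * (1 - r) \<le> norm ((x + S x) - (y + S y))"
proof -
  have lower: "norm (x - y) * (1 - r) \<le> norm ((x + S x) - (y + S y))" for x y
  proof -
    have "norm (x - y) \<le> norm ((x + S x) - (y + S y)) + norm (S (x - y))"
      using norm_triangle_ineq4 [of "(x + S x) - (y + S y)" "S (x - y)"]
      by (simp add: bounded_clinear_simps [OF S])
    then show ?thesis
      using le [of "x - y"] by (simp add: algebra_simps)
  qed
  then show "norm (x - y) * (1 - r) \<le> norm ((x + S x) - (y + S y))" .
  show "bij (\<lambda>y. y + S y)"
  proof (rule bijI)
    show "inj (\<lambda>y. y + S y)"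
    proof (rule injI)
      fix x y assume "x + S x = y + S y"
      then have "norm (x - y) * (1 - r) \<le> 0"
        using lower [of x y] by simp
      then show "x = y"
        using r by (simp add: mult_le_0_iff)
    qed
    have "\<exists>y. b = y + S y" for b
    proof -
      have "dist (b - S x) (b - S y) \<le> r * dist x y" for x y
        using le [of "y - x"] by (simp add: dist_norm bounded_clinear_simps [OF S] norm_minus_commute)
      then obtain y where "b - S y = y"
        using banach_fix_type [OF r, of "\<lambda>y. b - S y"] by blast
      then show ?thesis
        by (metis diff_add_cancel)
    qed
    then show "surj (\<lambda>y. y + S y)"
      unfolding surj_def by blast
  qed
qed

lemma schur_class_tendsto:
  fixes \<Theta> :: "complex \<Rightarrow> 'a::complex_hilbert \<Rightarrow> 'b::complex_hilbert"
  assumes "\<Theta> \<in> schur_class X Y"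
  shows "((\<lambda>w. \<Theta> w x) \<longlongrightarrow> \<Theta> 0 x) (at 0)"
proof -
  have op: "bounded_clinear (\<Theta> z)" if "z \<in> ball 0 1" for z
    using assms that by (auto simp: schur_class_def operators_def)
  obtain B where B: "bounded_clinear B"
    and lim: "((\<lambda>w. onorm (\<lambda>x. (1 / (w - 0)) *\<^sub>C (\<Theta> w x - \<Theta> 0 x) - B x)) \<longlongrightarrow> 0) (at 0 within ball 0 1)"
  proof -
    have "\<forall>z\<in>ball 0 1. \<exists>B. bounded_clinear B \<and>
        ((\<lambda>w. onorm (\<lambda>x. (1 / (w - z)) *\<^sub>C (\<Theta> w x - \<Theta> z x) - B x)) \<longlongrightarrow> 0) (at z within ball 0 1)"
      using assms unfolding schur_class_def operator_holomorphic_on_def mem_Collect_eq by (rule conjunct1)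
    then have "\<exists>B. bounded_clinear B \<and>
        ((\<lambda>w. onorm (\<lambda>x. (1 / (w - 0)) *\<^sub>C (\<Theta> w x - \<Theta> 0 x) - B x)) \<longlongrightarrow> 0) (at 0 within ball 0 1)"
      by (rule bspec) simp
    then show ?thesis
      by (elim exE conjE) (rule that)
  qed
  have at: "at 0 within ball 0 1 = at (0::complex)"
    by (rule at_within_open) auto
  have ev: "\<forall>\<^sub>F w in at 0. w \<in> ball 0 1 - {0::complex}"
    by (rule eventually_at_in_open) auto
  define Q where "Q w = (1 / (w - 0)) *\<^sub>C (\<Theta> w x - \<Theta> 0 x) - B x" for w
  have "(Q \<longlongrightarrow> 0) (at 0)"
  proof (rule Lim_null_comparison)
    show "((\<lambda>w. onorm (\<lambda>x. (1 / (w - 0)) *\<^sub>C (\<Theta> w x - \<Theta> 0 x) - B x) * norm x) \<longlongrightarrow> 0) (at 0)"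
      using tendsto_mult_left_zero [OF lim [unfolded at], of "norm x"] by simp
    show "\<forall>\<^sub>F w in at 0. norm (Q w) \<le> onorm (\<lambda>x. (1 / (w - 0)) *\<^sub>C (\<Theta> w x - \<Theta> 0 x) - B x) * norm x"
      using ev
    proof eventually_elim
      case (elim w)
      have "bounded_clinear (\<lambda>x. (1 / (w - 0)) *\<^sub>C (\<Theta> w x - \<Theta> 0 x) - B x)"
        using elim by (intro bounded_clinear_sub bounded_clinear_mult_scaleC op B) auto
      then show ?case
        unfolding Q_def by (intro onorm bounded_clinear_imp_bounded_linear)
    qed
  qed
  then have "((\<lambda>w. w *\<^sub>C (Q w + B x) + \<Theta> 0 x) \<longlongrightarrow> 0 *\<^sub>C (0 + B x) + \<Theta> 0 x) (at 0)"
    by (intro tendsto_intros)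
  then have "((\<lambda>w. w *\<^sub>C (Q w + B x) + \<Theta> 0 x) \<longlongrightarrow> \<Theta> 0 x) (at 0)"
    by simp
  moreover have "\<forall>\<^sub>F w in at 0. w *\<^sub>C (Q w + B x) + \<Theta> 0 x = \<Theta> w x"
    using ev by eventually_elim (simp add: Q_def)
  ultimately show ?thesis
    by (simp add: tendsto_cong)
qed

text \<open>
  \<open>\<Theta>\<close> is the transfer function of the colligation \<open>U\<close> with state space \<open>K\<close>: if
  \<open>U = [A B; C D]\<close>, then \<open>k = C m + z D k\<close> and hence \<open>\<Theta> z = A + z B (I - z D)\<^sup>-\<^sup>1 C\<close>. No inverse
  appears in the implicit form, which is stable under inverting \<open>U\<close> and under splitting it.
\<close>

definition realizes ::
    "'m::complex_hilbert set \<Rightarrow> 'k::complex_hilbert set \<Rightarrow> ('m \<times> 'k \<Rightarrow> 'n::complex_hilbert \<times> 'k) \<Rightarrow>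
     (complex \<Rightarrow> 'm \<Rightarrow> 'n) \<Rightarrow> bool" where
  "realizes M K U \<Theta> \<longleftrightarrow> (\<forall>z\<in>ball 0 1. \<forall>m\<in>M. \<exists>k\<in>K. U (m, z *\<^sub>C k) = (\<Theta> z m, k))"

lemma realizes_bound:
  assumes U: "unitary_op (M \<times> K) (N \<times> K) U" and K: "closed_csubspace K" and z: "norm z < 1"
    and m: "m \<in> M" "k \<in> K" "U (m, z *\<^sub>C k) = (n, k)"
  shows "norm k * (1 - norm z) \<le> norm m"
proof -
  have "(m, z *\<^sub>C k) \<in> M \<times> K"
    using m csubspace_scaleC [OF K] by simp
  then have "norm (n, k) = norm (m, z *\<^sub>C k)"
    using unitary_op_norm [OF U, of "(m, z *\<^sub>C k)"] m(3) by simp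
  also have "\<dots> \<le> norm m + norm z * norm k"
    using norm_Pair_le [of m "z *\<^sub>C k"] by simp
  finally show ?thesis
    using norm_snd_le [of k n] by (simp add: algebra_simps)
qed

text \<open>
  The pairs \<open>(m, n)\<close> that are related by the colligation at a point \<open>z \<noteq> 0\<close> form a closed set, because
  the state \<open>k\<close> is bounded by \<open>m\<close>; so it suffices to find them for a dense set of \<open>m\<close>. The same bound
  gives the value at 0 as a limit.
\<close>

lemma realizes_if_dense:
  fixes U :: "'m::complex_hilbert \<times> 'k::complex_hilbert \<Rightarrow> 'n::complex_hilbert \<times> 'k"
  assumes U: "unitary_op (M \<times> K) (N \<times> K) U" and M: "closed_csubspace M" and K: "closed_csubspace K"
    and \<Theta>: "\<Theta> \<in> schur_class M N"
    and dense: "\<And>z m. z \<noteq> 0 \<Longrightarrow> norm z < 1 \<Longrightarrow> m \<in> M \<Longrightarrow>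
      \<exists>u. u \<longlonglongrightarrow> m \<and> (\<forall>i. u i \<in> M \<and> (\<exists>k\<in>K. U (u i, z *\<^sub>C k) = (\<Theta> z (u i), k)))"
  shows "realizes M K U \<Theta>"
proof -
  note U_cl = unitary_op_clinear [OF U]
  have \<Theta>_cl: "bounded_clinear (\<Theta> z)" if "norm z < 1" for z
    using \<Theta> that by (auto simp: schur_class_def contraction_def)
  have nonzero: "\<exists>k\<in>K. U (m, z *\<^sub>C k) = (\<Theta> z m, k)" if z: "z \<noteq> 0" "norm z < 1" and m: "m \<in> M" for z m
  proof -
    obtain u where u: "u \<longlonglongrightarrow> m" "\<And>i. u i \<in> M" "\<And>i. \<exists>k\<in>K. U (u i, z *\<^sub>C k) = (\<Theta> z (u i), k)"
      using dense [OF z m] by blast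
    then obtain k where k: "\<And>i. k i \<in> K" "\<And>i. U (u i, z *\<^sub>C k i) = (\<Theta> z (u i), k i)"
      by metis
    have diff: "norm (k i - k j) * (1 - norm z) \<le> norm (u i - u j)" for i j
    proof (rule realizes_bound [OF U K z(2), where n = "\<Theta> z (u i) - \<Theta> z (u j)"])
      have "U ((u i, z *\<^sub>C k i) - (u j, z *\<^sub>C k j)) = U (u i, z *\<^sub>C k i) - U (u j, z *\<^sub>C k j)"
        by (rule bounded_clinear_diff [OF U_cl])
      then show "U (u i - u j, z *\<^sub>C (k i - k j)) = (\<Theta> z (u i) - \<Theta> z (u j), k i - k j)"
        by (simp add: k(2) scaleC_diff_right)
    qed (use u k csubspace_diff [OF M] csubspace_diff [OF K] in auto)
    have "Cauchy k"
    proof (rule CauchyI)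
      fix e :: real assume "e > 0"
      then have "e * (1 - norm z) > 0"
        using z by simp
      then obtain I where I: "\<forall>i\<ge>I. \<forall>j\<ge>I. norm (u i - u j) < e * (1 - norm z)"
        using CauchyD [OF LIMSEQ_imp_Cauchy [OF u(1)]] by blast
      have "norm (k i - k j) < e" if "i \<ge> I" "j \<ge> I" for i j
      proof -
        have "norm (k i - k j) * (1 - norm z) < e * (1 - norm z)"
          using diff [of i j] I that by (meson le_less_trans)
        then show ?thesis
          using z by simp
      qed
      then show "\<exists>I. \<forall>i\<ge>I. \<forall>j\<ge>I. norm (k i - k j) < e"
        by blast
    qed
    then obtain k0 where k0: "k \<longlonglongrightarrow> k0"
      using Cauchy_convergent convergent_def by blast
    have "k0 \<in> K"
      using K k(1) k0 unfolding closed_csubspace_def closed_sequential_limits by blast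
    have "(\<lambda>i. U (u i, z *\<^sub>C k i)) \<longlonglongrightarrow> U (m, z *\<^sub>C k0)"
      by (intro bounded_clinear_tendsto [OF U_cl] tendsto_intros u k0)
    moreover have "(\<lambda>i. U (u i, z *\<^sub>C k i)) \<longlonglongrightarrow> (\<Theta> z m, k0)"
      unfolding k(2) by (intro tendsto_intros k0 bounded_clinear_tendsto [OF \<Theta>_cl] z u)
    ultimately have "U (m, z *\<^sub>C k0) = (\<Theta> z m, k0)"
      using LIMSEQ_unique by blast
    with \<open>k0 \<in> K\<close> show ?thesis
      by blast
  qed
  have zero: "fst (U (m, 0)) = \<Theta> 0 m" if m: "m \<in> M" for m
  proof -
    \<comment> \<open>The shift by 2 keeps \<open>z i\<close> in the disc of radius \<open>1 / 2\<close>, where the states are bounded by \<open>2 * norm m\<close>.\<close>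
    define z :: "nat \<Rightarrow> complex" where "z i = of_real (1 / real (Suc (Suc i)))" for i
    have z: "z i \<noteq> 0" "norm (z i) \<le> 1 / 2" "norm (z i) < 1" for i
    proof -
      have "norm (z i) = 1 / real (Suc (Suc i))"
        unfolding z_def norm_of_real by simp
      moreover from this have "norm (z i) > 0"
        by simp
      ultimately show "norm (z i) \<le> 1 / 2" "norm (z i) < 1" "z i \<noteq> 0"
        by auto
    qed
    have "(\<lambda>i. 1 / real (Suc (Suc i))) \<longlonglongrightarrow> 0"
      by (intro LIMSEQ_Suc lim_1_over_n)
    then have "z \<longlonglongrightarrow> of_real 0"
      unfolding z_def [abs_def] by (rule tendsto_of_real)
    then have z_lim: "z \<longlonglongrightarrow> 0"
      by (simp only: of_real_0)
    obtain k where k: "\<And>i. k i \<in> K" "\<And>i. U (m, z i *\<^sub>C k i) = (\<Theta> (z i) m, k i)"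
      using nonzero [OF z(1) z(3) m] by metis
    have k_le: "norm (k i) \<le> 2 * norm m" for i
    proof -
      have "norm (k i) * (1 / 2) \<le> norm (k i) * (1 - norm (z i))"
        using z(2) [of i] by (intro mult_left_mono) auto
      also have "\<dots> \<le> norm m"
        by (rule realizes_bound [OF U K z(3) m k])
      finally show ?thesis
        by simp
    qed
    have "(\<lambda>i. z i *\<^sub>C k i) \<longlonglongrightarrow> 0"
    proof (rule Lim_null_comparison)
      show "\<forall>\<^sub>F i in sequentially. norm (z i *\<^sub>C k i) \<le> norm (z i) * (2 * norm m)"
        using k_le by (intro always_eventually) (simp add: mult_left_mono)
      show "(\<lambda>i. norm (z i) * (2 * norm m)) \<longlonglongrightarrow> 0"
        by (rule tendsto_mult_left_zero [OF tendsto_norm_zero [OF z_lim]])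
    qed
    then have "(\<lambda>i. fst (U (m, z i *\<^sub>C k i))) \<longlonglongrightarrow> fst (U (m, 0))"
      by (intro tendsto_fst bounded_clinear_tendsto [OF U_cl] tendsto_Pair tendsto_const)
    moreover have "(\<lambda>i. \<Theta> (z i) m) \<longlonglongrightarrow> \<Theta> 0 m"
    proof (rule filterlim_compose [OF schur_class_tendsto [OF \<Theta>]])
      show "filterlim z (at 0) sequentially"
        using z_lim z(1) by (simp add: filterlim_at)
    qed
    ultimately show ?thesis
      unfolding k(2) using LIMSEQ_unique by force
  qed
  show ?thesis
    unfolding realizes_def
  proof (intro ballI)
    fix z :: complex and m assume z: "z \<in> ball 0 1" and m: "m \<in> M"
    show "\<exists>k\<in>K. U (m, z *\<^sub>C k) = (\<Theta> z m, k)"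
    proof (cases "z = 0")
      case True
      have "(m, 0) \<in> M \<times> K"
        using m csubspace_zero [OF K] by simp
      have "snd (U (m, 0)) \<in> K"
        using unitary_op_in [OF U, of "(m, 0)"] by (auto simp: mem_Times_iff)
      then show ?thesis
        using zero [OF m] True by (intro bexI [of _ "snd (U (m, 0))"]) (simp_all add: prod_eq_iff)
    next
      case False
      then show ?thesis
        using nonzero z m by simp
    qed
  qed
qed

text \<open>
  The Schur iterate \<open>\<Theta>'\<close> is determined by \<open>\<Theta>\<close>: at \<open>z \<noteq> 0\<close> the rotation of \<open>\<Gamma>\<close> determines \<open>\<Theta>' z y\<close> from
  \<open>m\<close> and \<open>\<Theta> z m\<close>, since \<open>D\<^sub>\<Gamma>\<^sub>*\<close> is injective on its defect space, and the \<open>y\<close> that occur are dense.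
\<close>

lemma schur_step_realizes:
  fixes \<Gamma> :: "'m::complex_hilbert \<Rightarrow> 'n::complex_hilbert" and U :: "'m \<times> 'k::complex_hilbert \<Rightarrow> 'n \<times> 'k"
  assumes "contraction_between M N \<Gamma>" and K: "closed_csubspace K"
    and U: "unitary_op (defect_space M \<Gamma> \<times> K) (defect_space N (adj \<Gamma>) \<times> K) U"
    and \<Theta>': "\<Theta>' \<in> schur_class (defect_space M \<Gamma>) (defect_space N (adj \<Gamma>))"
    and step: "\<And>z m. z \<in> ball 0 1 \<Longrightarrow> \<Theta> z m = \<Gamma> m + z *\<^sub>C defect_op N (adj \<Gamma>)
      (\<Theta>' z (inv (\<lambda>y. y + z *\<^sub>C adj \<Gamma> (\<Theta>' z y)) (defect_op M \<Gamma> m)))"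
    and rel: "\<And>z m. z \<noteq> 0 \<Longrightarrow> norm z < 1 \<Longrightarrow> m \<in> M \<Longrightarrow> \<exists>n\<in>defect_space N (adj \<Gamma>). \<exists>k\<in>K.
      \<Theta> z m = \<Gamma> m + z *\<^sub>C defect_op N (adj \<Gamma>) n \<and>
      U (defect_op M \<Gamma> m - z *\<^sub>C adj \<Gamma> n, z *\<^sub>C k) = (n, k)"
  shows "realizes (defect_space M \<Gamma>) K U \<Theta>'"
proof -
  interpret g: contraction_between M N \<Gamma>
    by fact
  interpret ad: contraction_between N M "adj \<Gamma>"
    by (rule g.adjoint)
  let ?M' = "defect_space M \<Gamma>" and ?N' = "defect_space N (adj \<Gamma>)"
  let ?D = "defect_op M \<Gamma>" and ?D\<^sub>s = "defect_op N (adj \<Gamma>)"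
  show ?thesis
  proof (rule realizes_if_dense [OF U g.closed_defect_space K \<Theta>'])
    fix z :: complex and y assume z: "z \<noteq> 0" "norm z < 1" and y: "y \<in> ?M'"
    have \<Theta>'_op: "\<Theta>' z \<in> operators ?M' ?N'" and \<Theta>'_contr: "contraction (\<Theta>' z)"
      using \<Theta>' z by (auto simp: schur_class_def)
    define S where "S y = z *\<^sub>C adj \<Gamma> (\<Theta>' z y)" for y
    have S_cl: "bounded_clinear S"
      unfolding S_def
      by (intro bounded_clinear_mult_scaleC
          bounded_clinear_compose [OF ad.G_clinear operators_bounded_clinear [OF \<Theta>'_op]])
    have S_le: "norm (S y) \<le> norm z * norm y" for y
      using contraction_norm [OF ad.contr, of "\<Theta>' z y"] contraction_norm [OF \<Theta>'_contr, of y]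
      by (auto simp: S_def intro!: mult_left_mono)
    note L = bij_id_plus [OF S_cl norm_ge_zero z(2) S_le]
    have S_in: "S y \<in> ?M'" for y
      using ad.maps_defect_space [OF operators_in [OF \<Theta>'_op], of y]
      by (simp add: S_def csubspace_scaleC [OF g.closed_defect_space])
    define Y where "Y m = inv (\<lambda>y. y + S y) (?D m)" for m
    have LY: "Y m + S (Y m) = ?D m" for m
      using surj_f_inv_f [OF bij_is_surj [OF L(1)], of "?D m"] by (simp add: Y_def)
    have Y_in: "Y m \<in> ?M'" for m
    proof -
      have "Y m = ?D m - S (Y m)"
        using LY [of m] by (metis add_diff_cancel_right')
      then show ?thesis
        using csubspace_diff [OF g.closed_defect_space g.defect_in_space S_in] by metis
    qed
    have Y_proj: "Y m = Y (ortho_proj M m)" for m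
      by (simp add: Y_def g.defect_ortho_proj)
    have Y_rel: "\<exists>k\<in>K. U (Y m, z *\<^sub>C k) = (\<Theta>' z (Y m), k)" if m: "m \<in> M" for m
    proof -
      obtain n k where nk: "n \<in> ?N'" "k \<in> K" "\<Theta> z m = \<Gamma> m + z *\<^sub>C ?D\<^sub>s n"
          "U (?D m - z *\<^sub>C adj \<Gamma> n, z *\<^sub>C k) = (n, k)"
        using rel [OF z m] by blast
      have "\<Theta> z m = \<Gamma> m + z *\<^sub>C ?D\<^sub>s (\<Theta>' z (Y m))"
        using step [of z m] z by (simp add: Y_def S_def)
      with nk(3) have "z *\<^sub>C (?D\<^sub>s n - ?D\<^sub>s (\<Theta>' z (Y m))) = 0"
        by (simp add: scaleC_diff_right)
      then have "(1 / z) *\<^sub>C z *\<^sub>C (?D\<^sub>s n - ?D\<^sub>s (\<Theta>' z (Y m))) = 0"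
        by (simp only: scaleC_zero_right)
      then have "?D\<^sub>s (n - \<Theta>' z (Y m)) = 0"
        using z by (simp add: bounded_clinear_simps [OF ad.defect_clinear])
      with csubspace_diff [OF ad.closed_defect_space nk(1) operators_in [OF \<Theta>'_op]]
      have "n - \<Theta>' z (Y m) = 0"
        by (rule ad.defect_inj)
      then have n: "n = \<Theta>' z (Y m)"
        by simp
      then have "?D m - z *\<^sub>C adj \<Gamma> n = Y m"
        using LY [of m] by (simp add: S_def algebra_simps)
      with nk n show ?thesis
        by auto
    qed
    have "y + S y \<in> ?M'"
      by (rule csubspace_add [OF g.closed_defect_space y S_in])
    then obtain u where u: "(\<lambda>i. ?D (u i)) \<longlonglongrightarrow> y + S y"
      using g.defect_space_approx by blast
    have "(\<lambda>i. Y (u i)) \<longlonglongrightarrow> y"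
    proof (rule LIM_zero_cancel, rule Lim_null_comparison)
      show "\<forall>\<^sub>F i in sequentially. norm (Y (u i) - y) \<le> norm (?D (u i) - (y + S y)) / (1 - norm z)"
      proof (intro always_eventually allI)
        fix i
        show "norm (Y (u i) - y) \<le> norm (?D (u i) - (y + S y)) / (1 - norm z)"
          using L(2) [of "Y (u i)" y] z by (simp add: LY pos_le_divide_eq)
      qed
      show "(\<lambda>i. norm (?D (u i) - (y + S y)) / (1 - norm z)) \<longlonglongrightarrow> 0"
        using tendsto_divide_zero [OF tendsto_norm_zero [OF LIM_zero [OF u]]] .
    qed
    moreover have "Y (u i) \<in> ?M' \<and> (\<exists>k\<in>K. U (Y (u i), z *\<^sub>C k) = (\<Theta>' z (Y (u i)), k))" for i
      using Y_in [of "u i"] Y_rel [of "ortho_proj M (u i)"] by (simp add: Y_proj [of "u i"] g.X)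
    ultimately show "\<exists>u. u \<longlonglongrightarrow> y \<and> (\<forall>i. u i \<in> ?M' \<and> (\<exists>k\<in>K. U (u i, z *\<^sub>C k) = (\<Theta>' z (u i), k)))"
      by (intro exI [of _ "\<lambda>i. Y (u i)"]) blast
  qed
qed

lemma splits_off_embedding:
  assumes "contraction_between M N G" "closed_csubspace K" "splits_off M N K G U V K' U'"
  shows "isometric_embedding (defect_space M G) K V K'"
  using assms contraction_between.closed_defect_space [OF assms(1)]
  by unfold_locales (auto simp: splits_off_def)

lemma splits_off_unitary:
  "splits_off M N K G U V K' U' \<Longrightarrow>
    unitary_op (defect_space N (adj G) \<times> K') (defect_space M G \<times> K') U'"
  unfolding splits_off_def by blast

text \<open>
  The splitting as a relation between vectors. As \<open>U'\<close> inverts what remains of \<open>U\<close>, the remainder of the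
  output state \<open>l\<close> is an input of \<open>U'\<close>, and the remainder of the input state \<open>k\<close> an output.
\<close>

lemma splits_off_step:
  assumes "contraction_between M N G" "closed_csubspace K" "splits_off M N K G U V K' U'"
    and m: "m \<in> M" and k: "k \<in> K" and eq: "U (m, k) = (n, l)"
  obtains n' where "n' \<in> defect_space N (adj G)"
    "elementary_rotation M N G (m, n') = (n, adj V l)"
    "U' (n', l - V (adj V l)) = (adj V k, k - V (adj V k))"
proof -
  interpret g: contraction_between M N G
    by fact
  interpret ad: contraction_between N M "adj G"
    by (rule g.adjoint)
  interpret v: isometric_embedding "defect_space M G" K V K'
    by (rule splits_off_embedding [OF assms(1-3)])
  note U' = splits_off_unitary [OF assms(3)]
  let ?r = "(adj V k, k - V (adj V k))"
  have r: "?r \<in> defect_space M G \<times> K'"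
    using k by (simp add: v.adj_V_in v.remainder_in)
  define n' k' where "n' = fst (adj U' ?r)" and "k' = snd (adj U' ?r)"
  have n': "n' \<in> defect_space N (adj G)" "k' \<in> K'"
    using unitary_op_in [OF unitary_op_adj [OF U'], of ?r]
    by (auto simp: n'_def k'_def mem_Times_iff)
  have U'_eq: "U' (n', k') = ?r"
    using unitary_op_inverse' [OF U' r] by (simp add: n'_def k'_def)
  have "U (m, V (fst (U' (n', k'))) + snd (U' (n', k'))) =
      (G m + defect_op N (adj G) n', V (defect_op M G m - adj G n') + k')"
    using assms(3) m n' by (simp add: splits_off_def)
  then have *: "n = G m + defect_op N (adj G) n'" "l = V (defect_op M G m - adj G n') + k'"
    by (simp_all add: U'_eq eq)
  have "defect_op M G m - adj G n' \<in> defect_space M G"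
    using g.elementary_rotation_in [OF m n'(1)] by (simp add: elementary_rotation_def)
  then have "adj V l = defect_op M G m - adj G n'"
    unfolding *(2) using n'(2) by (rule v.adj_V_sum)
  moreover from this have "l - V (adj V l) = k'"
    by (simp add: *(2))
  ultimately show ?thesis
    using that [OF n'(1)] U'_eq *(1) by (simp add: elementary_rotation_def)
qed

text \<open>
  A splitting exchanges the directions: if \<open>U\<close> has the transfer function \<open>\<Theta>\<close>, then the inverse of \<open>U'\<close> has
  its Schur iterate; if the inverse of \<open>U\<close> has the transfer function \<open>\<Theta>\<close>, then \<open>U'\<close> has its iterate. Both
  follow by substituting \<open>z k\<close> for one of the states in the relation between vectors; in the second
  case the rotation is read backwards.
\<close>

lemma realizes_splits_off:
  fixes U :: "'m::complex_hilbert \<times> 'k::complex_hilbert \<Rightarrow> 'n::complex_hilbert \<times> 'k"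
  assumes g: "contraction_between M N \<Gamma>" and K: "closed_csubspace K"
    and split: "splits_off M N K \<Gamma> U V K' U'" and real: "realizes M K U \<Theta>"
    and \<Theta>': "\<Theta>' \<in> schur_class (defect_space M \<Gamma>) (defect_space N (adj \<Gamma>))"
    and step: "\<And>z m. z \<in> ball 0 1 \<Longrightarrow> \<Theta> z m = \<Gamma> m + z *\<^sub>C defect_op N (adj \<Gamma>)
      (\<Theta>' z (inv (\<lambda>y. y + z *\<^sub>C adj \<Gamma> (\<Theta>' z y)) (defect_op M \<Gamma> m)))"
  shows "realizes (defect_space M \<Gamma>) K' (adj U') \<Theta>'"
proof -
  interpret g: contraction_between M N \<Gamma>
    by fact
  interpret ad: contraction_between N M "adj \<Gamma>"
    by (rule g.adjoint)
  interpret v: isometric_embedding "defect_space M \<Gamma>" K V K'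
    by (rule splits_off_embedding [OF g K split])
  note U' = splits_off_unitary [OF split]
  show ?thesis
  proof (rule schur_step_realizes [OF g v.K' unitary_op_adj [OF U'] \<Theta>' step])
    fix z :: complex and m assume z: "z \<noteq> 0" "norm z < 1" and m: "m \<in> M"
    obtain k where k: "k \<in> K" "U (m, z *\<^sub>C k) = (\<Theta> z m, k)"
      using real z m unfolding realizes_def by force
    obtain n where n: "n \<in> defect_space N (adj \<Gamma>)"
        "elementary_rotation M N \<Gamma> (m, n) = (\<Theta> z m, adj V k)"
        "U' (n, k - V (adj V k)) = (adj V (z *\<^sub>C k), z *\<^sub>C k - V (adj V (z *\<^sub>C k)))"
      using splits_off_step [OF g K split m csubspace_scaleC [OF K k(1)] k(2)] .
    let ?k = "k - V (adj V k)" and ?n = "(1 / z) *\<^sub>C n"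
    have k': "?k \<in> K'"
      by (rule v.remainder_in [OF k(1)])
    have "U' (n, ?k) = z *\<^sub>C (adj V k, ?k)"
      using n(3) by (simp add: bounded_clinear_simps [OF v.adj_V_clinear]
          bounded_clinear_simps [OF v.V_clinear] scaleC_diff_right)
    then have "(1 / z) *\<^sub>C U' (n, ?k) = (adj V k, ?k)"
      using scaleC_inverse [OF z(1), of "(adj V k, ?k)"] by (simp only:)
    then have "U' (?n, (1 / z) *\<^sub>C ?k) = (adj V k, ?k)"
      using bounded_clinear_scaleC [OF unitary_op_clinear [OF U'], of "1 / z" "(n, ?k)"]
      by (simp only: scaleC_Pair)
    moreover have "(?n, (1 / z) *\<^sub>C ?k) \<in> defect_space N (adj \<Gamma>) \<times> K'"
      using n(1) k' csubspace_scaleC [OF ad.closed_defect_space] csubspace_scaleC [OF v.K'] by simp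
    ultimately have "adj U' (adj V k, ?k) = (?n, (1 / z) *\<^sub>C ?k)"
      using unitary_op_inverse [OF U'] by metis
    moreover have "\<Theta> z m = \<Gamma> m + z *\<^sub>C defect_op N (adj \<Gamma>) ?n"
        "adj V k = defect_op M \<Gamma> m - z *\<^sub>C adj \<Gamma> ?n"
      using n(2) z by (simp_all add: elementary_rotation_def bounded_clinear_simps [OF ad.defect_clinear]
          bounded_clinear_simps [OF ad.G_clinear])
    ultimately show "\<exists>n\<in>defect_space N (adj \<Gamma>). \<exists>k\<in>K'.
        \<Theta> z m = \<Gamma> m + z *\<^sub>C defect_op N (adj \<Gamma>) n \<and>
        adj U' (defect_op M \<Gamma> m - z *\<^sub>C adj \<Gamma> n, z *\<^sub>C k) = (n, k)"
      using z n(1) k' csubspace_scaleC [OF ad.closed_defect_space] csubspace_scaleC [OF v.K']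
      by (intro bexI [of _ ?n] bexI [of _ "(1 / z) *\<^sub>C ?k"]) simp_all
  qed
qed

lemma realizes_adj_splits_off:
  fixes U :: "'m::complex_hilbert \<times> 'k::complex_hilbert \<Rightarrow> 'n::complex_hilbert \<times> 'k"
  assumes g: "contraction_between N M \<Gamma>" and K: "closed_csubspace K"
    and U: "unitary_op (M \<times> K) (N \<times> K) U"
    and split: "splits_off M N K (adj \<Gamma>) U V K' U'" and real: "realizes N K (adj U) \<Theta>"
    and \<Theta>: "\<Theta> \<in> schur_class N M"
    and \<Theta>': "\<Theta>' \<in> schur_class (defect_space N \<Gamma>) (defect_space M (adj \<Gamma>))"
    and step: "\<And>z m. z \<in> ball 0 1 \<Longrightarrow> \<Theta> z m = \<Gamma> m + z *\<^sub>C defect_op M (adj \<Gamma>)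
      (\<Theta>' z (inv (\<lambda>y. y + z *\<^sub>C adj \<Gamma> (\<Theta>' z y)) (defect_op N \<Gamma> m)))"
  shows "realizes (defect_space N \<Gamma>) K' U' \<Theta>'"
proof -
  interpret g: contraction_between N M \<Gamma>
    by fact
  interpret ad: contraction_between M N "adj \<Gamma>"
    by (rule g.adjoint)
  note ad = ad.contraction_between_axioms
  interpret v: isometric_embedding "defect_space M (adj \<Gamma>)" K V K'
    by (rule splits_off_embedding [OF ad K split])
  have U': "unitary_op (defect_space N \<Gamma> \<times> K') (defect_space M (adj \<Gamma>) \<times> K') U'"
    using splits_off_unitary [OF split] by simp
  show ?thesis
  proof (rule schur_step_realizes [OF g v.K' U' \<Theta>' step])
    fix z :: complex and x assume z: "z \<noteq> 0" "norm z < 1" and x: "x \<in> N"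
    obtain k where k: "k \<in> K" "adj U (x, z *\<^sub>C k) = (\<Theta> z x, k)"
      using real z x unfolding realizes_def by force
    have "\<Theta> z x \<in> M"
      by (rule operators_in [of "\<Theta> z" N]) (use \<Theta> z in \<open>simp add: schur_class_def\<close>)
    have "U (\<Theta> z x, k) = (x, z *\<^sub>C k)"
      using unitary_op_inverse' [OF U, of "(x, z *\<^sub>C k)"] k x csubspace_scaleC [OF K] by simp
    then obtain y where y: "y \<in> defect_space N (adj (adj \<Gamma>))"
        "elementary_rotation M N (adj \<Gamma>) (\<Theta> z x, y) = (x, adj V (z *\<^sub>C k))"
        "U' (y, z *\<^sub>C k - V (adj V (z *\<^sub>C k))) = (adj V k, k - V (adj V k))"
      using splits_off_step [OF ad K split \<open>\<Theta> z x \<in> M\<close> k(1)] by metis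
    let ?k = "k - V (adj V k)"
    have "elementary_rotation N M \<Gamma> (x, adj V (z *\<^sub>C k)) = (\<Theta> z x, y)"
      using ad.elementary_rotation_inverse [OF \<open>\<Theta> z x \<in> M\<close>, of y] y(1,2) g.defect_space_subset
      by auto
    then have "\<Theta> z x = \<Gamma> x + z *\<^sub>C defect_op M (adj \<Gamma>) (adj V k)"
        "defect_op N \<Gamma> x - z *\<^sub>C adj \<Gamma> (adj V k) = y"
      by (simp_all add: elementary_rotation_def bounded_clinear_simps [OF ad.defect_clinear]
          bounded_clinear_simps [OF ad.G_clinear] bounded_clinear_simps [OF v.adj_V_clinear])
    moreover have "U' (y, z *\<^sub>C ?k) = (adj V k, ?k)"
      using y(3) by (simp add: bounded_clinear_simps [OF v.adj_V_clinear]
          bounded_clinear_simps [OF v.V_clinear] scaleC_diff_right)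
    ultimately show "\<exists>n\<in>defect_space M (adj \<Gamma>). \<exists>k\<in>K'.
        \<Theta> z x = \<Gamma> x + z *\<^sub>C defect_op M (adj \<Gamma>) n \<and>
        U' (defect_op N \<Gamma> x - z *\<^sub>C adj \<Gamma> n, z *\<^sub>C k) = (n, k)"
      using v.adj_V_in v.remainder_in [OF k(1)]
      by (intro bexI [of _ "adj V k"] bexI [of _ ?k]) simp_all
  qed
qed

section \<open>Iterated splitting\<close>

text \<open>
  An infinite sequence of splittings. The operator \<open>U j\<close> maps \<open>p j \<oplus> K j\<close> to \<open>q j \<oplus> K j\<close> and has the corner
  \<open>a j\<close>; the isometry \<open>V j\<close> embeds the defect space \<open>q (Suc j)\<close> in \<open>K j\<close>.
\<close>

locale rotation_tower =
  fixes p q :: "nat \<Rightarrow> 'a::complex_hilbert set" and a :: "nat \<Rightarrow> 'a \<Rightarrow> 'a"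
    and K :: "nat \<Rightarrow> 'k::complex_hilbert set" and U :: "nat \<Rightarrow> 'a \<times> 'k \<Rightarrow> 'a \<times> 'k"
    and V :: "nat \<Rightarrow> 'a \<Rightarrow> 'k"
  assumes contraction: "contraction_between (p j) (q j) (a j)"
    and p_Suc: "p (Suc j) = defect_space (q j) (adj (a j))"
    and q_Suc: "q (Suc j) = defect_space (p j) (a j)"
    and K_closed: "closed_csubspace (K j)"
    and split: "splits_off (p j) (q j) (K j) (a j) (U j) (V j) (K (Suc j)) (U (Suc j))"
    and K_0: "K 0 = UNIV"
begin

lemma embedding: "isometric_embedding (q (Suc j)) (K j) (V j) (K (Suc j))"
  unfolding q_Suc by (rule splits_off_embedding [OF contraction K_closed split])

lemma p_closed: "closed_csubspace (p j)"
  by (rule contraction_between.X [OF contraction])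

lemma p_Suc_subset: "x \<in> p (Suc j) \<Longrightarrow> x \<in> q j"
  using contraction_between.defect_space_subset [OF contraction_between.adjoint [OF contraction]]
  by (auto simp: p_Suc)

lemma K_antimono: "i \<le> j \<Longrightarrow> K j \<subseteq> K i"
  by (rule lift_Suc_antimono_le [of K]) (use isometric_embedding.K'_subset [OF embedding] in auto)

primrec remainder :: "nat \<Rightarrow> 'k \<Rightarrow> 'k" where
  "remainder 0 h = h"
| "remainder (Suc j) h = remainder j h - V j (adj (V j) (remainder j h))"

definition coord :: "nat \<Rightarrow> 'k \<Rightarrow> 'a" where
  "coord j h = adj (V j) (remainder j h)"

lemma remainder_in: "remainder j h \<in> K j"
  by (induction j) (auto simp: K_0 isometric_embedding.remainder_in [OF embedding])

lemma remainder_clinear: "bounded_clinear (remainder j)"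
proof (induction j)
  case (Suc j)
  note v = isometric_embedding.V_clinear [OF embedding, of j]
    and v' = isometric_embedding.adj_V_clinear [OF embedding, of j]
  show ?case
    unfolding remainder.simps
    by (rule bounded_clinear_sub [OF Suc bounded_clinear_compose [OF v bounded_clinear_compose [OF v' Suc]]])
qed (simp add: bounded_clinear_id)

lemma coord_in: "coord j h \<in> q (Suc j)"
  by (simp add: coord_def isometric_embedding.adj_V_in [OF embedding])

lemma coord_clinear: "bounded_clinear (coord j)"
  unfolding coord_def [abs_def]
  by (rule bounded_clinear_compose [OF isometric_embedding.adj_V_clinear [OF embedding] remainder_clinear])

text \<open>
  The equation \<open>U\<^sub>0 (z\<^sub>0, h) = (w\<^sub>0, h')\<close> is passed on through the tower. Each splitting inverts the
  operator that remains, so that \<open>h\<close> and \<open>h'\<close> change places at every step.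
\<close>

lemma trace:
  assumes z0: "z0 \<in> p 0" and eq: "U 0 (z0, h) = (w0, h')"
  obtains z w where "z 0 = z0" "w 0 = w0" "\<And>j. z j \<in> p j"
    "\<And>j. elementary_rotation (p j) (q j) (a j) (z j, z (Suc j)) = (w j, coord j (if even j then h' else h))"
    "\<And>j. w (Suc j) = coord j (if even j then h else h')"
proof -
  define u where "u j = remainder j (if even j then h else h')" for j
  define v where "v j = remainder j (if even j then h' else h)" for j
  have u_Suc: "u (Suc j) = v j - V j (adj (V j) (v j))" and v_Suc: "v (Suc j) = u j - V j (adj (V j) (u j))" for j
    by (simp_all add: u_def v_def)
  define P where "P j x \<longleftrightarrow> fst x \<in> p j \<and> U j (fst x, u j) = (snd x, v j) \<and> (j = 0 \<longrightarrow> x = (z0, w0))"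
    for j and x :: "'a \<times> 'a"
  define Q where "Q j x y \<longleftrightarrow> snd y = adj (V j) (u j) \<and>
      elementary_rotation (p j) (q j) (a j) (fst x, fst y) = (snd x, adj (V j) (v j))"
    for j and x y :: "'a \<times> 'a"
  have "\<exists>f. \<forall>j. P j (f j) \<and> Q j (f j) (f (Suc j))"
  proof (rule dependent_nat_choice)
    show "\<exists>x. P 0 x"
      using z0 eq by (intro exI [of _ "(z0, w0)"]) (simp add: P_def u_def v_def)
    fix x j assume "P j x"
    then have x: "fst x \<in> p j" "U j (fst x, u j) = (snd x, v j)"
      by (auto simp: P_def)
    have "u j \<in> K j"
      by (simp add: u_def remainder_in)
    obtain n where n: "n \<in> defect_space (q j) (adj (a j))"
        "elementary_rotation (p j) (q j) (a j) (fst x, n) = (snd x, adj (V j) (v j))"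
        "U (Suc j) (n, v j - V j (adj (V j) (v j))) = (adj (V j) (u j), u j - V j (adj (V j) (u j)))"
      using splits_off_step [OF contraction K_closed split x(1) \<open>u j \<in> K j\<close> x(2)] .
    then show "\<exists>y. P (Suc j) y \<and> Q j x y"
      by (intro exI [of _ "(n, adj (V j) (u j))"]) (simp add: P_def Q_def u_Suc v_Suc p_Suc)
  qed
  then obtain f where f: "\<And>j. P j (f j)" "\<And>j. Q j (f j) (f (Suc j))"
    by blast
  have coords: "adj (V j) (u j) = coord j (if even j then h else h')"
    "adj (V j) (v j) = coord j (if even j then h' else h)" for j
    by (simp_all add: coord_def u_def v_def)
  show ?thesis
    by (rule that [of "\<lambda>j. fst (f j)" "\<lambda>j. snd (f j)"])
      (use f in \<open>auto simp: P_def Q_def coords\<close>)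
qed

lemma rotation_eq_0:
  assumes "x \<in> p j" "y \<in> p (Suc j)" "elementary_rotation (p j) (q j) (a j) (x, y) = (0, 0)"
  shows "x = 0 \<and> y = 0"
proof -
  note g = contraction [of j]
  have "(x, y) = elementary_rotation (q j) (p j) (adj (a j)) (0, 0)"
    using contraction_between.elementary_rotation_inverse [OF g assms(1) p_Suc_subset [OF assms(2)]]
      assms(3) by simp
  also have "\<dots> = 0"
    using contraction_between.elementary_rotation_clinear [OF contraction_between.adjoint [OF g]]
    by (simp add: bounded_clinear_zero flip: zero_prod_def)
  finally show ?thesis
    by (simp add: zero_prod_def)
qed

lemma rotation_0: "elementary_rotation (p j) (q j) (a j) (0, 0) = (0, 0)"
  using bounded_clinear_zero [OF contraction_between.elementary_rotation_clinear [OF contraction]]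
  by (simp add: zero_prod_def)

lemma in_all_state_spaces_iff: "(\<forall>j. h \<in> K j) \<longleftrightarrow> (\<forall>j. coord j h = 0)"
proof
  assume h: "\<forall>j. h \<in> K j"
  have 0: "adj (V j) h = 0" for j
    using h by (blast intro: isometric_embedding.adj_V_K' [OF embedding])
  have "remainder j h = h" for j
    by (induction j) (simp_all add: 0 bounded_clinear_zero [OF isometric_embedding.V_clinear [OF embedding]])
  then show "\<forall>j. coord j h = 0"
    by (simp add: coord_def 0)
next
  assume h: "\<forall>j. coord j h = 0"
  have "remainder j h = h" for j
  proof (induction j)
    case (Suc j)
    then have "adj (V j) h = 0"
      using h by (metis coord_def)
    then show ?case
      by (simp add: Suc bounded_clinear_zero [OF isometric_embedding.V_clinear [OF embedding]])
  qed simp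
  then show "\<forall>j. h \<in> K j"
    using remainder_in by metis
qed

text \<open>
  If a state lies in all \<open>K j\<close>, its coordinates vanish. The rotations then force the coordinates of its
  image, and of its preimage, to vanish, along with the components outside the state space.
\<close>

lemma residual_forward:
  assumes h: "\<And>j. h \<in> K j" and eq: "U 0 (0, h) = (w0, h')"
  shows "w0 = 0 \<and> (\<forall>j. h' \<in> K j)"
proof -
  have c: "coord j h = 0" for j
    using h in_all_state_spaces_iff by blast
  obtain z w where zw: "z 0 = 0" "w 0 = w0" "\<And>j. z j \<in> p j"
      "\<And>j. elementary_rotation (p j) (q j) (a j) (z j, z (Suc j)) = (w j, coord j (if even j then h' else h))"
      "\<And>j. w (Suc j) = coord j (if even j then h else h')"
    by (rule trace [OF csubspace_zero [OF p_closed] eq], rule that; assumption)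
  have z_odd: "z j = 0 \<and> z (Suc j) = 0" if "odd j" for j
  proof (rule rotation_eq_0 [OF zw(3) zw(3)])
    obtain i where "j = Suc i" "even i"
      using \<open>odd j\<close> by (cases j) auto
    then show "elementary_rotation (p j) (q j) (a j) (z j, z (Suc j)) = (0, 0)"
      using zw(4) [of j] zw(5) [of i] by (simp add: c)
  qed
  have z: "z j = 0" for j
    using zw(1) z_odd [of j] z_odd [of "j - 1"] by (cases j; cases "even j") auto
  have w: "w j = 0 \<and> coord j (if even j then h' else h) = 0" for j
    using zw(4) [of j] by (simp add: z rotation_0)
  have "coord j h' = 0" for j
    using w [of j] w [of "Suc j"] zw(5) [of j] by (cases "even j") auto
  then show ?thesis
    using w [of 0] zw(2) in_all_state_spaces_iff by auto
qed

lemma residual_backward: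
  assumes z0: "z0 \<in> p 0" and h': "\<And>j. h' \<in> K j" and eq: "U 0 (z0, h) = (0, h')"
  shows "z0 = 0 \<and> (\<forall>j. h \<in> K j)"
proof -
  have c: "coord j h' = 0" for j
    using h' in_all_state_spaces_iff by blast
  obtain z w where zw: "z 0 = z0" "w 0 = 0" "\<And>j. z j \<in> p j"
      "\<And>j. elementary_rotation (p j) (q j) (a j) (z j, z (Suc j)) = (w j, coord j (if even j then h' else h))"
      "\<And>j. w (Suc j) = coord j (if even j then h else h')"
    by (rule trace [OF z0 eq], rule that; assumption)
  have z_even: "z j = 0 \<and> z (Suc j) = 0" if "even j" for j
  proof (rule rotation_eq_0 [OF zw(3) zw(3)])
    have "w j = 0"
      using \<open>even j\<close> zw(2) zw(5) [of "j - 1"] c by (cases j) auto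
    then show "elementary_rotation (p j) (q j) (a j) (z j, z (Suc j)) = (0, 0)"
      using zw(4) [of j] \<open>even j\<close> by (simp add: c)
  qed
  have z: "z j = 0" for j
    using z_even [of j] z_even [of "j - 1"] by (cases j; cases "even j") auto
  have w: "w j = 0 \<and> coord j (if even j then h' else h) = 0" for j
    using zw(4) [of j] by (simp add: z rotation_0)
  have "coord j h = 0" for j
    using w [of j] w [of "Suc j"] zw(5) [of j] by (cases "even j") auto
  then show ?thesis
    using z [of 0] zw(1) in_all_state_spaces_iff by auto
qed

lemma cinner_remainder:
  "cinner (remainder j x) (remainder j y) =
    cinner (coord j x) (coord j y) + cinner (remainder (Suc j) x) (remainder (Suc j) y)"
proof -
  interpret v: isometric_embedding "q (Suc j)" "K j" "V j" "K (Suc j)"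
    by (rule embedding)
  have split: "remainder j h = V j (coord j h) + remainder (Suc j) h" for h
    by (simp add: coord_def)
  have "cinner (V j (coord j x)) (V j (coord j y)) = cinner (coord j x) (coord j y)"
    by (rule cinner_eq_of_norm_eq [OF v.V_clinear v.X v.isometric]) (auto simp: coord_in)
  then show ?thesis
    using v.orthogonal [OF remainder_in] cinner_eq_0_commute [OF v.orthogonal [OF remainder_in]]
    by (simp only: split cinner_simps) simp
qed

lemma cinner_partial_sum:
  "cinner x y = (\<Sum>j<n. cinner (coord j x) (coord j y)) + cinner (remainder n x) (remainder n y)"
proof (induction n)
  case (Suc n)
  then show ?case
    by (simp add: cinner_remainder [of n x y] del: remainder.simps(2))
qed simp

lemma V_orthogonal: "i \<noteq> j \<Longrightarrow> cinner (V i x) (V j y) = 0"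
proof (induction i j arbitrary: x y rule: linorder_wlog)
  case (le i j)
  then have "V j y \<in> K (Suc i)"
    using K_antimono [of "Suc i" j] isometric_embedding.V_in [OF embedding, of j y] by auto
  then show ?case
    by (rule isometric_embedding.orthogonal [OF embedding])
next
  case (sym i j)
  then show ?case
    using cinner_eq_0_commute by blast
qed

lemma norm_sum_V:
  assumes "\<And>j. f j \<in> q (Suc j)" "finite S"
  shows "(norm (\<Sum>j\<in>S. V j (f j)))\<^sup>2 = (\<Sum>j\<in>S. (norm (f j))\<^sup>2)"
  using assms(2)
proof (induction S rule: finite_induct)
  case (insert i S)
  have "cinner (V i (f i)) (\<Sum>j\<in>S. V j (f j)) = (\<Sum>j\<in>S. cinner (V i (f i)) (V j (f j)))"
    using bounded_linear.linear [OF bounded_bilinear.bounded_linear_right [OF bounded_bilinear_cinner]]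
    by (rule linear_sum)
  also have "\<dots> = 0"
    using insert by (intro sum.neutral) (auto intro!: V_orthogonal)
  finally show ?case
    using insert isometric_embedding.isometric [OF embedding assms(1)]
    by (simp add: norm_add_square_orthogonal)
qed simp

lemma summable_V:
  assumes f: "\<And>j. f j \<in> q (Suc j)" and sum: "summable (\<lambda>j. (norm (f j))\<^sup>2)"
  shows "summable (\<lambda>j. V j (f j))"
  unfolding summable_Cauchy
proof (intro allI impI)
  fix e :: real assume "e > 0"
  then obtain N where N: "\<And>m n. m \<ge> N \<Longrightarrow> norm (\<Sum>j=m..<n. (norm (f j))\<^sup>2) < e\<^sup>2"
    using sum unfolding summable_Cauchy by (metis zero_less_power)
  have "norm (\<Sum>j=m..<n. V j (f j)) < e" if "m \<ge> N" for m n
  proof -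
    have "(norm (\<Sum>j=m..<n. V j (f j)))\<^sup>2 < e\<^sup>2"
      using N [OF that, of n] by (simp add: norm_sum_V [OF f] abs_less_iff)
    then show ?thesis
      using \<open>e > 0\<close> by (simp add: power2_less_imp_less)
  qed
  then show "\<exists>N. \<forall>m\<ge>N. \<forall>n. norm (\<Sum>j=m..<n. V j (f j)) < e"
    by blast
qed

lemma remainder_eq: "remainder n h = h - (\<Sum>j<n. V j (coord j h))"
  by (induction n) (simp_all add: coord_def)

lemma coord_eq: "coord i h = adj (V i) h"
proof -
  interpret v: isometric_embedding "q (Suc i)" "K i" "V i" "K (Suc i)"
    by (rule embedding)
  have "adj (V i) (V j y) = 0" if "j < i" for j y
    by (rule cinner_ext) (use that V_orthogonal in \<open>simp flip: cinner_adj [OF v.V_clinear]\<close>)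
  then have "adj (V i) (\<Sum>j<i. V j (coord j h)) = 0"
    using linear_sum [OF bounded_linear.linear [OF bounded_clinear_imp_bounded_linear [OF v.adj_V_clinear]],
        of "\<lambda>j. V j (coord j h)" "{..<i}"]
    by simp
  then show ?thesis
    unfolding coord_def [of i] remainder_eq [of i]
    by (simp add: bounded_clinear_simps [OF v.adj_V_clinear])
qed

lemma summable_coord: "summable (\<lambda>j. (norm (coord j h))\<^sup>2)"
proof (rule bounded_imp_summable)
  fix n
  define r where "r = remainder (Suc n) h"
  have "Re (cinner h h) = (\<Sum>j<Suc n. Re (cinner (coord j h) (coord j h))) + Re (cinner r r)"
    using arg_cong [OF cinner_partial_sum [of h h "Suc n"], of Re]
    unfolding r_def [symmetric] plus_complex.sel Re_sum .
  then have "(norm h)\<^sup>2 = (\<Sum>j<Suc n. (norm (coord j h))\<^sup>2) + (norm r)\<^sup>2"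
    unfolding cinner_self Re_complex_of_real .
  then show "(\<Sum>j\<le>n. (norm (coord j h))\<^sup>2) \<le> (norm h)\<^sup>2"
    unfolding lessThan_Suc_atMost by simp
qed simp

lemma coord_surj:
  assumes f: "\<And>j. f j \<in> q (Suc j)" and sum: "summable (\<lambda>j. (norm (f j))\<^sup>2)"
  obtains h where "\<And>j. coord j h = f j"
proof -
  obtain h where h: "(\<lambda>n. \<Sum>j<n. V j (f j)) \<longlonglongrightarrow> h"
    using summable_V [OF f sum] by (auto simp: summable_def sums_def)
  have "coord i h = f i" for i
  proof -
    interpret v: isometric_embedding "q (Suc i)" "K i" "V i" "K (Suc i)"
      by (rule embedding)
    have "adj (V i) (V j (f j)) = (if j = i then f i else 0)" for j
    proof (cases "j = i")
      case False
      then show ?thesis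
        by (intro cinner_ext) (use V_orthogonal in \<open>simp flip: cinner_adj [OF v.V_clinear]\<close>)
    qed (simp add: v.adj_V_V f)
    then have "adj (V i) (\<Sum>j<n. V j (f j)) = f i" if "n > i" for n
      using linear_sum [OF bounded_linear.linear [OF bounded_clinear_imp_bounded_linear [OF v.adj_V_clinear]],
          of "\<lambda>j. V j (f j)" "{..<n}"] that by simp
    then have "\<forall>\<^sub>F n in sequentially. adj (V i) (\<Sum>j<n. V j (f j)) = f i"
      by (auto simp: eventually_sequentially intro!: exI [of _ "Suc i"])
    then have "(\<lambda>n. adj (V i) (\<Sum>j<n. V j (f j))) \<longlonglongrightarrow> f i"
      by (rule tendsto_eventually)
    then have "adj (V i) h = f i"
      by (rule LIMSEQ_unique [OF bounded_clinear_tendsto [OF v.adj_V_clinear h]])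
    then show ?thesis
      by (simp add: coord_eq)
  qed
  then show ?thesis
    using that by blast
qed

text \<open>
  The remainders of a vector converge, by orthogonality, and their limit lies in all state spaces.
\<close>

lemma cinner_sums_coord:
  assumes "(\<Inter>j. K j) = {0}"
  shows "(\<lambda>j. cinner (coord j x) (coord j y)) sums cinner x y"
proof -
  have rem: "(\<lambda>n. remainder n h) \<longlonglongrightarrow> 0" for h
  proof -
    obtain s where s: "(\<lambda>n. \<Sum>j<n. V j (coord j h)) \<longlonglongrightarrow> s"
      using summable_V [OF coord_in summable_coord] by (auto simp: summable_def sums_def)
    then have lim: "(\<lambda>n. remainder n h) \<longlonglongrightarrow> h - s"
      unfolding remainder_eq by (intro tendsto_intros)
    have "h - s \<in> K i" for i
    proof (rule closed_sequentially)
      show "closed (K i)"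
        using K_closed by (simp add: closed_csubspace_def)
      show "(\<lambda>n. remainder (n + i) h) \<longlonglongrightarrow> h - s"
        by (rule LIMSEQ_ignore_initial_segment [OF lim])
      show "remainder (n + i) h \<in> K i" for n
        using remainder_in K_antimono [of i] by (meson le_add2 subsetD)
    qed
    then have "h - s = 0"
      using assms by blast
    then show ?thesis
      using lim by simp
  qed
  have "(\<lambda>n. cinner x y - cinner (remainder n x) (remainder n y)) \<longlonglongrightarrow> cinner x y - cinner 0 (0::'k)"
    by (intro tendsto_intros rem)
  moreover have "cinner x y - cinner (remainder n x) (remainder n y) = (\<Sum>j<n. cinner (coord j x) (coord j y))" for n
    using cinner_partial_sum [of x y n] by simp
  ultimately show ?thesis
    by (simp add: sums_def)
qed

end

section \<open>The tower of a sequence of Schur parameters\<close>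

lemma realizes_at_0: "realizes M K U \<Theta> \<Longrightarrow> m \<in> M \<Longrightarrow> fst (U (m, 0)) = \<Theta> 0 m"
  unfolding realizes_def by (drule bspec [of _ _ 0]) auto

locale schur_sequence =
  fixes M N :: "'a::complex_hilbert set" and \<Gamma> :: "nat \<Rightarrow> 'a \<Rightarrow> 'a"
    and \<Psi> :: "nat \<Rightarrow> complex \<Rightarrow> 'a \<Rightarrow> 'a"
  assumes M: "closed_csubspace M" and N: "closed_csubspace N"
    and parameter: "\<Gamma> n = \<Psi> n 0"
    and iterate: "\<Psi> n \<in> schur_class (defect_chain M \<Gamma> n) (defect_chain N (adj_seq \<Gamma>) n)"
    and schur_step: "z \<in> ball 0 1 \<Longrightarrow> \<Psi> n z x = \<Gamma> n x +
      z *\<^sub>C defect_seq N (adj_seq \<Gamma>) n (\<Psi> (Suc n) z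
        (inv (\<lambda>y. y + z *\<^sub>C adj (\<Gamma> n) (\<Psi> (Suc n) z y)) (defect_seq M \<Gamma> n x)))"
begin

abbreviation "Md \<equiv> defect_chain M \<Gamma>"
abbreviation "Nd \<equiv> defect_chain N (adj_seq \<Gamma>)"

lemma contraction_parameter: "contraction_between (Md n) (Nd n) (\<Gamma> n)"
proof -
  have \<Gamma>: "\<Gamma> n \<in> operators (Md n) (Nd n)" "contraction (\<Gamma> n)" for n
    using iterate [of n] by (auto simp: parameter schur_class_def)
  have "closed_csubspace (Md n) \<and> closed_csubspace (Nd n)"
  proof (induction n)
    case (Suc n)
    then interpret g: contraction_between "Md n" "Nd n" "\<Gamma> n"
      by unfold_locales (use \<Gamma> in auto)
    interpret ad: contraction_between "Nd n" "Md n" "adj (\<Gamma> n)"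
      by (rule g.adjoint)
    show ?case
      using g.closed_defect_space ad.closed_defect_space by simp
  qed (simp add: M N)
  then show ?thesis
    using \<Gamma> by unfold_locales auto
qed

lemma adj_adj_parameter [simp]: "adj (adj (\<Gamma> n)) = \<Gamma> n"
  by (rule contraction_between.adj_adj_G [OF contraction_parameter])

text \<open>
  Since each splitting inverts what remains, the directions alternate: at even places the
  operator realizes the Schur iterate by its inverse, its corner is the adjoint of the
  parameter, and it goes from the domains \<open>Nd\<close> of the adjoints to the domains \<open>Md\<close>.
\<close>

definition source :: "nat \<Rightarrow> 'a set" where "source j = (if even j then Nd j else Md j)"
definition target :: "nat \<Rightarrow> 'a set" where "target j = (if even j then Md j else Nd j)"
definition corner :: "nat \<Rightarrow> 'a \<Rightarrow> 'a" where "corner j = (if even j then adj (\<Gamma> j) else \<Gamma> j)"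

lemma contraction_corner: "contraction_between (source j) (target j) (corner j)"
  using contraction_parameter contraction_between.adjoint [OF contraction_parameter]
  by (auto simp: source_def target_def corner_def)

lemma source_Suc: "source (Suc j) = defect_space (target j) (adj (corner j))"
  and target_Suc: "target (Suc j) = defect_space (source j) (corner j)"
  by (auto simp: source_def target_def corner_def)

text \<open>
  At 0 the transfer function is the corner of the operator that realizes it, which at even places is
  the adjoint of \<open>U\<close>.
\<close>

lemma realizes_corner:
  fixes U :: "'a \<times> 'k::complex_hilbert \<Rightarrow> 'a \<times> 'k"
  assumes U: "unitary_op (source j \<times> K) (target j \<times> K) U"
    and real: "if even j then realizes (Md j) K (adj U) (\<Psi> j) else realizes (Md j) K U (\<Psi> j)"
    and x: "x \<in> source j"
  shows "fst (U (x, 0)) = corner j x"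
proof (cases "even j")
  case True
  interpret g: contraction_between "Md j" "Nd j" "\<Gamma> j"
    by (rule contraction_parameter)
  note U_cl = unitary_op_clinear [OF U]
  have "fst (U (x, 0)) = adj (\<Gamma> j) x"
  proof (rule cinner_ext)
    fix y
    let ?m = "ortho_proj (Md j) y"
    have "fst (U (x, 0)) \<in> Md j"
      using unitary_op_in [OF U, of "(x, 0)"] True by (auto simp: target_def mem_Times_iff)
    then have "cinner y (fst (U (x, 0))) = cinner (?m, 0) (U (x, 0))"
      by (simp add: cinner_prod_def cinner_ortho_proj_left [OF g.X])
    also have "\<dots> = cinner (adj U (?m, 0)) (x, 0)"
      by (rule cinner_adj' [OF U_cl, symmetric])
    also have "\<dots> = cinner (\<Gamma> j ?m) x"
      using realizes_at_0 [of "Md j" K "adj U" "\<Psi> j" ?m] real True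
      by (simp add: cinner_prod_def parameter ortho_proj_in [OF g.X])
    also have "\<dots> = cinner y (adj (\<Gamma> j) x)"
      by (simp add: operators_ortho_proj [OF g.G g.X] cinner_adj [OF g.G_clinear])
    finally show "cinner y (fst (U (x, 0))) = cinner y (adj (\<Gamma> j) x)" .
  qed
  then show ?thesis
    using True by (simp add: corner_def)
next
  case False
  then have "realizes (Md j) K U (\<Psi> j)" "x \<in> Md j"
    using real x by (simp_all add: source_def)
  then show ?thesis
    using False realizes_at_0 by (auto simp: corner_def parameter)
qed

lemma tower_exists:
  fixes U0 :: "'a \<times> 'k::complex_hilbert \<Rightarrow> 'a \<times> 'k"
  assumes U0: "unitary_op (N \<times> UNIV) (M \<times> UNIV) U0" and real0: "realizes M UNIV (adj U0) (\<Psi> 0)"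
  obtains K U V where "rotation_tower source target corner K U V" "U 0 = U0"
proof -
  \<comment> \<open>The last conjunct of \<open>P\<close> makes the chosen sequence start from \<open>U0\<close>.\<close>
  define P where "P j x \<longleftrightarrow> closed_csubspace (fst x) \<and>
      unitary_op (source j \<times> fst x) (target j \<times> fst x) (snd x) \<and>
      (if even j then realizes (Md j) (fst x) (adj (snd x)) (\<Psi> j) else realizes (Md j) (fst x) (snd x) (\<Psi> j)) \<and>
      (j = 0 \<longrightarrow> x = (UNIV, U0))"
    for j and x :: "'k set \<times> ('a \<times> 'k \<Rightarrow> 'a \<times> 'k)"
  define Q where "Q j x y \<longleftrightarrow>
      (\<exists>V. splits_off (source j) (target j) (fst x) (corner j) (snd x) V (fst y) (snd y))"
    for j and x y :: "'k set \<times> ('a \<times> 'k \<Rightarrow> 'a \<times> 'k)"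
  have "\<exists>f. \<forall>j. P j (f j) \<and> Q j (f j) (f (Suc j))"
  proof (rule dependent_nat_choice)
    show "\<exists>x. P 0 x"
      using U0 real0 by (intro exI [of _ "(UNIV, U0)"]) (simp add: P_def source_def target_def)
    fix x j assume P: "P j x"
    obtain K U where x: "x = (K, U)"
      by fastforce
    have K: "closed_csubspace K" and U: "unitary_op (source j \<times> K) (target j \<times> K) U"
      and real: "if even j then realizes (Md j) K (adj U) (\<Psi> j) else realizes (Md j) K U (\<Psi> j)"
      using P by (auto simp: P_def x)
    obtain V K' U' where split: "splits_off (source j) (target j) K (corner j) U V K' U'"
      using splits_off_exists [OF contraction_corner K U realizes_corner [OF U real]] .
    have "closed_csubspace K'"
      using isometric_embedding.K' [OF splits_off_embedding [OF contraction_corner K split]] .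
    moreover have "unitary_op (source (Suc j) \<times> K') (target (Suc j) \<times> K') U'"
      unfolding source_Suc target_Suc by (rule splits_off_unitary [OF split])
    moreover have "if even (Suc j) then realizes (Md (Suc j)) K' (adj U') (\<Psi> (Suc j))
        else realizes (Md (Suc j)) K' U' (\<Psi> (Suc j))"
    proof (cases "even j")
      case True
      have "realizes (defect_space (Md j) (\<Gamma> j)) K' U' (\<Psi> (Suc j))"
        by (rule realizes_adj_splits_off [OF contraction_parameter K, where U = U and \<Theta> = "\<Psi> j" and V = V])
          (use U split real True iterate [of j] iterate [of "Suc j"] schur_step [of _ j] in
            \<open>simp_all add: source_def target_def corner_def defect_seq_def\<close>)
      then show ?thesis
        using True by simp
    next
      case False
      have "realizes (defect_space (Md j) (\<Gamma> j)) K' (adj U') (\<Psi> (Suc j))"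
        by (rule realizes_splits_off [OF contraction_parameter K, where U = U and \<Theta> = "\<Psi> j" and V = V])
          (use U split real False iterate [of "Suc j"] schur_step [of _ j] in
            \<open>simp_all add: source_def target_def corner_def defect_seq_def\<close>)
      then show ?thesis
        using False by simp
    qed
    ultimately show "\<exists>y. P (Suc j) y \<and> Q j x y"
      using split by (intro exI [of _ "(K', U')"]) (auto simp: P_def Q_def x)
  qed
  then obtain f where f: "\<And>j. P j (f j)" "\<And>j. Q j (f j) (f (Suc j))"
    by blast
  then obtain V where V: "\<And>j. splits_off (source j) (target j) (fst (f j)) (corner j) (snd (f j)) (V j)
      (fst (f (Suc j))) (snd (f (Suc j)))"
    unfolding Q_def by metis
  have "rotation_tower source target corner (\<lambda>j. fst (f j)) (\<lambda>j. snd (f j)) V"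
    using f(1) V by (intro rotation_tower.intro contraction_corner source_Suc target_Suc)
      (simp_all add: P_def)
  then show ?thesis
    by (rule that) (use f(1) [of 0] in \<open>simp add: P_def\<close>)
qed

lemma rotation_even: "even j \<Longrightarrow>
    rotation N M (adj_seq \<Gamma>) j = elementary_rotation (source j) (target j) (corner j)"
  and rotation_odd: "odd j \<Longrightarrow>
    rotation N M (adj_seq \<Gamma>) j = elementary_rotation (target j) (source j) (adj (corner j))"
  by (auto simp: rotation_def elementary_rotation_def defect_seq_def source_def target_def corner_def)

end

section \<open>Unitary equivalence with the CMV matrices\<close>

text \<open>
  Applied to \<open>cmv_V\<close>, this turns a unitary operator onto the first CMV space into one onto the second.
\<close>

lemma unitary_onto_sum_rotate:
  fixes R :: "nat \<Rightarrow> 'b::complex_inner \<Rightarrow> 'c::complex_inner"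
  assumes W: "unitary_onto_sum W (hilbert_sum A)" and R: "\<And>n. bounded_clinear (R n)"
    and isometric: "\<And>n p q. p \<in> A n \<Longrightarrow> q \<in> A n \<Longrightarrow> cinner (R n p) (R n q) = cinner p q"
    and onto: "\<And>n. R n ` A n = B n"
  shows "unitary_onto_sum (\<lambda>x n. R n (W x n)) (hilbert_sum B)"
proof -
  have W_in: "W x \<in> hilbert_sum A" for x
    using W by (auto simp: unitary_onto_sum_def)
  then have W_n: "W x n \<in> A n" for x n
    by (simp add: hilbert_sum_def)
  have norm_R: "norm (R n p) = norm p" if "p \<in> A n" for n p
    using isometric [OF that that] by (simp add: norm_eq_cinner)
  have "(\<lambda>n. R n (W x n)) \<in> hilbert_sum B" for x
    using W_in [of x] onto by (auto simp: hilbert_sum_def norm_R)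
  moreover have "g \<in> range (\<lambda>x n. R n (W x n))" if g: "g \<in> hilbert_sum B" for g
  proof -
    have "g n \<in> R n ` A n" for n
      using g onto by (simp add: hilbert_sum_def)
    then have "\<forall>n. \<exists>p. p \<in> A n \<and> g n = R n p"
      by blast
    then obtain f where f: "\<And>n. f n \<in> A n" "\<And>n. g n = R n (f n)"
      by metis
    then have "f \<in> hilbert_sum A"
      using g by (simp add: hilbert_sum_def norm_R)
    then have "f \<in> range W"
      using W by (simp add: unitary_onto_sum_def)
    then obtain x where "f = W x"
      by blast
    then have "g = (\<lambda>n. R n (W x n))"
      using f(2) by auto
    then show ?thesis
      by blast
  qed
  ultimately have "range (\<lambda>x n. R n (W x n)) = hilbert_sum B"
    by blast
  then show ?thesis
    using W W_n isometric by (simp add: unitary_onto_sum_def bounded_clinear_simps [OF R])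
qed

context rotation_tower
begin

definition pairs :: "'k \<Rightarrow> nat \<Rightarrow> 'a \<times> 'a" where
  "pairs h n = (coord (2 * n) h, coord (2 * n + 1) h)"

lemma unitary_pairs:
  assumes simple: "(\<Inter>j. K j) = {0}"
  shows "unitary_onto_sum pairs (hilbert_sum (\<lambda>n. q (Suc (2 * n)) \<times> q (Suc (2 * n + 1))))"
proof -
  have group: "sum f {n * 2..<n * 2 + 2} = f (2 * n) + f (2 * n + 1)" for f :: "nat \<Rightarrow> 'b::comm_monoid_add" and n
    by (simp add: numeral_2_eq_2 mult.commute)
  have sums: "(\<lambda>n. cinner (pairs x n) (pairs y n)) sums cinner x y" for x y
    using sums_group [OF cinner_sums_coord [OF simple, of x y], of 2]
    by (simp only: group pairs_def cinner_Pair)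
  have "pairs x \<in> hilbert_sum (\<lambda>n. q (Suc (2 * n)) \<times> q (Suc (2 * n + 1)))" for x
  proof -
    have "summable (\<lambda>n. Re (cinner (pairs x n) (pairs x n)))"
      using sums_Re [OF sums [of x x]] by (rule sums_summable)
    then show ?thesis
      by (simp add: hilbert_sum_def cinner_self pairs_def coord_in)
  qed
  moreover have "g \<in> range pairs" if g: "g \<in> hilbert_sum (\<lambda>n. q (Suc (2 * n)) \<times> q (Suc (2 * n + 1)))" for g
  proof -
    define f where "f j = (if even j then fst (g (j div 2)) else snd (g (j div 2)))" for j
    have f_in: "f j \<in> q (Suc j)" for j
    proof -
      have "g (j div 2) \<in> q (Suc (2 * (j div 2))) \<times> q (Suc (2 * (j div 2) + 1))"
        using g by (simp add: hilbert_sum_def)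
      then show ?thesis
        by (cases "even j") (auto simp: f_def mem_Times_iff elim!: evenE oddE)
    qed
    have "summable (\<lambda>j. (norm (f j))\<^sup>2)"
    proof (rule bounded_imp_summable)
      fix n
      have "(\<Sum>j\<le>n. (norm (f j))\<^sup>2) \<le> (\<Sum>j<Suc n * 2. (norm (f j))\<^sup>2)"
        by (rule sum_mono2) auto
      also have "\<dots> = (\<Sum>i<Suc n. (norm (g i))\<^sup>2)"
      proof -
        have "(norm (g i))\<^sup>2 = (norm (f (2 * i)))\<^sup>2 + (norm (f (2 * i + 1)))\<^sup>2" for i
          using norm_Pair_square [of "fst (g i)" "snd (g i)"] by (simp add: f_def)
        then show ?thesis
          unfolding sum.nat_group [symmetric] group by simp
      qed
      also have "\<dots> \<le> (\<Sum>i. (norm (g i))\<^sup>2)"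
        using g by (intro sum_le_suminf) (auto simp: hilbert_sum_def)
      finally show "(\<Sum>j\<le>n. (norm (f j))\<^sup>2) \<le> (\<Sum>i. (norm (g i))\<^sup>2)" .
    qed simp
    then obtain h where "\<And>j. coord j h = f j"
      using coord_surj [of f] f_in by blast
    then have "pairs h = g"
      by (auto simp: pairs_def f_def)
    then show ?thesis
      by blast
  qed
  ultimately have "range pairs = hilbert_sum (\<lambda>n. q (Suc (2 * n)) \<times> q (Suc (2 * n + 1)))"
    by blast
  then show ?thesis
    using sums by (simp add: unitary_onto_sum_def pairs_def bounded_clinear_simps [OF coord_clinear])
qed

end

context schur_sequence
begin

text \<open>
  The vectors \<open>z j\<close> that the trace passes from rotation to rotation are the intermediate results
  of the product \<open>L (I \<oplus> V)\<close>: the rotations at odd places are read backwards, as their corners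
  are adjoint to the terms of the sequence of adjoints, and compute \<open>z\<close> from the coordinates of \<open>h\<close>;
  the rotations at even places compute the coordinates of \<open>h'\<close> from \<open>z\<close>. The truncation corresponds to \<open>z 0 = 0\<close>.
\<close>

lemma truncated_cmv_pairs:
  assumes tower: "rotation_tower source target corner K U V"
    and eq: "U 0 (0, h) = (w0, h')"
  shows "rotation_tower.pairs V h' =
    truncated_cmv N M (adj_seq \<Gamma>) (rotation_tower.pairs V h)"
proof -
  interpret rotation_tower source target corner K U V
    by (rule tower)
  obtain z w where zw: "z 0 = 0" "w 0 = w0" "\<And>j. z j \<in> source j"
      "\<And>j. elementary_rotation (source j) (target j) (corner j) (z j, z (Suc j)) =
        (w j, coord j (if even j then h' else h))"
      "\<And>j. w (Suc j) = coord j (if even j then h else h')"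
    by (rule trace [OF csubspace_zero [OF p_closed] eq], rule that; assumption)
  have V: "cmv_V N M (adj_seq \<Gamma>) (pairs h) = (\<lambda>n. (z (2 * n + 1), z (2 * n + 2)))"
  proof
    fix n :: nat
    let ?j = "2 * n + 1"
    have "elementary_rotation (target ?j) (source ?j) (adj (corner ?j)) (w ?j, coord ?j h) = (z ?j, z (Suc ?j))"
      using contraction_between.elementary_rotation_inverse [OF contraction_corner zw(3) p_Suc_subset [OF zw(3)], of ?j]
        zw(4) [of ?j] by simp
    moreover have "pairs h n = (w ?j, coord ?j h)"
      using zw(5) [of "2 * n"] by (simp add: pairs_def)
    ultimately show "cmv_V N M (adj_seq \<Gamma>) (pairs h) n = (z (2 * n + 1), z (2 * n + 2))"
      using rotation_odd [of ?j] by (simp add: cmv_V_def)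
  qed
  have "regroup (0, \<lambda>n. (z (2 * n + 1), z (2 * n + 2))) n = (z (2 * n), z (2 * n + 1))" for n
    by (cases n) (simp_all add: zw(1))
  then have "(\<lambda>n. rotation N M (adj_seq \<Gamma>) (2 * n) (regroup (0, cmv_V N M (adj_seq \<Gamma>) (pairs h)) n)) =
      (\<lambda>n. (w (2 * n), coord (2 * n) h'))"
    using zw(4) [of "2 * _"] rotation_even by (simp add: V)
  then have "truncated_cmv N M (adj_seq \<Gamma>) (pairs h) = (\<lambda>n. (coord (2 * n) h', w (2 * Suc n)))"
    by (simp add: truncated_cmv_def cmv_U_def cmv_L_def ungroup_def)
  then show ?thesis
    using zw(5) [of "Suc (2 * _)"] by (simp add: pairs_def fun_eq_iff)
qed

text \<open>The two matrices come from the products \<open>L (I \<oplus> V)\<close> and \<open>(I \<oplus> V) L\<close>.\<close>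

lemma truncated_cmv_tilde_cmv_V:
  "truncated_cmv_tilde N M G (cmv_V N M G f) = cmv_V N M G (truncated_cmv N M G f)"
  by (simp add: truncated_cmv_tilde_def truncated_cmv_def cmv_U_def cmv_U_tilde_def)

lemma unitarily_equivalent_cmv:
  assumes tower: "rotation_tower source target corner K U V" and simple: "(\<Inter>j. K j) = {0}"
    and T: "\<And>h. snd (U 0 (0, h)) = T h"
  shows "unitarily_equivalent T (cmv_space N M (adj_seq \<Gamma>)) (truncated_cmv N M (adj_seq \<Gamma>))"
    and "unitarily_equivalent T (cmv_space_tilde N M (adj_seq \<Gamma>)) (truncated_cmv_tilde N M (adj_seq \<Gamma>))"
proof -
  interpret rotation_tower source target corner K U V
    by (rule tower)
  let ?A = "\<lambda>n. Nd (Suc (2 * n)) \<times> Md (Suc (2 * n + 1))"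
    and ?B = "\<lambda>n. Md (Suc (2 * n)) \<times> Nd (Suc (2 * n + 1))"
  have "hilbert_sum (\<lambda>n. target (Suc (2 * n)) \<times> target (Suc (2 * n + 1))) = hilbert_sum ?A"
    by (simp add: target_def)
  then have W: "unitary_onto_sum pairs (hilbert_sum ?A)"
    using unitary_pairs [OF simple] by simp
  have cmv: "pairs (T h) = truncated_cmv N M (adj_seq \<Gamma>) (pairs h)" for h
    using truncated_cmv_pairs [OF tower, of h "fst (U 0 (0, h))" "T h"] T by (simp add: prod_eq_iff)
  have spaces: "cmv_space N M (adj_seq \<Gamma>) = hilbert_sum ?A" "cmv_space_tilde N M (adj_seq \<Gamma>) = hilbert_sum ?B"
    by (simp_all add: cmv_space_def cmv_space_tilde_def)
  show "unitarily_equivalent T (cmv_space N M (adj_seq \<Gamma>)) (truncated_cmv N M (adj_seq \<Gamma>))"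
    unfolding unitarily_equivalent_def spaces using W cmv by blast
  let ?R = "\<lambda>n. rotation N M (adj_seq \<Gamma>) (2 * n + 1)"
  have R: "?R n = elementary_rotation (Nd (2 * n + 1)) (Md (2 * n + 1)) (adj (\<Gamma> (2 * n + 1)))" for n
    by (simp add: rotation_def elementary_rotation_def defect_seq_def)
  have "unitary_onto_sum (\<lambda>x n. ?R n (pairs x n)) (hilbert_sum ?B)"
  proof (rule unitary_onto_sum_rotate [OF W])
    fix n
    interpret g: contraction_between "Md (2 * n + 1)" "Nd (2 * n + 1)" "\<Gamma> (2 * n + 1)"
      by (rule contraction_parameter)
    interpret ad: contraction_between "Nd (2 * n + 1)" "Md (2 * n + 1)" "adj (\<Gamma> (2 * n + 1))"
      by (rule g.adjoint)
    show "bounded_clinear (?R n)"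
      unfolding R by (rule ad.elementary_rotation_clinear)
    have A: "?A n = Nd (2 * n + 1) \<times> defect_space (Md (2 * n + 1)) (\<Gamma> (2 * n + 1))"
      and B: "?B n = Md (2 * n + 1) \<times> defect_space (Nd (2 * n + 1)) (adj (\<Gamma> (2 * n + 1)))"
      by simp_all
    show "cinner (?R n x) (?R n y) = cinner x y" if "x \<in> ?A n" "y \<in> ?A n" for x y
      unfolding R using that g.defect_space_subset
      by (intro ad.elementary_rotation_cinner) (auto simp: A)
    show "?R n ` ?A n = ?B n"
    proof (intro equalityI subsetI)
      fix r assume "r \<in> ?R n ` ?A n"
      then show "r \<in> ?B n"
        unfolding R A B using ad.elementary_rotation_in by auto
    next
      fix r assume "r \<in> ?B n"
      then obtain x y where r: "r = (x, y)" "x \<in> Md (2 * n + 1)"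
          "y \<in> defect_space (Nd (2 * n + 1)) (adj (\<Gamma> (2 * n + 1)))"
        unfolding B by blast
      have eq: "?R n (elementary_rotation (Md (2 * n + 1)) (Nd (2 * n + 1)) (\<Gamma> (2 * n + 1)) r) = r"
        unfolding R r(1) using ad.defect_space_subset r by (intro g.elementary_rotation_inverse) auto
      have "elementary_rotation (Md (2 * n + 1)) (Nd (2 * n + 1)) (\<Gamma> (2 * n + 1)) r \<in> ?A n"
        unfolding A r(1) by (rule g.elementary_rotation_in [OF r(2,3)])
      then show "r \<in> ?R n ` ?A n"
        by (rule rev_image_eqI) (rule eq [symmetric])
    qed
  qed
  then have "unitary_onto_sum (\<lambda>x. cmv_V N M (adj_seq \<Gamma>) (pairs x)) (hilbert_sum ?B)"
    by (simp add: cmv_V_def [abs_def])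
  moreover have "cmv_V N M (adj_seq \<Gamma>) (pairs (T x)) =
      truncated_cmv_tilde N M (adj_seq \<Gamma>) (cmv_V N M (adj_seq \<Gamma>) (pairs x))" for x
    by (simp only: truncated_cmv_tilde_cmv_V cmv)
  ultimately show "unitarily_equivalent T (cmv_space_tilde N M (adj_seq \<Gamma>)) (truncated_cmv_tilde N M (adj_seq \<Gamma>))"
    unfolding unitarily_equivalent_def spaces by blast
qed

end

section \<open>The characteristic function\<close>

lemma
  fixes S :: "'a::complex_hilbert \<Rightarrow> 'a"
  assumes S: "bounded_clinear S" and r: "0 \<le> r" "r < 1" and le: "\<And>x. norm (S x) \<le> r * norm x"
  defines "R \<equiv> inv (\<lambda>y. y - S y)"
  shows resolvent_eq: "R x - S (R x) = x"
    and resolvent_eq': "R (x - S x) = x"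
    and norm_resolvent: "norm (R x) \<le> norm x / (1 - r)"
    and bounded_clinear_resolvent: "bounded_clinear R"
proof -
  have S': "bounded_clinear (\<lambda>x. - S x)" "\<And>x. norm (- S x) \<le> r * norm x"
    using le by (simp_all add: bounded_clinear_uminus S)
  have bij: "bij (\<lambda>y. y - S y)"
    using bij_id_plus(1) [OF S'(1) r S'(2)] by simp
  have eq: "R x - S (R x) = x" for x
    unfolding R_def using surj_f_inv_f [OF bij_is_surj [OF bij]] .
  show eq': "R (x - S x) = x" for x
    unfolding R_def using inv_f_f [OF bij_is_inj [OF bij]] .
  show "R x - S (R x) = x"
    by (rule eq)
  have bound: "norm (R x) \<le> norm x / (1 - r)" for x
    using bij_id_plus(2) [OF S'(1) r S'(2), of "R x" 0] r
    by (simp add: bounded_clinear_zero [OF S] eq pos_le_divide_eq)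
  then show "norm (R x) \<le> norm x / (1 - r)" .
  show "bounded_clinear R"
  proof (rule bounded_clinearI)
    show "norm (R x) \<le> (1 / (1 - r)) * norm x" for x
      using bound [of x] by simp
    fix x y c
    have "R ((R x + R y) - S (R x + R y)) = R x + R y" "R (c *\<^sub>C R x - S (c *\<^sub>C R x)) = c *\<^sub>C R x"
      by (rule eq')+
    moreover have "(R x + R y) - S (R x + R y) = (R x - S (R x)) + (R y - S (R y))"
      by (simp add: bounded_clinear_simps [OF S])
    then have "(R x + R y) - S (R x + R y) = x + y"
      by (simp only: eq)
    moreover have "c *\<^sub>C R x - S (c *\<^sub>C R x) = c *\<^sub>C x"
      using eq [of x] by (simp add: bounded_clinear_simps [OF S] flip: scaleC_diff_right)
    ultimately show "R (x + y) = R x + R y" "R (c *\<^sub>C x) = c *\<^sub>C R x"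
      by simp_all
  qed
qed

locale hilbert_contraction =
  fixes T :: "'a::complex_hilbert \<Rightarrow> 'a"
  assumes T: "contraction T"
begin

lemma T_clinear: "bounded_clinear T"
  by (rule contraction_bounded_clinear [OF T])

sublocale g: contraction_between UNIV UNIV T
proof
  have "T x = 0" if "\<forall>z. cinner x z = 0" for x
    using that cinner_self_eq_0 [of x] bounded_clinear_zero [OF T_clinear] by simp
  then show "T \<in> operators UNIV UNIV"
    using T_clinear by (simp add: operators_def)
qed (simp_all add: T)

sublocale ad: contraction_between UNIV UNIV "adj T"
  by (rule g.adjoint)

abbreviation "DT \<equiv> defect_op UNIV T"
abbreviation "DTs \<equiv> defect_op UNIV (adj T)"
abbreviation "ET \<equiv> defect_space UNIV T"
abbreviation "ETs \<equiv> defect_space UNIV (adj T)"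

text \<open>
  The elementary rotation of \<open>T\<close>, with the state space moved to the second place, is the unitary
  colligation \<open>[-T\<^sup>* D\<^sub>T; D\<^sub>T\<^sub>* T]\<close>.
\<close>

definition colligation :: "'a \<times> 'a \<Rightarrow> 'a \<times> 'a" where
  "colligation p = prod.swap (elementary_rotation UNIV UNIV T (prod.swap (ortho_proj (ETs \<times> UNIV) p)))"

lemma colligation_eq:
  "n \<in> ETs \<Longrightarrow> colligation (n, h) = (DT h - adj T n, T h + DTs n)"
  by (simp add: colligation_def ortho_proj_Times ad.closed_defect_space elementary_rotation_def)

lemma unitary_colligation: "unitary_op (ETs \<times> UNIV) (ET \<times> UNIV) colligation"
proof (rule unitary_opI)
  show dom: "closed_csubspace (ETs \<times> (UNIV :: 'a set))" "closed_csubspace (ET \<times> (UNIV :: 'a set))"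
    by (simp_all add: closed_csubspace_Times g.closed_defect_space ad.closed_defect_space)
  have swap: "bounded_clinear (prod.swap :: 'a \<times> 'a \<Rightarrow> 'a \<times> 'a)"
    unfolding prod.swap_def [abs_def] by (rule bounded_clinear_Pair [OF bounded_clinear_snd bounded_clinear_fst])
  have in_E: "colligation (n, h) \<in> ET \<times> UNIV" if "n \<in> ETs" for n h
    using g.elementary_rotation_in [of h n] that
    by (simp add: colligation_eq elementary_rotation_def)
  show "colligation \<in> operators (ETs \<times> UNIV) (ET \<times> UNIV)"
  proof (rule operatorsI [OF _ dom(1)])
    show "bounded_clinear colligation"
      unfolding colligation_def [abs_def]
      by (rule bounded_clinear_compose [OF swap bounded_clinear_compose [OF g.elementary_rotation_clinear
            bounded_clinear_compose [OF swap bounded_clinear_ortho_proj [OF dom(1)]]]])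
    fix p
    show proj: "colligation (ortho_proj (ETs \<times> UNIV) p) = colligation p"
      by (simp add: colligation_def ortho_proj_id [OF dom(1)] ortho_proj_in [OF dom(1)])
    obtain n h where "ortho_proj (ETs \<times> UNIV) p = (n, h)" "n \<in> ETs"
      using ortho_proj_in [OF dom(1), of p] by auto
    then show "colligation p \<in> ET \<times> UNIV"
      using in_E proj by metis
  qed
  fix p assume "p \<in> ETs \<times> (UNIV :: 'a set)"
  then obtain n h where p: "p = (n, h)" "n \<in> ETs"
    by auto
  have "norm (colligation p) = norm (elementary_rotation UNIV UNIV T (h, n))"
    using p by (simp add: colligation_eq elementary_rotation_def norm_Pair add.commute)
  also have "\<dots> = norm (h, n)"
    using g.elementary_rotation_cinner [of "(h, n)" "(h, n)"] by (simp only: norm_eq_cinner) simp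
  also have "\<dots> = norm p"
    by (simp add: p norm_Pair add.commute)
  finally show "norm (colligation p) = norm p" .
next
  fix r assume "r \<in> ET \<times> (UNIV :: 'a set)"
  then obtain m h where r: "r = (m, h)" "m \<in> ET"
    by auto
  have in_E: "elementary_rotation UNIV UNIV (adj T) (h, m) \<in> UNIV \<times> ETs"
    using ad.elementary_rotation_in [of h m] r by simp
  have "elementary_rotation UNIV UNIV T (elementary_rotation UNIV UNIV (adj T) (h, m)) = (h, m)"
    using ad.elementary_rotation_inverse [of h m] by simp
  then have "colligation (prod.swap (elementary_rotation UNIV UNIV (adj T) (h, m))) = r"
    using in_E by (cases "elementary_rotation UNIV UNIV (adj T) (h, m)")
      (auto simp: colligation_eq r elementary_rotation_def)
  then show "\<exists>p\<in>ETs \<times> UNIV. colligation p = r"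
    using in_E by (metis UNIV_I mem_Sigma_iff prod.collapse prod.swap_def)
qed

lemma adj_colligation_eq:
  assumes m: "m \<in> ET"
  shows "adj colligation (m, h) = (DTs h - T m, adj T h + DT m)"
proof -
  have rot: "elementary_rotation UNIV UNIV (adj T) (h, m) = (adj T h + DT m, DTs h - T m)"
    by (simp add: elementary_rotation_def)
  have in_E: "DTs h - T m \<in> ETs"
    using ad.elementary_rotation_in [of h m] m by (simp add: rot)
  have "elementary_rotation UNIV UNIV T (adj T h + DT m, DTs h - T m) = (h, m)"
    using ad.elementary_rotation_inverse [of h m] by (simp add: rot)
  then have "colligation (DTs h - T m, adj T h + DT m) = (m, h)"
    using in_E by (simp add: colligation_eq elementary_rotation_def)
  then show ?thesis
    using unitary_op_swap [OF unitary_colligation, of "(DTs h - T m, adj T h + DT m)" "(m, h)"] in_E m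
    by simp
qed

definition resolvent :: "complex \<Rightarrow> 'a \<Rightarrow> 'a" where
  "resolvent z = inv (\<lambda>y. y - z *\<^sub>C adj T y)"

context
  fixes z :: complex
  assumes z: "norm z < 1"
begin

lemma zT_clinear: "bounded_clinear (\<lambda>y. z *\<^sub>C adj T y)"
  and norm_zT: "norm (z *\<^sub>C adj T y) \<le> norm z * norm y"
  using contraction_norm [OF ad.contr] by (auto simp: bounded_clinear_mult_scaleC ad.G_clinear mult_left_mono)

lemmas resolvent_z = resolvent_eq [OF zT_clinear norm_ge_zero z norm_zT, folded resolvent_def]
  and resolvent_z' = resolvent_eq' [OF zT_clinear norm_ge_zero z norm_zT, folded resolvent_def]
  and norm_resolvent_z = norm_resolvent [OF zT_clinear norm_ge_zero z norm_zT, folded resolvent_def]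
  and resolvent_clinear = bounded_clinear_resolvent [OF zT_clinear norm_ge_zero z norm_zT, folded resolvent_def]

end

lemma char_fun_eq:
  "char_fun T z x = - T (ortho_proj ET x) + z *\<^sub>C DTs (resolvent z (DT (ortho_proj ET x)))"
  by (simp add: char_fun_def Let_def resolvent_def)

lemma colligation_char_fun:
  assumes z: "norm z < 1" and m: "m \<in> ET"
  shows "adj colligation (m, z *\<^sub>C resolvent z (DT m)) = (char_fun T z m, resolvent z (DT m))"
  using resolvent_z [OF z, of "DT m"]
  by (simp add: adj_colligation_eq [OF m] char_fun_eq ortho_proj_id [OF g.closed_defect_space] m
      bounded_clinear_simps [OF ad.defect_clinear] bounded_clinear_simps [OF ad.G_clinear] algebra_simps)

lemma realizes_char_fun: "realizes ET UNIV (adj colligation) (char_fun T)"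
  unfolding realizes_def using colligation_char_fun by (auto intro!: exI [of _ "resolvent _ (DT _)"])

lemma char_fun_clinear:
  assumes z: "norm z < 1"
  shows "bounded_clinear (char_fun T z)"
proof -
  note P = bounded_clinear_ortho_proj [OF g.closed_defect_space]
  have "bounded_clinear (\<lambda>x. - T (ortho_proj ET x) + z *\<^sub>C DTs (resolvent z (DT (ortho_proj ET x))))"
    by (intro bounded_clinear_plus bounded_clinear_uminus bounded_clinear_mult_scaleC
        bounded_clinear_compose [OF T_clinear P]
        bounded_clinear_compose [OF ad.defect_clinear bounded_clinear_compose [OF resolvent_clinear [OF z]
          bounded_clinear_compose [OF g.defect_clinear P]]])
  then show ?thesis
    by (simp add: char_fun_eq [abs_def])
qed

lemma char_fun_operators:
  assumes z: "norm z < 1"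
  shows "char_fun T z \<in> operators ET ETs" and "contraction (char_fun T z)"
proof -
  note P_in = ortho_proj_in [OF g.closed_defect_space]
  have proj: "char_fun T z (ortho_proj ET x) = char_fun T z x" for x
    by (simp add: char_fun_eq ortho_proj_id [OF g.closed_defect_space] P_in)
  have adj_U: "unitary_op (ET \<times> UNIV) (ETs \<times> UNIV) (adj colligation)"
    by (rule unitary_op_adj [OF unitary_colligation])
  show "char_fun T z \<in> operators ET ETs"
  proof (rule operatorsI [OF char_fun_clinear [OF z] g.closed_defect_space _ proj])
    fix x
    have "(char_fun T z (ortho_proj ET x), resolvent z (DT (ortho_proj ET x))) \<in> ETs \<times> UNIV"
      unfolding colligation_char_fun [OF z P_in, symmetric] by (rule unitary_op_in [OF adj_U])
    then show "char_fun T z x \<in> ETs"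
      by (simp add: proj)
  qed
  have "norm (char_fun T z x) \<le> norm x" for x
  proof -
    let ?m = "ortho_proj ET x" and ?k = "resolvent z (DT (ortho_proj ET x))"
    have "(norm (char_fun T z ?m, ?k))\<^sup>2 = (norm (?m, z *\<^sub>C ?k))\<^sup>2"
      using unitary_op_norm [OF adj_U, of "(?m, z *\<^sub>C ?k)"] P_in
      by (simp add: colligation_char_fun [OF z P_in])
    then have "(norm (char_fun T z x))\<^sup>2 + (norm ?k)\<^sup>2 = (norm ?m)\<^sup>2 + (norm z)\<^sup>2 * (norm ?k)\<^sup>2"
      by (simp add: norm_Pair_square proj power_mult_distrib)
    moreover have "(norm z)\<^sup>2 * (norm ?k)\<^sup>2 \<le> (norm ?k)\<^sup>2"
      using z power_le_one [of "norm z" 2] by (simp add: mult_left_le_one_le)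
    moreover have "(norm ?m)\<^sup>2 \<le> (norm x)\<^sup>2"
      using norm_ortho_proj_le [OF g.closed_defect_space, of x] by (intro power_mono) auto
    ultimately have "(norm (char_fun T z x))\<^sup>2 \<le> (norm x)\<^sup>2"
      by linarith
    then show ?thesis
      by simp
  qed
  then show "contraction (char_fun T z)"
    using char_fun_clinear [OF z] by (simp add: contraction_def)
qed

text \<open>
  With \<open>R\<^sub>z = (I - z T\<^sup>*)\<^sup>-\<^sup>1\<close>, two applications of the resolvent identity give
  \<open>w R\<^sub>w - z R\<^sub>z = (w - z) R\<^sub>w R\<^sub>z\<close> and \<open>R\<^sub>w - R\<^sub>z = (w - z) R\<^sub>w T\<^sup>* R\<^sub>z\<close>, so that \<open>w R\<^sub>w\<close> has the derivative
  \<open>R\<^sub>z\<^sup>2\<close> in the operator norm.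
\<close>

lemma resolvent_identities:
  assumes w: "norm w < 1" and z: "norm z < 1"
  shows "w *\<^sub>C resolvent w v - z *\<^sub>C resolvent z v = (w - z) *\<^sub>C resolvent w (resolvent z v)"
    and "resolvent w v - resolvent z v = (w - z) *\<^sub>C resolvent w (adj T (resolvent z v))"
proof -
  note Rw = bounded_clinear_simps [OF resolvent_clinear [OF w]]
  let ?u = "resolvent z v"
  have v: "v = ?u - z *\<^sub>C adj T ?u"
    using resolvent_z [OF z, of v] by simp
  have Rw_v: "resolvent w v = resolvent w ?u - z *\<^sub>C resolvent w (adj T ?u)"
    by (subst v) (simp add: Rw)
  have u: "resolvent w ?u - w *\<^sub>C resolvent w (adj T ?u) = ?u"
    using resolvent_z' [OF w, of ?u] by (simp add: Rw)
  show "w *\<^sub>C resolvent w v - z *\<^sub>C resolvent z v = (w - z) *\<^sub>C resolvent w ?u"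
  proof -
    have "w *\<^sub>C z *\<^sub>C resolvent w (adj T ?u) = z *\<^sub>C w *\<^sub>C resolvent w (adj T ?u)"
      by (simp add: scaleC_scaleC mult.commute)
    also have "w *\<^sub>C resolvent w (adj T ?u) = resolvent w ?u - ?u"
      using u by (simp add: algebra_simps)
    finally show ?thesis
      unfolding Rw_v by (simp add: scaleC_diff_right scaleC_diff_left)
  qed
  show "resolvent w v - resolvent z v = (w - z) *\<^sub>C resolvent w (adj T ?u)"
  proof -
    have "w *\<^sub>C resolvent w (adj T ?u) = resolvent w ?u - ?u"
      using u by (simp add: algebra_simps)
    then show ?thesis
      unfolding Rw_v by (simp add: scaleC_diff_left)
  qed
qed

lemma char_fun_holomorphic: "operator_holomorphic_on (char_fun T) (ball 0 1)"
  unfolding operator_holomorphic_on_def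
proof
  fix z :: complex assume "z \<in> ball 0 1"
  then have z: "norm z < 1"
    by simp
  let ?P = "ortho_proj ET"
  note P = bounded_clinear_ortho_proj [OF g.closed_defect_space]
  note R = resolvent_clinear [OF z]
  define B where "B x = DTs (resolvent z (resolvent z (DT (?P x))))" for x
  have B: "bounded_clinear B"
    unfolding B_def [abs_def]
    by (intro bounded_clinear_compose [OF ad.defect_clinear bounded_clinear_compose [OF R
          bounded_clinear_compose [OF R bounded_clinear_compose [OF g.defect_clinear P]]]])
  let ?q = "\<lambda>w x. (1 / (w - z)) *\<^sub>C (char_fun T w x - char_fun T z x) - B x"
  define b where "b w = norm (w - z) * (1 / (1 - norm w) * (1 / (1 - norm z)) * (1 / (1 - norm z)))"
    for w :: complex
  have bound: "norm (?q w x) \<le> b w * norm x" if w: "norm w < 1" "w \<noteq> z" for w x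
  proof -
    let ?v = "DT (?P x)"
    let ?u = "resolvent z (resolvent z ?v)"
    have "char_fun T w x - char_fun T z x = DTs (w *\<^sub>C resolvent w ?v - z *\<^sub>C resolvent z ?v)"
      by (simp add: char_fun_eq bounded_clinear_simps [OF ad.defect_clinear])
    also have "\<dots> = (w - z) *\<^sub>C DTs (resolvent w (resolvent z ?v))"
      by (simp only: resolvent_identities(1) [OF w(1) z] bounded_clinear_scaleC [OF ad.defect_clinear])
    finally have "?q w x = DTs (resolvent w (resolvent z ?v) - resolvent z (resolvent z ?v))"
      using w(2) by (simp add: B_def bounded_clinear_simps [OF ad.defect_clinear] scaleC_scaleC)
    also have "\<dots> = (w - z) *\<^sub>C DTs (resolvent w (adj T ?u))"
      by (simp only: resolvent_identities(2) [OF w(1) z] bounded_clinear_scaleC [OF ad.defect_clinear])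
    finally have "norm (?q w x) = norm (w - z) * norm (DTs (resolvent w (adj T ?u)))"
      by simp
    also have "\<dots> \<le> norm (w - z) * (norm ?u / (1 - norm w))"
    proof (intro mult_left_mono norm_ge_zero)
      have "norm (DTs (resolvent w (adj T ?u))) \<le> norm (adj T ?u) / (1 - norm w)"
        by (rule order_trans [OF ad.norm_defect_le norm_resolvent_z [OF w(1)]])
      also have "\<dots> \<le> norm ?u / (1 - norm w)"
        using w contraction_norm [OF ad.contr, of ?u] by (intro divide_right_mono) auto
      finally show "norm (DTs (resolvent w (adj T ?u))) \<le> norm ?u / (1 - norm w)" .
    qed
    also have "\<dots> \<le> norm (w - z) * (norm x / (1 - norm z) / (1 - norm z) / (1 - norm w))"
    proof (intro mult_left_mono divide_right_mono norm_ge_zero)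
      have "norm ?v \<le> norm x"
        using g.norm_defect_le [of "?P x"] norm_ortho_proj_le [OF g.closed_defect_space, of x] by linarith
      then have "norm (resolvent z ?v) \<le> norm x / (1 - norm z)"
        using norm_resolvent_z [OF z, of ?v] z by (meson divide_right_mono diff_ge_0_iff_ge less_imp_le order_trans)
      then show "norm ?u \<le> norm x / (1 - norm z) / (1 - norm z)"
        using norm_resolvent_z [OF z, of "resolvent z ?v"] z
        by (meson divide_right_mono diff_ge_0_iff_ge less_imp_le order_trans)
    qed (use w in auto)
    also have "\<dots> = b w * norm x"
      by (simp add: b_def)
    finally show ?thesis .
  qed
  have ev: "\<forall>\<^sub>F w in at z within ball 0 1. norm w < 1 \<and> w \<noteq> z"
    by (auto simp: eventually_at intro!: exI [of _ 1])
  have "((\<lambda>w. onorm (?q w)) \<longlongrightarrow> 0) (at z within ball 0 1)"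
  proof (rule Lim_null_comparison)
    show "\<forall>\<^sub>F w in at z within ball 0 1. norm (onorm (?q w)) \<le> b w"
      using ev
    proof eventually_elim
      case (elim w)
      have "bounded_clinear (?q w)"
        using elim z by (intro bounded_clinear_sub bounded_clinear_mult_scaleC char_fun_clinear B) auto
      moreover have "onorm (?q w) \<le> b w"
        using bound elim by (intro onorm_bound) (auto simp: b_def z less_imp_le)
      ultimately show ?case
        by (simp add: onorm_pos_le bounded_clinear_imp_bounded_linear)
    qed
    have "(b \<longlongrightarrow> norm (z - z) * (1 / (1 - norm z) * (1 / (1 - norm z)) * (1 / (1 - norm z)))) (at z within ball 0 1)"
      unfolding b_def [abs_def] using z by (intro tendsto_intros) auto
    then show "(b \<longlongrightarrow> 0) (at z within ball 0 1)"
      by simp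
  qed
  then show "\<exists>B. bounded_clinear B \<and>
      ((\<lambda>w. onorm (\<lambda>x. (1 / (w - z)) *\<^sub>C (char_fun T w x - char_fun T z x) - B x)) \<longlongrightarrow> 0) (at z within ball 0 1)"
    using B by blast
qed

lemma char_fun_schur_class: "char_fun T \<in> schur_class ET ETs"
  using char_fun_holomorphic char_fun_operators by (simp add: schur_class_def)

end

section \<open>The functional model by CMV matrices\<close>

theorem theorem8p1:
  fixes T :: "'a::complex_hilbert \<Rightarrow> 'a"
    and \<Gamma> :: "nat \<Rightarrow> 'a \<Rightarrow> 'a"
  assumes "separable_space (euclidean :: 'a topology)"
    and "contraction T"
    and "completely_nonunitary T"
    and "schur_parameters (defect_space UNIV T) (defect_space UNIV (adj T)) (char_fun T) \<Gamma>"
  shows "char_fun T \<in> schur_class (defect_space UNIV T) (defect_space UNIV (adj T))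
     \<and> unitarily_equivalent T
           (cmv_space (defect_space UNIV (adj T)) (defect_space UNIV T) (adj_seq \<Gamma>))
           (truncated_cmv (defect_space UNIV (adj T)) (defect_space UNIV T) (adj_seq \<Gamma>))
     \<and> unitarily_equivalent T
           (cmv_space_tilde (defect_space UNIV (adj T)) (defect_space UNIV T) (adj_seq \<Gamma>))
           (truncated_cmv_tilde (defect_space UNIV (adj T)) (defect_space UNIV T) (adj_seq \<Gamma>))"
proof -
  interpret hilbert_contraction T
    by unfold_locales fact
  obtain \<Psi> where \<Psi>: "\<Psi> 0 = char_fun T" "\<And>n. \<Gamma> n = \<Psi> n 0"
      "\<And>n. \<Psi> (Suc n) \<in> schur_class (defect_chain ET \<Gamma> (Suc n)) (defect_chain ETs (adj_seq \<Gamma>) (Suc n))"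
      "\<And>n z x. z \<in> ball 0 1 \<Longrightarrow> \<Psi> n z x = \<Gamma> n x + z *\<^sub>C defect_seq ETs (adj_seq \<Gamma>) n
        (\<Psi> (Suc n) z (inv (\<lambda>y. y + z *\<^sub>C adj (\<Gamma> n) (\<Psi> (Suc n) z y)) (defect_seq ET \<Gamma> n x)))"
    using assms(4) unfolding schur_parameters_def by blast
  interpret schur_sequence ET ETs \<Gamma> \<Psi>
  proof (rule schur_sequence.intro)
    show "\<Psi> n \<in> schur_class (defect_chain ET \<Gamma> n) (defect_chain ETs (adj_seq \<Gamma>) n)" for n
      using \<Psi>(1,3) char_fun_schur_class by (cases n) auto
  qed (rule g.closed_defect_space ad.closed_defect_space \<Psi>(2,4), assumption?)+
  have "realizes ET UNIV (adj colligation) (\<Psi> 0)"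
    unfolding \<Psi>(1) by (rule realizes_char_fun)
  then obtain K U V where tower: "rotation_tower source target corner K U V" and U0: "U 0 = colligation"
    by (rule tower_exists [OF unitary_colligation])
  interpret tower: rotation_tower source target corner K U V
    by (rule tower)
  have zero: "0 \<in> ETs"
    by (rule csubspace_zero [OF ad.closed_defect_space])
  have U0_eq: "U 0 (0, h) = (DT h, T h)" for h
    using colligation_eq [OF zero, of h]
    by (simp add: U0 bounded_clinear_zero [OF ad.G_clinear] bounded_clinear_zero [OF ad.defect_clinear])
  \<comment> \<open>The intersection of the state spaces reduces \<open>T\<close> to a unitary operator.\<close>
  have forward: "DT h = 0 \<and> T h \<in> (\<Inter>j. K j)" if "h \<in> (\<Inter>j. K j)" for h
    using tower.residual_forward [OF _ U0_eq, of h] that by blast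
  have backward: "adj T h \<in> (\<Inter>j. K j) \<and> T (adj T h) = h" if h: "h \<in> (\<Inter>j. K j)" for h
  proof -
    have "adj colligation (0, h) = (DTs h, adj T h)"
      using adj_colligation_eq [OF csubspace_zero [OF g.closed_defect_space], of h]
      by (simp add: bounded_clinear_zero [OF T_clinear] bounded_clinear_zero [OF g.defect_clinear])
    then have eq: "U 0 (DTs h, adj T h) = (0, h)"
      using unitary_op_inverse' [OF unitary_colligation, of "(0, h)"] csubspace_zero [OF g.closed_defect_space]
      by (simp add: U0)
    have "DTs h \<in> source 0"
      by (simp add: source_def ad.defect_in_space)
    with eq h have 0: "DTs h = 0 \<and> (\<forall>j. adj T h \<in> K j)"
      by (intro tower.residual_backward) auto
    then show ?thesis
      using eq U0_eq [of "adj T h"] by simp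
  qed
  have "closed_csubspace (\<Inter>j. K j)"
  proof (rule closed_csubspaceI)
    show "closed (\<Inter>j. K j)"
      using tower.K_closed by (intro closed_INT) (simp add: closed_csubspace_def)
  qed (use csubspace_intros [OF tower.K_closed] in auto)
  moreover have "T ` (\<Inter>j. K j) \<subseteq> (\<Inter>j. K j)" "adj T ` (\<Inter>j. K j) \<subseteq> (\<Inter>j. K j)"
    using forward backward by blast+
  moreover have "T ` (\<Inter>j. K j) = (\<Inter>j. K j)"
  proof (intro equalityI subsetI)
    fix h assume h: "h \<in> (\<Inter>j. K j)"
    show "h \<in> T ` (\<Inter>j. K j)"
      by (rule rev_image_eqI [of "adj T h"]) (use backward [OF h] in auto)
  qed (use forward in blast)
  moreover have "norm (T x) = norm x" if "x \<in> (\<Inter>j. K j)" for x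
    using g.norm_defect [of x] forward [OF that] by simp
  ultimately have simple: "(\<Inter>j. K j) = {0}"
    by (intro assms(3) [unfolded completely_nonunitary_def, rule_format] conjI ballI)
  have "snd (U 0 (0, h)) = T h" for h
    by (simp add: U0_eq)
  then show ?thesis
    by (intro conjI char_fun_schur_class unitarily_equivalent_cmv [OF tower simple])
qed

end
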